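(* Let $n\ge 1$ and let $W$ be the Weyl group $W(A_n)$, $W(B_n)$ or $W(D_{2n+1})$, realized on $N$ indices with $N=n+1$, $N=n$, $N=2n+1$ respectively. Then the $W$-module $\mathcal{M}$ is a Gelfand model for $W$.
   Context: A Gelfand model for a finite group is a complex representation that is isomorphic to the direct sum of all irreducible complex representations, each occurring exactly once. Groups: let $\mathbb{I}_N=\{1,\dots,N\}$, $\mathfrak{S}_N$ its permutation group, $\mathcal{C}_2=\{\pm1\}$. Put $W(B_N)=\mathcal{C}_2^N\rtimes\mathfrak{S}_N$, with elements $(\zeta,\pi)$, $\zeta=(\zeta_1,\dots,\zeta_N)$; $W(A_{N-1})=\{\boldsymbol{I}\}\times\mathfrak{S}_N\cong\mathfrak{S}_N$ (where $\boldsymbol{I}=(1,\dots,1)$); and $W(D_N)=\{(\zeta,\pi)\in W(B_N):\zeta_1\cdots\zeta_N=1\}$. The group structure is the one for which $(\zeta,\pi)\cdot x_i=\zeta_{\pi(i)}x_{\pi(i)}$ is a linear action on the span of $x_1,\dots,x_N$. Let $W$ be one of $W(A_{N-1}),W(B_N),W(D_N)$. For $\tau=(\zeta,\pi)\in W$ put $L_1^\tau=\{i:\pi(i)=i,\ \zeta_i=-1\}$, $L_2^\tau=\{i:\pi(i)\ne i,\ \zeta_{\pi(i)}=-1\}$, $Q_1^\tau=\{i:\pi(i)=i,\ \zeta_i=1\}$, $Q_2^\tau=\{i:\pi(i)\neq i,\ \zeta_{\pi(i)}=1\}$. Let $\mathcal{P}=\mathbb{C}[x_1,\dots,x_N]$,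 with $W$ acting by algebra automorphisms extending the action above. Let $V=\mathcal{P}\oplus(\mathcal{P}\wedge\mathcal{P})$ (second summand: exterior square) with the induced $W$-action, and let $W$ act on the symmetric algebra $S(V)$ by the induced algebra automorphisms. Let $\mathcal{I}=\{\tau\in W:\tau^2=1\}$ be the set of involutions of $W$ (including the identity). For $\tau=(\zeta,\pi)\in\mathcal{I}$ define the element of $S(V)$ $$e_\tau=\Big(\prod_{k\in L_1^\tau}x_k\Big)\Big(\prod_{m\in L_2^\tau,\ m<\pi(m)}(x_m\wedge x_{\pi(m)})\Big)\Big(\prod_{l\in Q_2^\tau,\ l<\pi(l)}(x_l^2\wedge x_{\pi(l)}^2)\Big),$$ where the products are taken in $S(V)$ and empty products equal $1$. Each $(\varepsilon,\eta)\in W$ sends $e_\tau$ to $\pm e_{\eta\tau\eta^{-1}}$. $\mathcal{M}\subseteq S(V)$ is the ($W$-invariant) linear span of $\{e_\tau:\tau\in\mathcal{I}\}$. *)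

theory Defs
  imports
    Complex_Main
    "HOL-Library.Poly_Mapping"
    "HOL-Library.Product_Plus"
    "HOL-Library.Cardinality"
    "HOL-Algebra.Group"
begin

section \<open>Complex vector spaces and commutative complex algebras\<close>

class complex_vector = ab_group_add +
  fixes scaleC :: "complex \<Rightarrow> 'a \<Rightarrow> 'a" (infixr \<open>*\<^sub>C\<close> 75)
  assumes scaleC_add_right: "a *\<^sub>C (x + y) = a *\<^sub>C x + a *\<^sub>C y"
    and scaleC_add_left: "(a + b) *\<^sub>C x = a *\<^sub>C x + b *\<^sub>C x"
    and scaleC_scaleC: "a *\<^sub>C b *\<^sub>C x = (a * b) *\<^sub>C x"
    and scaleC_one: "1 *\<^sub>C x = x"

class comm_complex_algebra_1 = complex_vector + comm_ring_1 +
  assumes mult_scaleC_left: "(a *\<^sub>C x) * y = a *\<^sub>C (x * y)"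

global_interpretation cvec: vector_space "scaleC :: complex \<Rightarrow> 'a \<Rightarrow> 'a::complex_vector"
  by unfold_locales (simp_all add: scaleC_add_right scaleC_add_left scaleC_scaleC scaleC_one)

abbreviation clinear :: "('a::complex_vector \<Rightarrow> 'b::complex_vector) \<Rightarrow> bool"
  where "clinear \<equiv> Vector_Spaces.linear scaleC scaleC"

lemma clinearI:
  assumes "\<And>x y. f (x + y) = f x + f y" "\<And>c x. f (c *\<^sub>C x) = c *\<^sub>C f x"
  shows "clinear f"
  by unfold_locales (use assms in auto)

lemma clinear_add: "clinear f \<Longrightarrow> f (x + y) = f x + f y"
  by (simp add: Vector_Spaces.linear_iff)

lemma clinear_scaleC: "clinear f \<Longrightarrow> f (c *\<^sub>C x) = c *\<^sub>C f x"
  by (simp add: Vector_Spaces.linear_iff)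

lemma mult_scaleC_right: "x * (a *\<^sub>C y) = a *\<^sub>C (x * (y :: 'a::comm_complex_algebra_1))"
  by (metis mult.commute mult_scaleC_left)

instantiation complex :: comm_complex_algebra_1
begin
definition scaleC_complex :: "complex \<Rightarrow> complex \<Rightarrow> complex" where "scaleC_complex = (*)"
instance
  by standard (simp_all add: scaleC_complex_def algebra_simps)
end

instantiation prod :: (complex_vector, complex_vector) complex_vector
begin
definition scaleC_prod :: "complex \<Rightarrow> 'a \<times> 'b \<Rightarrow> 'a \<times> 'b"
  where "scaleC_prod c v = (c *\<^sub>C fst v, c *\<^sub>C snd v)"
instance
  by standard (simp_all add: scaleC_prod_def prod_eq_iff scaleC_add_right scaleC_add_left
      scaleC_scaleC scaleC_one)
end

instantiation poly_mapping :: (type, complex_vector) complex_vector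
begin
lift_definition scaleC_poly_mapping :: "complex \<Rightarrow> ('a \<Rightarrow>\<^sub>0 'b) \<Rightarrow> 'a \<Rightarrow>\<^sub>0 'b"
  is "\<lambda>c f k. c *\<^sub>C f k"
  by (auto elim!: rev_finite_subset)
instance
  by (standard; transfer)
    (simp_all add: fun_eq_iff scaleC_add_right scaleC_add_left scaleC_scaleC scaleC_one)
end

lemma lookup_scaleC [simp]: "Poly_Mapping.lookup (c *\<^sub>C p) k = c *\<^sub>C Poly_Mapping.lookup p k"
  by transfer simp

lemma scaleC_single: "c *\<^sub>C Poly_Mapping.single k a = Poly_Mapping.single k (c *\<^sub>C a)"
  by (rule poly_mapping_eqI) (simp add: lookup_single when_def)

lemma poly_mapping_induct [case_names single add]:
  assumes 1: "\<And>k a. P (Poly_Mapping.single k a)" and 2: "\<And>p q. P p \<Longrightarrow> P q \<Longrightarrow> P (p + q)"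
  shows "P (p :: 'a \<Rightarrow>\<^sub>0 'b::monoid_add)"
proof (induction p rule: update_induct)
  case const
  show ?case
    using 1[of undefined 0] by simp
next
  case (update p k a)
  then have "Poly_Mapping.update k a p = p + Poly_Mapping.single k a"
    by (intro poly_mapping_eqI)
      (auto simp: lookup_update lookup_add lookup_single in_keys_iff when_def)
  with update 1 2 show ?case
    by simp
qed

instance poly_mapping :: (comm_monoid_add, comm_complex_algebra_1) comm_complex_algebra_1
proof
  fix c and p q :: "'a \<Rightarrow>\<^sub>0 'b"
  have 1: "c *\<^sub>C (Poly_Mapping.single k a * q) = Poly_Mapping.single k (c *\<^sub>C a) * q" for k a
    by (induction q rule: poly_mapping_induct)
      (simp_all add: mult_single scaleC_single mult_scaleC_left distrib_left scaleC_add_right)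
  show "(c *\<^sub>C p) * q = c *\<^sub>C (p * q)"
    by (induction p rule: poly_mapping_induct)
      (simp_all add: 1 scaleC_single distrib_right scaleC_add_right)
qed

section \<open>Polynomial algebras\<close>

text \<open>A polynomial in variables indexed by \<^typ>\<open>'x\<close> is a finitely supported family of complex
  coefficients, indexed by finitely supported exponent vectors.\<close>

type_synonym 'x cpoly = "('x \<Rightarrow>\<^sub>0 nat) \<Rightarrow>\<^sub>0 complex"

definition var :: "'x \<Rightarrow> 'x cpoly"
  where "var x = Poly_Mapping.single (Poly_Mapping.single x 1) 1"

text \<open>\<open>lin_ext f\<close> is the linear extension of \<open>f\<close> to the vector space with basis \<^typ>\<open>'k\<close>;
  \<open>poly_eval f\<close> is the algebra homomorphism mapping the variable \<open>x\<close> to \<open>f x\<close>.\<close>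

definition lin_ext :: "('k \<Rightarrow> 'w::complex_vector) \<Rightarrow> ('k \<Rightarrow>\<^sub>0 complex) \<Rightarrow> 'w"
  where "lin_ext f p = (\<Sum>k\<in>Poly_Mapping.keys p. Poly_Mapping.lookup p k *\<^sub>C f k)"

definition monom_eval :: "('x \<Rightarrow> 'w::comm_monoid_mult) \<Rightarrow> ('x \<Rightarrow>\<^sub>0 nat) \<Rightarrow> 'w"
  where "monom_eval f m = (\<Prod>x\<in>Poly_Mapping.keys m. f x ^ Poly_Mapping.lookup m x)"

definition poly_eval :: "('x \<Rightarrow> 'w::comm_complex_algebra_1) \<Rightarrow> 'x cpoly \<Rightarrow> 'w"
  where "poly_eval f = lin_ext (monom_eval f)"

lemma lin_ext_superset:
  assumes "finite S" "Poly_Mapping.keys p \<subseteq> S"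
  shows "lin_ext f p = (\<Sum>k\<in>S. Poly_Mapping.lookup p k *\<^sub>C f k)"
  unfolding lin_ext_def
  by (rule sum.mono_neutral_left) (use assms in \<open>auto simp: in_keys_iff\<close>)

lemma clinear_lin_ext: "clinear (lin_ext f)"
proof (rule clinearI)
  fix p q :: "'a \<Rightarrow>\<^sub>0 complex" and c
  let ?S = "Poly_Mapping.keys p \<union> Poly_Mapping.keys q"
  have "Poly_Mapping.keys (p + q) \<subseteq> ?S"
    by (rule keys_add)
  then show "lin_ext f (p + q) = lin_ext f p + lin_ext f q"
    by (simp add: lin_ext_superset[of ?S] lookup_add scaleC_add_left sum.distrib)
  have "Poly_Mapping.keys (c *\<^sub>C p) \<subseteq> Poly_Mapping.keys p"
    by (auto simp: in_keys_iff)
  then show "lin_ext f (c *\<^sub>C p) = c *\<^sub>C lin_ext f p"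
    by (simp add: lin_ext_superset[of "Poly_Mapping.keys p"] cvec.scale_sum_right
        scaleC_complex_def)
qed

lemma lin_ext_single [simp]: "lin_ext f (Poly_Mapping.single k c) = c *\<^sub>C f k"
  by (simp add: lin_ext_def)

lemma monom_eval_add: "monom_eval f (m + n) = monom_eval f m * monom_eval f n"
proof -
  let ?S = "Poly_Mapping.keys m \<union> Poly_Mapping.keys n"
  have *: "monom_eval f p = (\<Prod>x\<in>?S. f x ^ Poly_Mapping.lookup p x)"
    if "Poly_Mapping.keys p \<subseteq> ?S" for p
    unfolding monom_eval_def
    by (rule prod.mono_neutral_left) (use that in \<open>auto simp: in_keys_iff\<close>)
  show ?thesis
    using keys_add[of m n] by (simp add: * lookup_add power_add prod.distrib)
qed

lemma poly_eval_add: "poly_eval f (p + q) = poly_eval f p + poly_eval f q"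
  unfolding poly_eval_def by (rule clinear_add[OF clinear_lin_ext])

lemma poly_eval_scaleC: "poly_eval f (c *\<^sub>C p) = c *\<^sub>C poly_eval f p"
  unfolding poly_eval_def by (rule clinear_scaleC[OF clinear_lin_ext])

lemma poly_eval_diff: "poly_eval f (p - q) = poly_eval f p - poly_eval f q"
  by (metis add_diff_cancel_right' diff_add_cancel poly_eval_add)

lemma poly_eval_zero [simp]: "poly_eval f 0 = 0"
  by (metis diff_self poly_eval_diff)

lemma poly_eval_one [simp]: "poly_eval f 1 = 1"
  by (simp add: poly_eval_def monom_eval_def scaleC_one flip: single_one)

lemma poly_eval_var [simp]: "poly_eval f (var x) = f x"
  by (simp add: poly_eval_def monom_eval_def var_def scaleC_one)

lemma poly_eval_mult: "poly_eval f (p * q) = poly_eval f p * poly_eval f q"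
proof -
  have 1: "poly_eval f (Poly_Mapping.single k a * q)
      = poly_eval f (Poly_Mapping.single k a) * poly_eval f q" for k a
  proof (induction q rule: poly_mapping_induct)
    case (single k' b)
    show ?case
      by (simp add: mult_single poly_eval_def monom_eval_add mult_scaleC_left mult_scaleC_right
          scaleC_scaleC mult.commute)
  qed (simp_all add: distrib_left poly_eval_add)
  show ?thesis
    by (induction p rule: poly_mapping_induct) (simp_all add: 1 distrib_right poly_eval_add)
qed

section \<open>Exterior square\<close>

definition ext2_relators :: "('v::complex_vector \<times> 'v \<Rightarrow>\<^sub>0 complex) set" where
  "ext2_relators = (let s = (\<lambda>a b. Poly_Mapping.single (a, b) 1) in
      {s (a + b) d - s a d - s b d |a b d. True}
    \<union> {s a (b + d) - s a b - s a d |a b d. True}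
    \<union> {s (c *\<^sub>C a) b - c *\<^sub>C s a b |a b c. True}
    \<union> {s a (c *\<^sub>C b) - c *\<^sub>C s a b |a b c. True}
    \<union> {s a a |a. True})"

definition ext2_eq :: "('v::complex_vector \<times> 'v \<Rightarrow>\<^sub>0 complex) \<Rightarrow> ('v \<times> 'v \<Rightarrow>\<^sub>0 complex) \<Rightarrow> bool"
  where "ext2_eq x y \<longleftrightarrow> x - y \<in> cvec.span ext2_relators"

lemma equivp_ext2_eq: "equivp ext2_eq"
proof (rule equivpI)
  show "reflp ext2_eq"
    by (auto simp: reflp_def ext2_eq_def cvec.span_zero)
  show "symp ext2_eq"
    unfolding symp_def ext2_eq_def by (metis cvec.span_neg minus_diff_eq)
  show "transp ext2_eq"
    unfolding transp_def ext2_eq_def by (auto dest: cvec.span_add)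
qed

quotient_type (overloaded) 'v ext2 = "('v::complex_vector \<times> 'v) \<Rightarrow>\<^sub>0 complex" / ext2_eq
  by (rule equivp_ext2_eq)

instantiation ext2 :: (complex_vector) complex_vector
begin
lift_definition zero_ext2 :: "'a ext2" is 0 .
lift_definition plus_ext2 :: "'a ext2 \<Rightarrow> 'a ext2 \<Rightarrow> 'a ext2" is "(+)"
  unfolding ext2_eq_def by (drule (1) cvec.span_add) (simp add: algebra_simps)
lift_definition uminus_ext2 :: "'a ext2 \<Rightarrow> 'a ext2" is uminus
  unfolding ext2_eq_def by (drule cvec.span_neg) (simp add: algebra_simps)
lift_definition minus_ext2 :: "'a ext2 \<Rightarrow> 'a ext2 \<Rightarrow> 'a ext2" is "(-)"
  unfolding ext2_eq_def
  by (drule (1) cvec.span_diff) (simp add: algebra_simps)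
lift_definition scaleC_ext2 :: "complex \<Rightarrow> 'a ext2 \<Rightarrow> 'a ext2" is scaleC
  unfolding ext2_eq_def by (simp add: cvec.span_scale flip: cvec.scale_right_diff_distrib)
instance
proof
  fix x y z :: "'a ext2" and a b
  obtain p q r where [simp]: "x = abs_ext2 p" "y = abs_ext2 q" "z = abs_ext2 r"
    by (metis Quotient3_ext2 Quotient3_def)
  note [simp] = zero_ext2_def plus_ext2.abs_eq uminus_ext2.abs_eq minus_ext2.abs_eq
    scaleC_ext2.abs_eq
  show "x + y + z = x + (y + z)" "x + y = y + x" "0 + x = x" "- x + x = 0" "x - y = x + - y"
    by (simp_all add: ac_simps)
  show "a *\<^sub>C (x + y) = a *\<^sub>C x + a *\<^sub>C y" "(a + b) *\<^sub>C x = a *\<^sub>C x + b *\<^sub>C x"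
    "a *\<^sub>C b *\<^sub>C x = (a * b) *\<^sub>C x" "1 *\<^sub>C x = x"
    by (simp_all add: scaleC_add_right scaleC_add_left scaleC_scaleC scaleC_one)
qed
end

lift_definition wedge :: "'v::complex_vector \<Rightarrow> 'v \<Rightarrow> 'v ext2" (infixl \<open>\<and>\<^sub>2\<close> 70)
  is "\<lambda>a b. Poly_Mapping.single (a, b) 1" .

text \<open>The map on the exterior square induced by a bilinear map \<open>B\<close>. It is computed on an arbitrary
  representative, and hence is meaningful only if \<open>B\<close> is bilinear and alternating.\<close>

definition ext2_lift :: "('v::complex_vector \<Rightarrow> 'v \<Rightarrow> 'w::complex_vector) \<Rightarrow> 'v ext2 \<Rightarrow> 'w"
  where "ext2_lift B x = lin_ext (\<lambda>(a, b). B a b) (rep_ext2 x)"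

definition ext2_map :: "('v::complex_vector \<Rightarrow> 'w::complex_vector) \<Rightarrow> 'v ext2 \<Rightarrow> 'w ext2"
  where "ext2_map f = ext2_lift (\<lambda>a b. f a \<and>\<^sub>2 f b)"

lemma ext2_lift_abs:
  assumes 1: "\<And>b. clinear (\<lambda>a. B a b)" and 2: "\<And>a. clinear (B a)" and 3: "\<And>a. B a a = 0"
  shows "ext2_lift B (abs_ext2 p) = lin_ext (\<lambda>(a, b). B a b) p"
proof -
  let ?L = "lin_ext (\<lambda>(a, b). B a b)"
  interpret L: Vector_Spaces.linear scaleC scaleC ?L by (rule clinear_lin_ext)
  have "?L q = 0" if "q \<in> ext2_relators" for q
    using that unfolding ext2_relators_def Let_def
    by (auto simp: L.diff L.scale clinear_add[OF 1] clinear_add[OF 2] clinear_scaleC[OF 1]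
        clinear_scaleC[OF 2] 3 scaleC_one)
  then have 0: "?L q = 0" if "q \<in> cvec.span ext2_relators" for q
    using L.eq_0_on_span that by blast
  have "ext2_eq (rep_ext2 (abs_ext2 p)) p"
    by (meson Quotient3_ext2 equivp_ext2_eq equivp_reflp rep_abs_rsp_left)
  then have "?L (rep_ext2 (abs_ext2 p) - p) = 0"
    by (intro 0) (simp add: ext2_eq_def)
  then show ?thesis
    by (simp add: ext2_lift_def L.diff)
qed

lemma ext2_lift_wedge:
  assumes "\<And>b. clinear (\<lambda>a. B a b)" "\<And>a. clinear (B a)" "\<And>a. B a a = 0"
  shows "ext2_lift B (a \<and>\<^sub>2 b) = B a b"
  using ext2_lift_abs[OF assms] by (simp add: wedge_def scaleC_one)

lemma clinear_ext2_lift: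
  assumes "\<And>b. clinear (\<lambda>a. B a b)" "\<And>a. clinear (B a)" "\<And>a. B a a = 0"
  shows "clinear (ext2_lift B)"
proof (rule clinearI)
  fix x y :: "'a ext2" and c
  obtain p q where [simp]: "x = abs_ext2 p" "y = abs_ext2 q"
    by (metis Quotient3_ext2 Quotient3_def)
  show "ext2_lift B (x + y) = ext2_lift B x + ext2_lift B y"
    by (simp add: ext2_lift_abs[OF assms] plus_ext2.abs_eq clinear_add[OF clinear_lin_ext])
  show "ext2_lift B (c *\<^sub>C x) = c *\<^sub>C ext2_lift B x"
    by (simp add: ext2_lift_abs[OF assms] scaleC_ext2.abs_eq clinear_scaleC[OF clinear_lin_ext])
qed

lemma wedge_add_left: "(a + b) \<and>\<^sub>2 c = a \<and>\<^sub>2 c + b \<and>\<^sub>2 c"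
  by transfer
    (unfold ext2_eq_def diff_diff_eq[symmetric], rule cvec.span_base,
      simp add: ext2_relators_def Let_def, blast)

lemma wedge_add_right: "a \<and>\<^sub>2 (b + c) = a \<and>\<^sub>2 b + a \<and>\<^sub>2 c"
  by transfer
    (unfold ext2_eq_def diff_diff_eq[symmetric], rule cvec.span_base,
      simp add: ext2_relators_def Let_def, blast)

lemma wedge_scaleC_left: "(c *\<^sub>C a) \<and>\<^sub>2 b = c *\<^sub>C (a \<and>\<^sub>2 b)"
  by transfer
    (unfold ext2_eq_def, rule cvec.span_base, simp add: ext2_relators_def Let_def, blast)

lemma wedge_scaleC_right: "a \<and>\<^sub>2 (c *\<^sub>C b) = c *\<^sub>C (a \<and>\<^sub>2 b)"
  by transfer
    (unfold ext2_eq_def, rule cvec.span_base, simp add: ext2_relators_def Let_def, blast)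

lemma wedge_self [simp]: "a \<and>\<^sub>2 a = 0"
  by transfer
    (unfold ext2_eq_def diff_zero, rule cvec.span_base, simp add: ext2_relators_def Let_def, blast)

lemma
  assumes "clinear f"
  shows ext2_map_wedge: "ext2_map f (a \<and>\<^sub>2 b) = f a \<and>\<^sub>2 f b"
    and clinear_ext2_map: "clinear (ext2_map f)"
proof -
  have 1: "clinear (\<lambda>a. f a \<and>\<^sub>2 f b)" "clinear (\<lambda>b. f a \<and>\<^sub>2 f b)" for a b
    by (rule clinearI; simp add: clinear_add[OF assms] clinear_scaleC[OF assms]
        wedge_add_left wedge_add_right wedge_scaleC_left wedge_scaleC_right)+
  show "ext2_map f (a \<and>\<^sub>2 b) = f a \<and>\<^sub>2 f b" "clinear (ext2_map f)"
    unfolding ext2_map_def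
    by (rule ext2_lift_wedge clinear_ext2_lift; simp add: 1)+
qed

section \<open>Symmetric algebra\<close>

text \<open>\<open>S(V)\<close> is the polynomial algebra with one variable for each vector of \<open>V\<close>, modulo the ideal
  generated by the linear relations between the vectors.\<close>

definition sym_relators :: "'v::complex_vector cpoly set" where
  "sym_relators =
      {var (a + b) - var a - var b |a b. True} \<union> {var (c *\<^sub>C a) - c *\<^sub>C var a |c a. True}"

lemma module_times: "module ((*) :: 'a \<Rightarrow> 'a \<Rightarrow> 'a::comm_ring_1)"
  by unfold_locales (simp_all add: algebra_simps)

lemmas ideal_span =
  module.span_zero[OF module_times] module.span_neg[OF module_times]
  module.span_add[OF module_times] module.span_diff[OF module_times]
  module.span_scale[OF module_times] module.span_base[OF module_times]

definition sym_eq :: "'v::complex_vector cpoly \<Rightarrow> 'v cpoly \<Rightarrow> bool"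
  where "sym_eq x y \<longleftrightarrow> x - y \<in> module.span (*) sym_relators"

lemma equivp_sym_eq: "equivp sym_eq"
proof (rule equivpI)
  show "reflp sym_eq"
    by (auto simp: reflp_def sym_eq_def ideal_span(1))
  show "symp sym_eq"
    unfolding symp_def sym_eq_def by (metis ideal_span(2) minus_diff_eq)
  show "transp sym_eq"
    unfolding transp_def sym_eq_def by (auto dest: ideal_span(3))
qed

quotient_type (overloaded) 'v symalg = "('v::complex_vector) cpoly" / sym_eq
  by (rule equivp_sym_eq)

lemma poly_eval_sym_eq:
  assumes "clinear f" "sym_eq p q"
  shows "poly_eval f p = poly_eval f q"
proof -
  have "poly_eval f r = 0" if "r \<in> module.span (*) sym_relators" for r
    using that
  proof (induction rule: module.span_induct_alt[OF module_times, consumes 1, case_names base step])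
    case (step c x y)
    then have "poly_eval f x = 0"
      by (auto simp: sym_relators_def poly_eval_diff poly_eval_scaleC
          clinear_add[OF assms(1)] clinear_scaleC[OF assms(1)])
    with step show ?case
      by (simp add: poly_eval_add poly_eval_mult)
  qed simp
  with assms(2) show ?thesis
    by (metis sym_eq_def poly_eval_diff right_minus_eq)
qed

lemma not_sym_eq_0_1: "\<not> sym_eq (0 :: 'v::complex_vector cpoly) 1"
proof
  have "clinear (\<lambda>v::'v. 0 :: complex)"
    by (rule clinearI) simp_all
  moreover assume "sym_eq (0 :: 'v cpoly) 1"
  ultimately have "poly_eval (\<lambda>v::'v. 0 :: complex) 0 = poly_eval (\<lambda>v::'v. 0) 1"
    by (rule poly_eval_sym_eq)
  then show False
    by simp
qed

instantiation symalg :: (complex_vector) complex_vector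
begin
lift_definition zero_symalg :: "'a symalg" is 0 .
lift_definition plus_symalg :: "'a symalg \<Rightarrow> 'a symalg \<Rightarrow> 'a symalg" is "(+)"
  unfolding sym_eq_def by (drule (1) ideal_span(3)) (simp add: algebra_simps)
lift_definition uminus_symalg :: "'a symalg \<Rightarrow> 'a symalg" is uminus
  unfolding sym_eq_def by (drule ideal_span(2)) (simp add: algebra_simps)
lift_definition minus_symalg :: "'a symalg \<Rightarrow> 'a symalg \<Rightarrow> 'a symalg" is "(-)"
  unfolding sym_eq_def by (drule (1) ideal_span(4)) (simp add: algebra_simps)
lift_definition scaleC_symalg :: "complex \<Rightarrow> 'a symalg \<Rightarrow> 'a symalg" is scaleC
proof -
  fix c and p q :: "'a cpoly"
  assume "sym_eq p q"
  then have "(c *\<^sub>C 1) * (p - q) \<in> module.span (*) sym_relators"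
    unfolding sym_eq_def by (intro ideal_span(5))
  then show "sym_eq (c *\<^sub>C p) (c *\<^sub>C q)"
    by (simp add: sym_eq_def mult_scaleC_left cvec.scale_right_diff_distrib)
qed
instance
proof
  fix x y z :: "'a symalg" and a b
  obtain p q r where [simp]: "x = abs_symalg p" "y = abs_symalg q" "z = abs_symalg r"
    by (metis Quotient3_symalg Quotient3_def)
  note [simp] = zero_symalg_def plus_symalg.abs_eq uminus_symalg.abs_eq minus_symalg.abs_eq
    scaleC_symalg.abs_eq
  show "x + y + z = x + (y + z)" "x + y = y + x" "0 + x = x" "- x + x = 0" "x - y = x + - y"
    by (simp_all add: ac_simps)
  show "a *\<^sub>C (x + y) = a *\<^sub>C x + a *\<^sub>C y" "(a + b) *\<^sub>C x = a *\<^sub>C x + b *\<^sub>C x"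
    "a *\<^sub>C b *\<^sub>C x = (a * b) *\<^sub>C x" "1 *\<^sub>C x = x"
    by (simp_all add: scaleC_add_right scaleC_add_left scaleC_scaleC scaleC_one)
qed
end

instantiation symalg :: (complex_vector) comm_ring_1
begin
lift_definition one_symalg :: "'a symalg" is 1 .
lift_definition times_symalg :: "'a symalg \<Rightarrow> 'a symalg \<Rightarrow> 'a symalg" is "(*)"
proof -
  fix p p' q q' :: "'a cpoly"
  assume "sym_eq p p'" "sym_eq q q'"
  then have "p * (q - q') + q' * (p - p') \<in> module.span (*) sym_relators"
    unfolding sym_eq_def by (intro ideal_span(3) ideal_span(5))
  then show "sym_eq (p * q) (p' * q')"
    by (simp add: sym_eq_def algebra_simps)
qed
instance
proof
  fix x y z :: "'a symalg"
  obtain p q r where [simp]: "x = abs_symalg p" "y = abs_symalg q" "z = abs_symalg r"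
    by (metis Quotient3_symalg Quotient3_def)
  note [simp] = zero_symalg_def one_symalg_def plus_symalg.abs_eq times_symalg.abs_eq
  show "x * y * z = x * (y * z)" "x * y = y * x"
    by (simp_all add: ac_simps)
  show "1 * x = x" "(x + y) * z = x * z + y * z"
    by (simp_all add: distrib_right)
  show "(0 :: 'a symalg) \<noteq> 1"
    using not_sym_eq_0_1 by (simp add: symalg.abs_eq_iff)
qed
end

instance symalg :: (complex_vector) comm_complex_algebra_1
proof
  fix c and x y :: "'a symalg"
  obtain p q where [simp]: "x = abs_symalg p" "y = abs_symalg q"
    by (metis Quotient3_symalg Quotient3_def)
  show "(c *\<^sub>C x) * y = c *\<^sub>C (x * y)"
    by (simp add: times_symalg.abs_eq scaleC_symalg.abs_eq mult_scaleC_left)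
qed

lift_definition sym_inj :: "'v::complex_vector \<Rightarrow> 'v symalg" is var .

text \<open>The algebra homomorphism on \<open>S(V)\<close> induced by \<open>f\<close>. It is computed on an arbitrary
  representative, and hence is meaningful only if \<open>f\<close> is linear.\<close>

definition sym_lift :: "('v::complex_vector \<Rightarrow> 'w::comm_complex_algebra_1) \<Rightarrow> 'v symalg \<Rightarrow> 'w"
  where "sym_lift f x = poly_eval f (rep_symalg x)"

definition sym_map :: "('v::complex_vector \<Rightarrow> 'w::complex_vector) \<Rightarrow> 'v symalg \<Rightarrow> 'w symalg"
  where "sym_map f = sym_lift (\<lambda>v. sym_inj (f v))"

lemma clinear_sym_inj: "clinear sym_inj"
proof (rule clinearI)
  fix a b :: 'a and c
  show "sym_inj (a + b) = sym_inj a + sym_inj b"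
    by transfer
      (unfold sym_eq_def diff_diff_eq[symmetric], rule ideal_span(6),
        simp add: sym_relators_def, blast)
  show "sym_inj (c *\<^sub>C a) = c *\<^sub>C sym_inj a"
    by transfer (unfold sym_eq_def, rule ideal_span(6), simp add: sym_relators_def, blast)
qed

lemma sym_lift_abs: "clinear f \<Longrightarrow> sym_lift f (abs_symalg p) = poly_eval f p"
  unfolding sym_lift_def
  by (rule poly_eval_sym_eq)
    (auto intro: rep_abs_rsp_left[OF Quotient3_symalg] equivp_reflp[OF equivp_sym_eq])

lemma
  assumes "clinear f"
  shows sym_lift_inj: "sym_lift f (sym_inj v) = f v"
    and sym_lift_one: "sym_lift f 1 = 1"
    and sym_lift_add: "sym_lift f (x + y) = sym_lift f x + sym_lift f y"
    and sym_lift_mult: "sym_lift f (x * y) = sym_lift f x * sym_lift f y"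
    and sym_lift_scaleC: "sym_lift f (c *\<^sub>C x) = c *\<^sub>C sym_lift f x"
proof -
  obtain p q where [simp]: "x = abs_symalg p" "y = abs_symalg q"
    by (metis Quotient3_symalg Quotient3_def)
  note [simp] = sym_lift_abs[OF assms]
  show "sym_lift f (sym_inj v) = f v"
    by (simp add: sym_inj_def)
  show "sym_lift f 1 = 1"
    by (simp add: one_symalg_def)
  show "sym_lift f (x + y) = sym_lift f x + sym_lift f y"
    by (simp add: plus_symalg.abs_eq poly_eval_add)
  show "sym_lift f (x * y) = sym_lift f x * sym_lift f y"
    by (simp add: times_symalg.abs_eq poly_eval_mult)
  show "sym_lift f (c *\<^sub>C x) = c *\<^sub>C sym_lift f x"
    by (simp add: scaleC_symalg.abs_eq poly_eval_scaleC)
qed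

lemma sym_map_inj: "clinear f \<Longrightarrow> sym_map f (sym_inj v) = sym_inj (f v)"
  unfolding sym_map_def
  by (rule sym_lift_inj, rule clinearI)
    (simp_all add: clinear_add clinear_scaleC clinear_sym_inj)

section \<open>Representations and Gelfand models\<close>

text \<open>The space of a representation is a linear subspace \<open>V\<close> of a type of vectors; the behaviour of
  \<open>\<rho>\<close> outside \<open>carrier G\<close> and \<open>V\<close> is irrelevant.\<close>

locale complex_rep = group G for G (structure) +
  fixes V :: "'v::complex_vector set" and \<rho> :: "'g \<Rightarrow> 'v \<Rightarrow> 'v"
  assumes subspace: "cvec.subspace V"
    and closed: "g \<in> carrier G \<Longrightarrow> v \<in> V \<Longrightarrow> \<rho> g v \<in> V"
    and add: "g \<in> carrier G \<Longrightarrow> v \<in> V \<Longrightarrow> w \<in> V \<Longrightarrow> \<rho> g (v + w) = \<rho> g v + \<rho> g w"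
    and scaleC: "g \<in> carrier G \<Longrightarrow> v \<in> V \<Longrightarrow> \<rho> g (c *\<^sub>C v) = c *\<^sub>C \<rho> g v"
    and one: "v \<in> V \<Longrightarrow> \<rho> \<one> v = v"
    and mult: "g \<in> carrier G \<Longrightarrow> h \<in> carrier G \<Longrightarrow> v \<in> V \<Longrightarrow> \<rho> (g \<otimes> h) v = \<rho> g (\<rho> h v)"

definition irreducible_rep ::
    "('g, 'm) monoid_scheme \<Rightarrow> 'v::complex_vector set \<Rightarrow> ('g \<Rightarrow> 'v \<Rightarrow> 'v) \<Rightarrow> bool" where
  "irreducible_rep G V \<rho> \<longleftrightarrow> complex_rep G V \<rho> \<and> V \<noteq> {0} \<and>
     (\<forall>U. cvec.subspace U \<longrightarrow> U \<subseteq> V \<longrightarrow> (\<forall>g\<in>carrier G. \<rho> g ` U \<subseteq> U) \<longrightarrow> U = {0} \<or> U = V)"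

definition isomorphic_reps ::
    "('g, 'm) monoid_scheme \<Rightarrow> 'v::complex_vector set \<Rightarrow> ('g \<Rightarrow> 'v \<Rightarrow> 'v) \<Rightarrow>
     'w::complex_vector set \<Rightarrow> ('g \<Rightarrow> 'w \<Rightarrow> 'w) \<Rightarrow> bool" where
  "isomorphic_reps G V \<rho> W \<sigma> \<longleftrightarrow> (\<exists>f. bij_betw f V W \<and>
     (\<forall>v\<in>V. \<forall>w\<in>V. f (v + w) = f v + f w) \<and>
     (\<forall>c. \<forall>v\<in>V. f (c *\<^sub>C v) = c *\<^sub>C f v) \<and>
     (\<forall>g\<in>carrier G. \<forall>v\<in>V. f (\<rho> g v) = \<sigma> g (f v)))"

text \<open>External direct sum: the finitely supported families with \<open>i\<close>-th member in \<open>U i\<close>.\<close>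

definition dsum_space :: "'i set \<Rightarrow> ('i \<Rightarrow> 'v::complex_vector set) \<Rightarrow> ('i \<Rightarrow>\<^sub>0 'v) set" where
  "dsum_space I U =
     {f. Poly_Mapping.keys f \<subseteq> I \<and> (\<forall>i\<in>I. Poly_Mapping.lookup f i \<in> U i)}"

definition dsum_action ::
    "('i \<Rightarrow> 'g \<Rightarrow> 'v::complex_vector \<Rightarrow> 'v) \<Rightarrow> 'g \<Rightarrow> ('i \<Rightarrow>\<^sub>0 'v) \<Rightarrow> ('i \<Rightarrow>\<^sub>0 'v)" where
  "dsum_action \<sigma> g = Poly_Mapping.mapp (\<lambda>i. \<sigma> i g)"

text \<open>The irreducible representations are taken on subspaces of the space of finitely supported
  complex sequences, which contains a copy of every finite-dimensional vector space. Up to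
  isomorphism this covers all irreducible representations of a finite group; see
  \<open>irreducible_rep_on_sequences\<close> below.\<close>

definition gelfand_model ::
    "('g, 'm) monoid_scheme \<Rightarrow> 'v::complex_vector set \<Rightarrow> ('g \<Rightarrow> 'v \<Rightarrow> 'v) \<Rightarrow> bool" where
  "gelfand_model G V \<rho> \<longleftrightarrow> finite (carrier G) \<and> complex_rep G V \<rho> \<and>
     (\<exists>(I :: nat set) (U :: nat \<Rightarrow> (nat \<Rightarrow>\<^sub>0 complex) set) \<sigma>.
        (\<forall>i\<in>I. irreducible_rep G (U i) (\<sigma> i)) \<and>
        (\<forall>(U' :: (nat \<Rightarrow>\<^sub>0 complex) set) \<sigma>'. irreducible_rep G U' \<sigma>' \<longrightarrow>
           (\<exists>!i. i \<in> I \<and> isomorphic_reps G U' \<sigma>' (U i) (\<sigma> i))) \<and>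
        isomorphic_reps G V \<rho> (dsum_space I U) (dsum_action \<sigma>))"

lemma irreducible_rep_isomorphic:
  assumes V: "irreducible_rep G V \<rho>"
    and f: "clinear f" "inj_on f V"
  defines "\<sigma> \<equiv> \<lambda>g w. f (\<rho> g (inv_into V f w))"
  shows "irreducible_rep G (f ` V) \<sigma>" "isomorphic_reps G V \<rho> (f ` V) \<sigma>"
proof -
  interpret complex_rep G V \<rho>
    using V by (simp add: irreducible_rep_def)
  interpret f: Vector_Spaces.linear scaleC scaleC f by (rule f)
  have [simp]: "\<sigma> g (f v) = f (\<rho> g v)" if "v \<in> V" for g v
    using that f(2) by (simp add: \<sigma>_def)
  note sub = cvec.subspace_add[OF subspace] cvec.subspace_scale[OF subspace]
  have rep: "complex_rep G (f ` V) \<sigma>"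
  proof
    show "cvec.subspace (f ` V)"
      using subspace by (rule f.subspace_image)
  qed (auto simp: closed add scaleC one mult sub simp flip: f.add f.scale)
  show "isomorphic_reps G V \<rho> (f ` V) \<sigma>"
    unfolding isomorphic_reps_def
    by (rule exI[of _ f]) (use f(2) in \<open>auto simp: bij_betw_def f.add f.scale\<close>)
  show "irreducible_rep G (f ` V) \<sigma>"
    unfolding irreducible_rep_def
  proof (intro conjI allI impI)
    show "f ` V \<noteq> {0}"
      using V f(2) cvec.subspace_0[OF subspace]
      by (metis f.zero inj_on_image_eq_iff image_insert image_empty irreducible_rep_def
          empty_subsetI insert_subset order_refl)
  next
    fix U assume U: "cvec.subspace U" "U \<subseteq> f ` V" "\<forall>g\<in>carrier G. \<sigma> g ` U \<subseteq> U"
    define T where "T = f -` U \<inter> V"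
    have fT: "f ` T = U"
      using U(2) by (auto simp: T_def)
    have "cvec.subspace T"
      unfolding T_def using f.subspace_vimage[OF U(1)] subspace by (rule cvec.subspace_inter)
    moreover have "T \<subseteq> V" "\<forall>g\<in>carrier G. \<rho> g ` T \<subseteq> T"
      using U(3) closed by (force simp: T_def)+
    ultimately have "T = {0} \<or> T = V"
      using V by (auto simp: irreducible_rep_def)
    then show "U = {0} \<or> U = f ` V"
      using fT by auto
  qed (rule rep)
qed

lemma irreducible_rep_on_sequences:
  fixes V :: "'v::complex_vector set"
  assumes V: "irreducible_rep G V \<rho>" and fin: "finite (carrier G)"
  shows "\<exists>(U :: (nat \<Rightarrow>\<^sub>0 complex) set) \<sigma>. irreducible_rep G U \<sigma> \<and> isomorphic_reps G V \<rho> U \<sigma>"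
proof -
  interpret complex_rep G V \<rho>
    using V by (simp add: irreducible_rep_def)
  obtain v where v: "v \<in> V" "v \<noteq> 0"
    using V cvec.subspace_0[OF subspace] by (auto simp: irreducible_rep_def)
  define S where "S = (\<lambda>g. \<rho> g v) ` carrier G"
  have 0: "\<rho> g 0 = 0" if "g \<in> carrier G" for g
    using scaleC[OF that v(1), of 0] by simp
  note sub = cvec.subspace_add[OF subspace] cvec.subspace_scale[OF subspace]
    cvec.subspace_0[OF subspace]
  have inv: "cvec.span S \<subseteq> {u \<in> V. \<rho> g u \<in> cvec.span S}" if g: "g \<in> carrier G" for g
  proof (rule cvec.span_minimal)
    have "\<rho> g (\<rho> h v) \<in> S" if "h \<in> carrier G" for h
      using mult[OF g that v(1)] g that unfolding S_def by (metis image_eqI m_closed)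
    then show "S \<subseteq> {u \<in> V. \<rho> g u \<in> cvec.span S}"
      using v(1) closed by (auto simp: S_def intro!: cvec.span_base)
    show "cvec.subspace {u \<in> V. \<rho> g u \<in> cvec.span S}"
      using g sub by (auto simp: cvec.subspace_def 0 add scaleC cvec.span_zero cvec.span_add
          cvec.span_scale)
  qed
  have "v \<in> cvec.span S"
    unfolding S_def by (intro cvec.span_base image_eqI[where x = "\<one>\<^bsub>G\<^esub>"]) (simp_all add: one v)
  moreover have "cvec.span S \<subseteq> V" "\<forall>g\<in>carrier G. \<rho> g ` cvec.span S \<subseteq> cvec.span S"
    using inv[OF one_closed] by (auto dest: inv[THEN subsetD])
  ultimately have VS: "V = cvec.span S"
    using V v(2) cvec.subspace_span[of S] unfolding irreducible_rep_def
    by (metis singletonD)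
  obtain B where B: "B \<subseteq> S" "cvec.independent B" "S \<subseteq> cvec.span B"
    using cvec.maximal_independent_subset[of S] by blast
  have VB: "V = cvec.span B"
    unfolding VS using cvec.span_mono[OF B(1)] cvec.span_mono[OF B(3)]
    by (intro equalityI) (simp_all only: cvec.span_span)
  have "finite S"
    using fin by (simp add: S_def)
  then have "finite B"
    using B(1) by (rule rev_finite_subset)
  then obtain h :: "'v \<Rightarrow> nat" where h: "inj_on h B"
    using finite_imp_inj_to_nat_seg by blast
  interpret P: vector_space_pair "scaleC :: complex \<Rightarrow> 'v \<Rightarrow> 'v"
      "scaleC :: complex \<Rightarrow> (nat \<Rightarrow>\<^sub>0 complex) \<Rightarrow> (nat \<Rightarrow>\<^sub>0 complex)" ..
  define f where "f = P.construct B (\<lambda>b. Poly_Mapping.single (h b) 1)"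
  have f: "clinear f" "\<And>b. b \<in> B \<Longrightarrow> f b = Poly_Mapping.single (h b) 1"
    unfolding f_def using B(2) by (simp_all add: P.linear_construct P.construct_basis)
  interpret f: Vector_Spaces.linear scaleC scaleC f by (rule f)
  have "inj_on f (cvec.span B)"
  proof (subst f.inj_on_iff_eq_0[OF cvec.subspace_span], intro ballI impI)
    fix x assume x: "x \<in> cvec.span B" "f x = 0"
    then obtain c where c: "x = (\<Sum>b\<in>B. c b *\<^sub>C b)"
      using cvec.span_finite[OF \<open>finite B\<close>] by auto
    have "c b = 0" if "b \<in> B" for b
    proof -
      have "0 = Poly_Mapping.lookup (f x) (h b)"
        using x(2) by simp
      also have "\<dots> = (\<Sum>b'\<in>B. if b' = b then c b' else 0)"
        unfolding c f.sum lookup_sum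
        by (rule sum.cong)
          (use that h in \<open>auto simp: f.scale f(2) lookup_single when_def scaleC_complex_def inj_on_def\<close>)
      finally show ?thesis
        using that \<open>finite B\<close> by simp
    qed
    then show "x = 0"
      by (simp add: c)
  qed
  then have "inj_on f V"
    by (simp only: VB)
  from irreducible_rep_isomorphic[OF V f(1) this] show ?thesis
    by (intro exI conjI)
qed

section \<open>The Weyl groups\<close>

text \<open>The index set \<open>{1, \<dots>, N}\<close> is a finite linearly ordered type \<^typ>\<open>'n\<close> with \<open>N\<close> elements, and a
  group element is a pair \<open>(\<zeta>, \<pi>)\<close>. The multiplication is determined by
  \<open>(\<zeta>, \<pi>) \<cdot> var i = \<zeta> (\<pi> i) *\<^sub>C var (\<pi> i)\<close>; see \<open>poly_act\<close> and \<open>poly_act_mult\<close> below.\<close>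

type_synonym 'n signed_perm = "('n \<Rightarrow> int) \<times> ('n \<Rightarrow> 'n)"

definition weyl_B :: "'n::finite signed_perm monoid" where
  "weyl_B = \<lparr>carrier = {(\<zeta>, \<pi>). range \<zeta> \<subseteq> {1, -1} \<and> bij \<pi>},
     mult = (\<lambda>(\<zeta>, \<pi>) (\<zeta>', \<pi>'). (\<lambda>j. \<zeta> j * \<zeta>' (inv_into UNIV \<pi> j), \<pi> \<circ> \<pi>')),
     one = (\<lambda>_. 1, id)\<rparr>"

definition weyl_A :: "'n::finite signed_perm monoid" where
  "weyl_A = weyl_B\<lparr>carrier := {(\<zeta>, \<pi>) \<in> carrier weyl_B. \<zeta> = (\<lambda>_. 1)}\<rparr>"

definition weyl_D :: "'n::finite signed_perm monoid" where
  "weyl_D = weyl_B\<lparr>carrier := {(\<zeta>, \<pi>) \<in> carrier weyl_B. (\<Prod>i\<in>UNIV. \<zeta> i) = 1}\<rparr>"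

section \<open>The module\<close>

definition poly_act :: "'n signed_perm \<Rightarrow> 'n cpoly \<Rightarrow> 'n cpoly" where
  "poly_act = (\<lambda>(\<zeta>, \<pi>). poly_eval (\<lambda>i. of_int (\<zeta> (\<pi> i)) *\<^sub>C var (\<pi> i)))"

definition V_act ::
    "'n signed_perm \<Rightarrow> 'n cpoly \<times> 'n cpoly ext2 \<Rightarrow> 'n cpoly \<times> 'n cpoly ext2" where
  "V_act w = map_prod (poly_act w) (ext2_map (poly_act w))"

definition sym_act ::
    "'n signed_perm \<Rightarrow> ('n cpoly \<times> 'n cpoly ext2) symalg \<Rightarrow> ('n cpoly \<times> 'n cpoly ext2) symalg" where
  "sym_act w = sym_map (V_act w)"

lemma poly_act_mult: "w \<in> carrier weyl_B \<Longrightarrow> w' \<in> carrier weyl_B \<Longrightarrow>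
    poly_act (w \<otimes>\<^bsub>weyl_B\<^esub> w') (var i) = poly_act w (poly_act w' (var i))"
  by (auto simp: weyl_B_def poly_act_def poly_eval_scaleC scaleC_scaleC bij_is_inj mult.commute)

lemma clinear_V_act: "clinear (V_act w)"
proof -
  have 1: "clinear (poly_act w)"
    by (rule clinearI) (simp_all add: poly_act_def poly_eval_add poly_eval_scaleC split: prod.splits)
  note [simp] = clinear_add[OF 1] clinear_scaleC[OF 1]
    clinear_add[OF clinear_ext2_map[OF 1]] clinear_scaleC[OF clinear_ext2_map[OF 1]]
  show ?thesis
    by (rule clinearI) (simp_all add: V_act_def prod_eq_iff scaleC_prod_def)
qed

definition L1 :: "'n signed_perm \<Rightarrow> 'n set"
  where "L1 = (\<lambda>(\<zeta>, \<pi>). {i. \<pi> i = i \<and> \<zeta> i = -1})"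

definition L2 :: "'n signed_perm \<Rightarrow> 'n set"
  where "L2 = (\<lambda>(\<zeta>, \<pi>). {i. \<pi> i \<noteq> i \<and> \<zeta> (\<pi> i) = -1})"

definition Q2 :: "'n signed_perm \<Rightarrow> 'n set"
  where "Q2 = (\<lambda>(\<zeta>, \<pi>). {i. \<pi> i \<noteq> i \<and> \<zeta> (\<pi> i) = 1})"

definition e_vec ::
    "'n::{finite, linorder} signed_perm \<Rightarrow> ('n cpoly \<times> 'n cpoly ext2) symalg" where
  "e_vec \<tau> = (let \<pi> = snd \<tau> in
     (\<Prod>k\<in>L1 \<tau>. sym_inj (var k, 0)) *
     (\<Prod>m\<in>{m \<in> L2 \<tau>. m < \<pi> m}. sym_inj (0, var m \<and>\<^sub>2 var (\<pi> m))) *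
     (\<Prod>l\<in>{l \<in> Q2 \<tau>. l < \<pi> l}. sym_inj (0, (var l)\<^sup>2 \<and>\<^sub>2 (var (\<pi> l))\<^sup>2)))"

definition involutions :: "('g, 'm) monoid_scheme \<Rightarrow> 'g set"
  where "involutions G = {\<tau> \<in> carrier G. \<tau> \<otimes>\<^bsub>G\<^esub> \<tau> = \<one>\<^bsub>G\<^esub>}"

definition model_space ::
    "'n::{finite, linorder} signed_perm monoid \<Rightarrow> ('n cpoly \<times> 'n cpoly ext2) symalg set"
  where "model_space W = cvec.span (e_vec ` involutions W)"

end

(* The vectors e_tau are linearly independent, and W permutes them up to signs; so everything reduces
   to pairs of involutions (t, t') of the index set. An intertwiner of the module has a nonzero matrix
   entry at such a pair only if no element fixing both involutions contributes the sign -1. The graph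
   formed by the transpositions of t and t' then has no path with an even number of vertices, and the
   two involutions are exchanged by an involutive permutation, which contributes the sign +1. Hence
   the matrices of all intertwiners are symmetric, so the intertwiners commute and the module is
   multiplicity-free.

   For completeness, every conjugacy class of the hyperoctahedral group yields a pair of involutions
   whose orbits are the cycles of the class, and thus an intertwiner supported on that pair. So there
   are as many linearly independent intertwiners as conjugacy classes. By the double commutant theorem,
   commuting intertwiners are given by class functions; an irreducible representation that does not
   occur would give a nonzero class function acting as zero, contradicting the count. The other two
   groups are retracts of the hyperoctahedral group. *)

theory Submission
  imports Defs "HOL-Combinatorics.Permutations"
begin

section \<open>Integer powers of a permutation\<close>

text \<open>Wedges of squares record a transposition but absorb all sign changes. So a sign change
  \<open>\<epsilon>\<close> scales \<open>e_vec \<tau>\<close> by the product of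
  \<open>\<epsilon>\<close> over the indices where the sign part of \<open>\<tau>\<close> is -1, and
  this tells different sign parts apart. In the series D even sign changes cannot distinguish
  \<open>\<zeta>\<close> from \<open>-\<zeta>\<close>; for odd N these never both have sign product
  1. The same parity makes B the direct product of D and the center, which provides the retraction.
  For equal sign parts only permutations matter. Everything rests on \<open>osgn_eq_sign\<close>: up
  to the common factor \<open>sign g\<close>, the sign of \<open>g\<close> on the transpositions of
  \<open>t\<close> is its sign on the fixed points of \<open>t\<close>, so two involutions are
  compared on their fixed points alone. Paths and closed cycles of the graph are handled through
  powers of the product of the two involutions, hence the calculus of integer powers. Completeness
  uses no character theory: averages over the group, matrix coefficients and a dimension count
  replace the orthogonality relations.\<close>

definition zpow :: "('a \<Rightarrow> 'a) \<Rightarrow> int \<Rightarrow> 'a \<Rightarrow> 'a" where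
  "zpow f k = (if 0 \<le> k then f ^^ nat k else (inv_into UNIV f) ^^ nat (- k))"

lemma zpow_0 [simp]: "zpow f 0 x = x"
  by (simp add: zpow_def)

lemma zpow_1 [simp]: "zpow f 1 x = f x"
  by (simp add: zpow_def)

lemma zpow_minus_1: "zpow f (-1) x = inv_into UNIV f x"
  by (simp add: zpow_def)

lemma zpow_plus_1:
  assumes "bij f"
  shows "zpow f (k + 1) x = f (zpow f k x)"
proof (cases "0 \<le> k")
  case True
  then show ?thesis
    by (simp add: zpow_def nat_add_distrib)
next
  case False
  then obtain n where n: "nat (- k) = Suc n"
    by (cases "nat (- k)") auto
  then have k: "k = - 1 - int n"
    using False by linarith
  show ?thesis
    using assms by (cases n) (simp_all add: zpow_def k nat_add_distrib bij_is_surj surj_f_inv_f)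
qed

lemma zpow_diff_1:
  assumes "bij f"
  shows "zpow f (k - 1) x = inv_into UNIV f (zpow f k x)"
  using zpow_plus_1[OF assms, of "k - 1" x] assms by (simp add: bij_is_inj)

lemma zpow_add:
  assumes "bij f"
  shows "zpow f (a + b) x = zpow f a (zpow f b x)"
proof (induction a rule: int_induct[where k = 0])
  case (step1 i)
  then show ?case
    using zpow_plus_1[OF assms, of "i + b"] zpow_plus_1[OF assms, of i] by (simp add: algebra_simps)
next
  case (step2 i)
  then show ?case
    using zpow_diff_1[OF assms, of "i + b"] zpow_diff_1[OF assms, of i] by (simp add: algebra_simps)
qed simp

text \<open>The case \<open>f' = inv_into UNIV f\<close> governs reflections: a map that inverts
  \<open>f\<close> negates exponents. The general case transports orbits along a
  conjugation.\<close>

lemma zpow_semiconj: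
  assumes "bij f" "bij f'" and h: "\<And>x. h (f x) = f' (h x)"
  shows "h (zpow f k x) = zpow f' k (h x)"
proof (induction k rule: int_induct[where k = 0])
  case (step1 i)
  then show ?case
    by (simp add: zpow_plus_1 assms)
next
  case (step2 i)
  have "f' (h (inv_into UNIV f y)) = h y" for y
    using h[of "inv_into UNIV f y"] assms(1) by (simp add: bij_is_surj surj_f_inv_f)
  then have "h (inv_into UNIV f y) = inv_into UNIV f' (h y)" for y
    by (metis assms(2) bij_is_inj inv_f_f)
  with step2 show ?case
    by (simp add: zpow_diff_1 assms)
qed simp

lemma zpow_inv:
  assumes "bij f"
  shows "zpow (inv_into UNIV f) k x = zpow f (- k) x"
proof (induction k rule: int_induct[where k = 0])
  case (step1 i)
  have "zpow (inv_into UNIV f) (i + 1) x = zpow f (- i - 1) x"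
    by (simp only: zpow_plus_1[OF bij_imp_bij_inv[OF assms]] step1 zpow_diff_1[OF assms])
  then show ?case
    by simp
next
  case (step2 i)
  have "zpow (inv_into UNIV f) (i - 1) x = zpow f (- i + 1) x"
    by (simp only: zpow_diff_1[OF bij_imp_bij_inv[OF assms]] step2 zpow_plus_1[OF assms]
        inv_inv_eq[OF assms])
  then show ?case
    by simp
qed simp

lemma zpow_eq_iff:
  assumes "bij f"
  shows "zpow f a x = zpow f b x \<longleftrightarrow> zpow f (a - b) x = x"
proof
  assume "zpow f a x = zpow f b x"
  then have "zpow f (- b) (zpow f a x) = zpow f (- b) (zpow f b x)"
    by simp
  then show "zpow f (a - b) x = x"
    by (simp flip: zpow_add[OF assms])
next
  assume "zpow f (a - b) x = x"
  then have "zpow f b (zpow f (a - b) x) = zpow f b x"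
    by simp
  then show "zpow f a x = zpow f b x"
    by (simp flip: zpow_add[OF assms])
qed

lemma zpow_mult_fixed:
  assumes "bij f" "zpow f a x = x"
  shows "zpow f (a * m) x = x"
proof (induction m rule: int_induct[where k = 0])
  case (step1 i)
  then show ?case
    using zpow_add[OF assms(1), of a "a * i" x] assms(2) by (simp add: algebra_simps)
next
  case (step2 i)
  then show ?case
    using zpow_eq_iff[OF assms(1), of "a * i" x a] assms(2) by (simp add: algebra_simps)
qed simp

text \<open>The factor 2 can be cancelled modulo an odd period. This makes half rotations of an odd
  cycle well defined and gives its reflections a single fixed point.\<close>

lemma zpow_half_fixed:
  assumes "bij f" "odd m" "zpow f m x = x" "zpow f (2 * k) x = x"
  shows "zpow f k x = x"
proof -
  obtain q where q: "m = 2 * q + 1"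
    using assms(2) by (auto elim: oddE)
  have "zpow f (k * m) x = x" "zpow f (2 * k * q) x = x"
    using zpow_mult_fixed assms by (metis mult.commute)+
  moreover have "k = k * m - 2 * k * q"
    by (simp add: q algebra_simps)
  ultimately show ?thesis
    using zpow_eq_iff[OF assms(1), of "k * m" x "2 * k * q"] by simp
qed

lemma zpow_fixed_shift:
  assumes "bij f"
  shows "zpow f m (zpow f k x) = zpow f k x \<longleftrightarrow> zpow f m x = x"
  using zpow_eq_iff[OF assms, of "m + k" x k] by (simp add: zpow_add[OF assms])

lemma zpow_period:
  fixes f :: "'a::finite \<Rightarrow> 'a"
  assumes "bij f"
  obtains l :: nat where "l > 0" "\<And>k. zpow f k x = x \<longleftrightarrow> int l dvd k"
proof -
  have "\<not> inj (\<lambda>n::nat. zpow f (int n) x)"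
    using finite_imageD[of "\<lambda>n::nat. zpow f (int n) x" UNIV] by auto
  then obtain a b :: nat where ab: "a \<noteq> b" "zpow f (int a) x = zpow f (int b) x"
    by (auto simp: inj_def)
  define m where "m = int a - int b"
  have m: "m \<noteq> 0" "zpow f m x = x" "zpow f (- m) x = x"
    using ab zpow_eq_iff[OF assms] zpow_mult_fixed[OF assms, of m x "-1"] by (simp_all add: m_def)
  have "nat \<bar>m\<bar> > 0 \<and> zpow f (int (nat \<bar>m\<bar>)) x = x"
    using m by (cases "m \<ge> 0") simp_all
  then have ex: "\<exists>n::nat. n > 0 \<and> zpow f (int n) x = x"
    by blast
  define l where "l = (LEAST n::nat. n > 0 \<and> zpow f (int n) x = x)"
  have l: "l > 0" "zpow f (int l) x = x"
    using LeastI_ex[OF ex] by (simp_all add: l_def)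
  have "int l dvd k" if "zpow f k x = x" for k
  proof -
    have "k mod int l = k - int l * (k div int l)"
      by (simp add: minus_mult_div_eq_mod)
    then have "zpow f (k mod int l) x = x"
      using zpow_eq_iff[OF assms, of k x "int l * (k div int l)"] that
        zpow_mult_fixed[OF assms l(2)] by simp
    moreover have "0 \<le> k mod int l" "k mod int l < int l"
      using l(1) by simp_all
    ultimately have "\<not> nat (k mod int l) > 0"
      using not_less_Least[of "nat (k mod int l)" "\<lambda>n. n > 0 \<and> zpow f (int n) x = x"]
      by (auto simp: l_def[symmetric])
    then show ?thesis
      using \<open>0 \<le> k mod int l\<close> by (simp add: dvd_eq_mod_eq_0)
  qed
  then have "zpow f k x = x \<longleftrightarrow> int l dvd k" for k
    using zpow_mult_fixed[OF assms l(2)] by (auto elim: dvdE)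
  with l(1) show thesis
    by (rule that)
qed

section \<open>Orbits of a permutation and their reflections\<close>

definition zorbit :: "('a \<Rightarrow> 'a) \<Rightarrow> 'a \<Rightarrow> 'a set" where
  "zorbit f x = range (\<lambda>k. zpow f k x)"

lemma zorbit_self [simp]: "x \<in> zorbit f x"
  unfolding zorbit_def by (rule image_eqI[of _ _ 0]) simp_all

lemma zorbit_eq:
  assumes "bij f" "y \<in> zorbit f x"
  shows "zorbit f y = zorbit f x"
proof -
  obtain k where y: "y = zpow f k x"
    using assms(2) by (auto simp: zorbit_def)
  have "zpow f m y = zpow f (m + k) x" "zpow f m x = zpow f (m - k) y" for m
    by (simp_all add: y flip: zpow_add[OF assms(1)])
  then show ?thesis
    unfolding zorbit_def by (intro equalityI subsetI; elim rangeE; metis rangeI)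
qed

lemma zorbit_step:
  assumes "bij f"
  shows "zorbit f (f x) = zorbit f x"
  by (rule zorbit_eq[OF assms]) (use zpow_1 in \<open>auto simp: zorbit_def intro: range_eqI[of _ _ 1]\<close>)

text \<open>Reflects every cycle of \<open>f\<close> at a chosen point.\<close>

lemma ex_inverting_involution:
  assumes f: "bij f"
  obtains r where "\<And>x. r (r x) = x" "\<And>x. r (f x) = inv_into UNIV f (r x)" "\<And>x. r x \<in> zorbit f x"
    "\<And>x. \<exists>b\<in>zorbit f x. r b = b"
proof -
  define base where "base x = (SOME y. y \<in> zorbit f x)" for x
  define idx where "idx x = (SOME k. x = zpow f k (base x))" for x
  define r where "r x = zpow f (- idx x) (base x)" for x
  have base: "base x \<in> zorbit f x" for x
    unfolding base_def by (rule someI[of _ x]) simp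
  have base_eq: "base y = base x" if "y \<in> zorbit f x" for x y
    using zorbit_eq[OF f that] by (simp add: base_def)
  have idx: "x = zpow f (idx x) (base x)" for x
  proof -
    have "x \<in> zorbit f (base x)"
      using zorbit_eq[OF f base[of x]] by simp
    then have "\<exists>k. x = zpow f k (base x)"
      by (auto simp: zorbit_def)
    then show ?thesis
      unfolding idx_def by (rule someI_ex)
  qed
  \<comment> \<open>\<open>idx\<close> is an arbitrary choice of exponent. Any other exponent that
    reaches \<open>x\<close> from the base point differs by a period and leads to the same reflected
    point.\<close>
  have r: "r x = zpow f (- k) (base x)" if "x = zpow f k (base x)" for x k
  proof -
    have "zpow f k (base x) = zpow f (idx x) (base x)"
      using that idx[of x] by argo
    then have "zpow f (k - idx x) (base x) = base x"
      by (simp add: zpow_eq_iff[OF f])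
    then show ?thesis
      using zpow_eq_iff[OF f, of "- idx x" _ "- k"] by (simp add: r_def)
  qed
  have orb: "r x \<in> zorbit f x" for x
    using zorbit_eq[OF f base[of x]] by (auto simp: r_def zorbit_def)
  show thesis
  proof
    show "r x \<in> zorbit f x" for x
      by (rule orb)
    show "r (r x) = x" for x
    proof -
      have "r x = zpow f (- idx x) (base (r x))"
        unfolding base_eq[OF orb] by (rule r_def)
      from r[OF this] show ?thesis
        using idx[of x] by (simp add: base_eq[OF orb])
    qed
    show "r (f x) = inv_into UNIV f (r x)" for x
    proof -
      have b: "base (f x) = base x"
        using zorbit_step[OF f] by (simp add: base_def)
      have "f x = zpow f (idx x + 1) (base (f x))"
        unfolding b using idx[of x] by (simp add: zpow_plus_1[OF f])
      from r[OF this] show ?thesis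
        using zpow_diff_1[OF f, of "- idx x" "base x"] by (simp add: b r_def[of x])
    qed
    show "\<exists>b\<in>zorbit f x. r b = b" for x
    proof
      show "r (base x) = base x"
        using r[of "base x" 0] base_eq[OF base[of x]] by simp
    qed (rule base)
  qed
qed

section \<open>Signs of permutations acting on the transpositions of an involution\<close>

text \<open>The sign that appears when \<open>g\<close> is applied to a product of wedges, one for
  each transposition of \<open>t\<close> with the smaller index first: every pair whose order is
  reversed contributes -1.\<close>

definition osgn :: "('n::{finite,linorder} \<Rightarrow> 'n) \<Rightarrow> ('n \<Rightarrow> 'n) \<Rightarrow> int" where
  "osgn g t = (\<Prod>i | i < t i. if g i < g (t i) then 1 else -1)"

lemma bij_involution: "(\<And>x. t (t x) = x) \<Longrightarrow> bij t"
  by (rule o_bij[of t]) (simp_all add: fun_eq_iff)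

lemma permutation_finite_type: "bij (p :: 'a::finite \<Rightarrow> 'a) \<Longrightarrow> permutation p"
  by (simp add: permutation)

lemma bij_betw_invariant:
  fixes p :: "'a::finite \<Rightarrow> 'a"
  assumes "bij p" "\<And>x. x \<in> A \<Longrightarrow> p x \<in> A"
  shows "bij_betw p A A"
  unfolding bij_betw_def using assms endo_inj_surj[of A p]
  by (auto simp: bij_is_inj inj_on_subset[of p UNIV])

lemma sign_on_Un:
  assumes "bij_betw g A A" "bij_betw g B B" "A \<inter> B = {}" "finite A" "finite B"
  shows "sign_on (A \<union> B) g = sign_on A g * sign_on B g"
proof -
  have "restrict_id g (A \<union> B) = restrict_id g A \<circ> restrict_id g B"
    using assms(2,3) by (auto simp: restrict_id_def fun_eq_iff bij_betw_def)
  moreover have "permutation (restrict_id g A)" "permutation (restrict_id g B)"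
    by (rule permutes_imp_permutation permutes_restrict_id assms)+
  ultimately show ?thesis
    by (simp add: sign_on_def sign_compose)
qed

lemma sign_conj:
  fixes h q :: "'a::finite \<Rightarrow> 'a"
  assumes "bij h" "bij q"
  shows "sign (inv_into UNIV h \<circ> q \<circ> h) = sign q"
  using permutation_finite_type[OF assms(1)] permutation_finite_type[OF assms(2)]
  by (simp add: sign_compose permutation_compose permutation_inverse sign_inverse mult.commute)

text \<open>\<open>F\<close> contains only the smaller ends, so its transpositions are disjoint and
  each of them contributes one factor -1.\<close>

lemma sign_flips:
  fixes t :: "'n::{finite,linorder} \<Rightarrow> 'n"
  assumes t: "\<And>x. t (t x) = x" and F: "\<forall>i\<in>F. i < t i"
  shows "sign (\<lambda>x. if x \<in> F \<or> t x \<in> F then t x else x) = (-1) ^ card F"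
  using finite[of F] F
proof (induction F rule: finite_induct)
  case (insert a F)
  let ?f = "\<lambda>x. if x \<in> F \<or> t x \<in> F then t x else x"
  have a: "t a \<notin> F" "a < t a"
    using insert by (auto simp: t dest!: bspec[where x = "t a"])
  have "(\<lambda>x. if x \<in> insert a F \<or> t x \<in> insert a F then t x else x) = transpose a (t a) \<circ> ?f"
    using a insert(2) t by (auto simp: fun_eq_iff transpose_def) (metis t)
  moreover have "bij ?f"
    by (rule bij_involution) (simp add: t)
  moreover have "sign (transpose a (t a)) = -1"
    using a by (simp add: sign_swap_id)
  ultimately show ?case
    using insert by (simp add: sign_compose permutation_swap_id permutation_finite_type)
qed simp

text \<open>Flipping the transpositions whose orientation \<open>g\<close> reverses turns \<open>g\<close> into a permutation
  that acts in the same way on the smaller and on the larger ends of the transpositions.\<close>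

lemma osgn_eq_sign:
  fixes t :: "'n::{finite,linorder} \<Rightarrow> 'n"
  assumes t: "\<And>x. t (t x) = x" and g: "bij g" and comm: "\<And>x. g (t x) = t (g x)"
  shows "osgn g t = sign g * sign_on {x. t x = x} g"
proof -
  define H where "H = {i. i < t i}"
  define H' where "H' = {i. t i < i}"
  define F where "F = {i \<in> H. \<not> g i < g (t i)}"
  define fl where "fl = (\<lambda>x. if x \<in> F \<or> t x \<in> F then t x else x)"
  define g1 where "g1 = g \<circ> fl"
  have fl2: "fl (fl x) = x" for x
    by (simp add: fl_def t)
  have flt: "fl (t x) = t (fl x)" for x
    by (auto simp: fl_def t)
  have fl: "bij fl"
    using fl2 by (rule bij_involution)
  have g1: "bij g1"
    unfolding g1_def using fl g by (rule bij_comp)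
  have g1t: "g1 (t x) = t (g1 x)" for x
    by (simp add: g1_def flt comm)
  have ginj: "g x = g y \<longleftrightarrow> x = y" for x y
    using g by (simp add: bij_is_inj inj_eq)
  have g1H: "g1 x \<in> H" if "x \<in> H" for x
  proof (cases "x \<in> F")
    case True
    have "x \<noteq> t x"
      using that by (auto simp: H_def)
    then have "g x \<noteq> g (t x)"
      using ginj by blast
    then have "g (t x) < g x"
      using True by (auto simp: F_def)
    then show ?thesis
      using True comm[of "t x"] by (simp add: g1_def fl_def H_def t)
  next
    case False
    then have "t x \<notin> F" "g x < g (t x)"
      using that by (auto simp: F_def H_def t)
    with False show ?thesis
      by (simp add: g1_def fl_def H_def comm)
  qed
  have t_H: "x \<in> H' \<longleftrightarrow> t x \<in> H" for x
    by (simp add: H_def H'_def t)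
  have b1: "bij_betw g1 H H" "bij_betw g1 H' H'"
    by (rule bij_betw_invariant[OF g1]; use g1H in \<open>auto simp: t_H simp flip: g1t\<close>)+
  have b2: "bij_betw fl (H \<union> H') (H \<union> H')"
    by (rule bij_betw_invariant[OF fl]) (auto simp: fl_def H_def H'_def t)
  have S: "x \<in> H \<union> H' \<longleftrightarrow> t x \<noteq> x" for x
    by (auto simp: H_def H'_def)
  have b3: "bij_betw g (H \<union> H') (H \<union> H')" "bij_betw g {x. t x = x} {x. t x = x}"
    by (rule bij_betw_invariant[OF g]; unfold S mem_Collect_eq; use ginj in \<open>simp flip: comm\<close>)+
  \<comment> \<open>\<open>t\<close> carries \<open>H\<close> to \<open>H'\<close> and commutes with
    \<open>g1\<close>, so the actions of \<open>g1\<close> on the two halves are conjugate and their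
    signs cancel.\<close>
  have "restrict_id g1 H' = inv_into UNIV t \<circ> restrict_id g1 H \<circ> t"
  proof -
    have "inv_into UNIV t = t"
      by (rule inv_unique_comp) (simp_all add: fun_eq_iff t)
    then show ?thesis
      by (simp add: fun_eq_iff restrict_id_def t_H t g1t)
  qed
  moreover have "bij (restrict_id g1 H)"
    using permutes_bij[OF permutes_restrict_id[OF b1(1)]] .
  ultimately have "sign_on H' g1 = sign_on H g1"
    unfolding sign_on_def using sign_conj[OF bij_involution[of t, OF t]] by simp
  moreover have disj: "H \<inter> H' = {}" "(H \<union> H') \<inter> {x. t x = x} = {}"
    by (auto simp: H_def H'_def)
  ultimately have "sign_on (H \<union> H') g1 = 1"
    by (subst sign_on_Un[OF b1]) (auto simp: sign_on_def)
  \<comment> \<open>\<open>g1\<close> is even on the moved points, hence \<open>g\<close> and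
    \<open>fl\<close> have the same sign there; the sign of \<open>fl\<close> counts the reversed
    pairs.\<close>
  then have "sign_on (H \<union> H') g * sign_on (H \<union> H') fl = 1"
    unfolding g1_def by (subst (asm) sign_on_compose) (simp_all add: b2 b3)
  moreover have "sign_on (H \<union> H') fl = sign fl"
  proof (rule sign_on_permutes)
    show "fl permutes H \<union> H'"
      by (rule bij_imp_permutes[OF b2]) (metis S fl_def)
  qed simp
  moreover have "sign fl = (-1) ^ card F"
    unfolding fl_def by (rule sign_flips) (auto simp: t F_def H_def)
  moreover have "osgn g t = (-1) ^ card F"
  proof -
    have "osgn g t = (\<Prod>i\<in>H. if i \<in> F then -1 else 1)"
      unfolding osgn_def H_def by (rule prod.cong) (auto simp: F_def H_def)
    also have "\<dots> = (\<Prod>i\<in>F. -1)"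
      by (subst prod.inter_restrict[symmetric]) (simp_all add: Int_absorb1 F_def)
    finally show ?thesis
      by simp
  qed
  ultimately have "osgn g t = sign_on (H \<union> H') g"
    by (simp add: minus_one_power_iff split: if_splits)
  moreover have "sign g = sign_on (H \<union> H') g * sign_on {x. t x = x} g"
  proof -
    have "(H \<union> H') \<union> {x. t x = x} = UNIV"
      using S by auto
    moreover have "sign_on UNIV g = sign g"
      by (rule sign_on_permutes[OF bij_imp_permutes]) (use g in auto)
    ultimately show ?thesis
      using sign_on_Un[OF b3 disj(2)] by simp
  qed
  ultimately show ?thesis
    by (simp add: sign_on_def)
qed

text \<open>On a cycle of \<open>\<pi>\<close>, identified with the integers modulo \<open>l\<close>, the two involutions are
  \<open>k \<mapsto> 1 - k\<close> and \<open>k \<mapsto> - 1 - k\<close>. They have no fixed points if \<open>l\<close> is even, and one fixed point each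
  if \<open>l\<close> is odd, so that \<open>inv \<pi>\<close> matches the fixed points of the first involution with those of the
  second one, in a way that is compatible with every \<open>g\<close> commuting with both.\<close>

lemma ex_good_pair:
  fixes \<pi> :: "'n::{finite,linorder} \<Rightarrow> 'n"
  assumes \<pi>: "bij \<pi>"
  obtains t t' where "\<And>x. t (t x) = x" "\<And>x. t' (t' x) = x"
    "\<And>x. t x \<in> zorbit \<pi> x" "\<And>x. t' x \<in> zorbit \<pi> x"
    "\<And>S. t ` S \<subseteq> S \<Longrightarrow> t' ` S \<subseteq> S \<Longrightarrow> \<pi> ` S \<subseteq> S"
    "\<And>g. bij g \<Longrightarrow> (\<And>x. g (t x) = t (g x)) \<Longrightarrow> (\<And>x. g (t' x) = t' (g x)) \<Longrightarrow> osgn g t = osgn g t'"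
proof -
  let ?i = "inv_into UNIV \<pi>"
  obtain r where r: "\<And>x. r (r x) = x" "\<And>x. r (\<pi> x) = ?i (r x)" "\<And>x. r x \<in> zorbit \<pi> x"
    "\<And>x. \<exists>b\<in>zorbit \<pi> x. r b = b"
    using ex_inverting_involution[OF \<pi>] by blast
  have [simp]: "\<pi> (?i x) = x" "?i (\<pi> x) = x" for x
    using \<pi> by (simp_all add: bij_is_surj surj_f_inv_f bij_is_inj)
  have ri: "r (?i x) = \<pi> (r x)" for x
    by (metis r(1,2))
  have rz: "r (zpow \<pi> k x) = zpow \<pi> (- k) (r x)" for k x
    using zpow_semiconj[OF \<pi> bij_imp_bij_inv[OF \<pi>], of r] r(2) zpow_inv[OF \<pi>] by simp
  have step: "zpow \<pi> k x \<in> zorbit \<pi> y" if "x \<in> zorbit \<pi> y" for k x y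
    using zorbit_eq[OF \<pi> that] by (auto simp: zorbit_def)
  \<comment> \<open>The obvious pair \<open>r\<close> and \<open>\<pi> \<circ> r\<close>, with
    product \<open>\<pi>\<close>, fails: on a cycle of even length \<open>r\<close> has two fixed
    points and \<open>\<pi> \<circ> r\<close> has none, which is precisely a path with an even
    number of vertices. Shifting by one step in both directions leaves neither with a fixed point on
    such a cycle.\<close>
  define t where "t x = \<pi> (r x)" for x
  define t' where "t' x = ?i (r x)" for x
  have t2: "t (t x) = x" and t'2: "t' (t' x) = x" for x
    by (simp_all add: t_def t'_def r ri)
  have orb: "t x \<in> zorbit \<pi> x" "t' x \<in> zorbit \<pi> x" for x
    using step[OF r(3), of 1 x] step[OF r(3), of "-1" x] by (simp_all add: t_def t'_def zpow_minus_1)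
  have orb2: "t x \<in> zorbit \<pi> y" "t' x \<in> zorbit \<pi> y" if "x \<in> zorbit \<pi> y" for x y
    using zorbit_eq[OF \<pi> that] orb[of x] by simp_all
  \<comment> \<open>The composition \<open>t \<circ> t'\<close> is the square of
    \<open>\<pi>\<close>, which on an even cycle preserves the parity of the position. Parity is
    changed by \<open>t\<close>, which exchanges the fixed point \<open>b\<close> of
    \<open>r\<close> with \<open>\<pi> b\<close>; hence the case distinction on the parity of the
    distance to \<open>b\<close>.\<close>
  have closed: "\<pi> ` S \<subseteq> S" if S: "t ` S \<subseteq> S" "t' ` S \<subseteq> S" for S
  proof
    fix y assume "y \<in> \<pi> ` S"
    then obtain x where x: "x \<in> S" "y = \<pi> x"
      by blast
    obtain b k where b: "r b = b" "x = zpow \<pi> k b"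
      using r(4)[of x] zorbit_eq[OF \<pi>, of _ x] by (metis (no_types) imageE zorbit_def zorbit_self)
    have St: "t z \<in> S" "t' z \<in> S" if "z \<in> S" for z
      using S that by auto
    have 2: "zpow \<pi> (2 * j) z \<in> S" if "z \<in> S" for j z
    proof (induction j rule: int_induct[where k = 0])
      case (step1 i)
      have "zpow \<pi> (2 * (i + 1)) z = t (t' (zpow \<pi> (2 * i) z))"
        using zpow_add[OF \<pi>, of 2 "2 * i" z] zpow_add[OF \<pi>, of 1 1]
        by (simp add: t_def t'_def ri r(1) algebra_simps)
      with step1 St show ?case
        by simp
    next
      case (step2 i)
      have "zpow \<pi> (2 * (i - 1)) z = t' (t (zpow \<pi> (2 * i) z))"
        using zpow_add[OF \<pi>, of "-2" "2 * i" z] zpow_add[OF \<pi>, of "-1" "-1"]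
        by (simp add: t_def t'_def r zpow_minus_1 algebra_simps)
      with step2 St show ?case
        by simp
    qed (use that in simp)
    show "y \<in> S"
    proof (cases "even k")
      case True
      then obtain j where j: "k = 2 * j"
        by blast
      have "b = zpow \<pi> (2 * (- j)) x"
        by (simp add: b j flip: zpow_add[OF \<pi>])
      then have "t b \<in> S"
        using 2[OF x(1)] St by metis
      then have "zpow \<pi> (2 * j) (\<pi> b) \<in> S"
        using 2 by (simp add: t_def b)
      then show ?thesis
        using zpow_add[OF \<pi>, of "2 * j" 1 b] zpow_add[OF \<pi>, of 1 "2 * j" b]
        by (simp add: x b j add.commute)
    next
      case False
      then obtain j where j: "k = 2 * j + 1"
        by (auto elim: oddE)
      have "\<pi> b = zpow \<pi> (2 * (- j)) x"
        using zpow_add[OF \<pi>, of "2 * (- j)" k b] by (simp add: b j)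
      then have "t (\<pi> b) \<in> S"
        using 2[OF x(1)] St by metis
      then have "b \<in> S"
        by (simp add: t_def b r)
      then have "zpow \<pi> (2 * (j + 1)) b \<in> S"
        by (rule 2)
      then show ?thesis
        using zpow_add[OF \<pi>, of 1 k b] by (simp add: x b j algebra_simps)
    qed
  qed
  \<comment> \<open>A fixed point of \<open>t'\<close> at position \<open>k\<close> makes
    \<open>2 * k + 1\<close> a period, so the period is odd. Two such positions have a doubled
    difference that is a period, and the factor 2 cancels.\<close>
  have uniq: "y = z" if y: "t' y = y" and z: "t' z = z" and yz: "y \<in> zorbit \<pi> z" for y z
  proof -
    obtain b where b: "b \<in> zorbit \<pi> z" "r b = b"
      using r(4) by blast
    have "y \<in> zorbit \<pi> b" "z \<in> zorbit \<pi> b"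
      using yz zorbit_eq[OF \<pi> b(1)] by simp_all
    then obtain k l where kl: "y = zpow \<pi> k b" "z = zpow \<pi> l b"
      by (auto simp: zorbit_def)
    have *: "zpow \<pi> (2 * j + 1) b = b" if "t' (zpow \<pi> j b) = zpow \<pi> j b" for j
    proof -
      have "?i (zpow \<pi> (- j) b) = zpow \<pi> j b"
        using that by (simp add: t'_def rz b)
      then have "zpow \<pi> j b = zpow \<pi> (- j - 1) b"
        by (simp add: zpow_diff_1[OF \<pi>])
      then show ?thesis
        by (simp add: zpow_eq_iff[OF \<pi>] algebra_simps)
    qed
    have k: "zpow \<pi> (2 * k + 1) b = b" and l: "zpow \<pi> (2 * l + 1) b = b"
      using * y z kl by auto
    have "zpow \<pi> (2 * (k - l)) b = b"
      using zpow_eq_iff[OF \<pi>, of "2 * k + 1" b "2 * l + 1"] k l by (simp add: algebra_simps)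
    from zpow_half_fixed[OF \<pi> _ k this] show ?thesis
      unfolding kl by (simp add: zpow_eq_iff[OF \<pi>])
  qed
  have good: "osgn g t = osgn g t'"
    if g: "bij g" and gt: "\<And>x. g (t x) = t (g x)" and gt': "\<And>x. g (t' x) = t' (g x)" for g
  proof -
    \<comment> \<open>Both sides are fixed points of \<open>t'\<close> on one cycle. Thus
      \<open>\<pi>\<close> conjugates the action of \<open>g\<close> on the fixed points of
      \<open>t'\<close> into its action on those of \<open>t\<close>, and the two signs
      agree.\<close>
    have *: "?i (g (\<pi> z)) = g z" if z: "t' z = z" for z
    proof (rule uniq)
      have "t (\<pi> z) = \<pi> z"
        using z by (simp add: t_def t'_def r)
      then have "t (g (\<pi> z)) = g (\<pi> z)"
        by (metis gt)
      then show "t' (?i (g (\<pi> z))) = ?i (g (\<pi> z))"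
        by (simp add: t_def t'_def ri)
      show "t' (g z) = g z"
        by (metis gt' z)
      \<comment> \<open>\<open>g\<close> may fail to commute with \<open>\<pi>\<close>. It still
        maps cycles of \<open>\<pi>\<close> into cycles, because closed sets of \<open>t\<close> and
        \<open>t'\<close> are closed under \<open>\<pi>\<close>.\<close>
      have "\<pi> ` {y. g y \<in> zorbit \<pi> (g z)} \<subseteq> {y. g y \<in> zorbit \<pi> (g z)}"
        by (rule closed) (auto simp: gt gt' intro: orb2)
      then have "g (\<pi> z) \<in> zorbit \<pi> (g z)"
        by force
      then show "?i (g (\<pi> z)) \<in> zorbit \<pi> (g z)"
        using step[of _ _ "-1"] by (simp add: zpow_minus_1)
    qed
    have fix_iff: "t' z = z \<longleftrightarrow> t (\<pi> z) = \<pi> z" for z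
      by (simp add: t_def t'_def r) (metis \<open>\<And>x. \<pi> (?i x) = x\<close> \<open>\<And>x. ?i (\<pi> x) = x\<close>)
    have "restrict_id g {x. t' x = x} = ?i \<circ> restrict_id g {x. t x = x} \<circ> \<pi>"
      using * by (auto simp: fun_eq_iff restrict_id_def fix_iff)
    moreover have "bij (restrict_id g {x. t x = x})"
    proof (rule permutes_bij[OF permutes_restrict_id[OF bij_betw_invariant[OF g]]])
      show "g x \<in> {x. t x = x}" if "x \<in> {x. t x = x}" for x
        using that gt[of x] by simp
    qed
    ultimately have "sign_on {x. t' x = x} g = sign_on {x. t x = x} g"
      unfolding sign_on_def using sign_conj[OF \<pi>] by simp
    then show ?thesis
      by (simp add: osgn_eq_sign t2 t'2 g gt gt')
  qed
  show thesis
    by (rule that[OF t2 t'2 orb closed good])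
qed

section \<open>Pairs of involutions\<close>

text \<open>Join every \<open>x\<close> to \<open>t x\<close> and \<open>t' x\<close>. With
  \<open>p = t \<circ> t'\<close>, a path with m vertices is a single cycle of \<open>p\<close> of
  length m, whereas a closed cycle consists of two cycles of \<open>p\<close> of equal length that
  \<open>t\<close> exchanges. Parity of a path is therefore parity of a period of
  \<open>p\<close>.\<close>

locale two_involutions =
  fixes t t' :: "'n::{finite,linorder} \<Rightarrow> 'n"
  assumes t [simp]: "t (t x) = x" and t' [simp]: "t' (t' x) = x"
begin

definition p where "p = t \<circ> t'"

lemma inv_p: "inv_into UNIV p = t' \<circ> t"
  by (rule inv_unique_comp) (simp_all add: p_def fun_eq_iff)

lemma bij_p: "bij p"
  by (rule o_bij[of "t' \<circ> t"]) (simp_all add: p_def fun_eq_iff)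

lemma t_zpow: "t (zpow p k x) = zpow p (- k) (t x)"
  using zpow_semiconj[OF bij_p bij_imp_bij_inv[OF bij_p], of t] zpow_inv[OF bij_p]
  by (simp add: inv_p) (simp add: p_def)

lemma t'_zpow: "t' (zpow p k x) = zpow p (- k) (t' x)"
  using zpow_semiconj[OF bij_p bij_imp_bij_inv[OF bij_p], of t'] zpow_inv[OF bij_p]
  by (simp add: inv_p) (simp add: p_def)

lemma t'_eq: "t' x = t (zpow p 1 x)"
  by (simp add: p_def)

lemma t'_t: "t' (t x) = zpow p (-1) x"
  by (simp add: zpow_minus_1 inv_p)

lemma closed_zpow:
  assumes "t ` S \<subseteq> S" "t' ` S \<subseteq> S" "x \<in> S"
  shows "zpow p k x \<in> S"
proof -
  have S: "t y \<in> S" "t' y \<in> S" if "y \<in> S" for y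
    using assms(1,2) that by auto
  then have "p y \<in> S" if "y \<in> S" for y
    using that by (simp add: p_def)
  note S = S this
  show ?thesis
  proof (induction k rule: int_induct[where k = 0])
    case (step1 i)
    then show ?case
      by (simp add: zpow_plus_1[OF bij_p] S)
  next
    case (step2 i)
    then show ?case
      by (simp add: zpow_diff_1[OF bij_p] inv_p S)
  qed (simp add: assms)
qed

text \<open>In a cycle of \<open>p\<close> of even length, the fixed points of \<open>t\<close> and \<open>t'\<close> are two fixed points of
  \<open>t\<close>, at opposite places; rotate the cycle by half its length.\<close>

lemma even_path:
  assumes b: "t b = b" and even: "\<And>m. odd m \<Longrightarrow> zpow p m b \<noteq> b"
  obtains g where "bij g" "\<And>x. g (t x) = t (g x)" "\<And>x. g (t' x) = t' (g x)"
    "\<And>S. t ` S \<subseteq> S \<Longrightarrow> t' ` S \<subseteq> S \<Longrightarrow> g ` S \<subseteq> S" "osgn g t \<noteq> osgn g t'"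
proof -
  obtain l :: nat where l: "l > 0" "\<And>k. zpow p k b = b \<longleftrightarrow> int l dvd k"
    using zpow_period[OF bij_p] by blast
  with even have "even (int l)"
    by (metis dvd_refl)
  then obtain c where c: "int l = 2 * c"
    by blast
  then have "c > 0"
    using l(1) by linarith
  define C where "C = zorbit p b"
  have C: "x \<in> C \<longleftrightarrow> (\<exists>k. x = zpow p k b)" for x
    by (auto simp: C_def zorbit_def)
  have tb: "t (zpow p k b) = zpow p (- k) b" for k
    by (simp add: t_zpow b)
  have t'b: "t' (zpow p k b) = zpow p (- k - 1) b" for k
  proof -
    have "t' (zpow p k b) = t (zpow p (1 + k) b)"
      by (simp only: t'_eq zpow_add[OF bij_p])
    also have "\<dots> = zpow p (- k - 1) b"
      unfolding tb by (rule arg_cong[where f = "\<lambda>j. zpow p j b"]) simp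
    finally show ?thesis .
  qed
  have tC: "t x \<in> C \<longleftrightarrow> x \<in> C" "t' x \<in> C \<longleftrightarrow> x \<in> C" for x
    by (metis C tb t) (metis C t'b t')
  have zC: "zpow p k x \<in> C" if "x \<in> C" for x k
    using that by (auto simp: C simp flip: zpow_add[OF bij_p])
  have cc: "zpow p (c + c) x = x" if "x \<in> C" for x
    using that l(2)[of "c + c"] by (auto simp: C zpow_fixed_shift[OF bij_p] c)
  then have mc: "zpow p (- c) x = zpow p c x" if "x \<in> C" for x
    using that zpow_eq_iff[OF bij_p, of c x "- c"] by simp
  define g where "g x = (if x \<in> C then zpow p c x else x)" for x
  have "g (g x) = x" for x
    using cc[of x] by (simp add: g_def zC flip: zpow_add[OF bij_p])
  then have g: "bij g"
    by (rule bij_involution)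
  have gt: "g (t x) = t (g x)" "g (t' x) = t' (g x)" for x
    by (simp_all add: g_def tC t_zpow t'_zpow mc)
  \<comment> \<open>By \<open>osgn_eq_sign\<close> the common factor \<open>sign g\<close> drops
    out. On the fixed points of \<open>t\<close> the rotation acts as the transposition of
    \<open>b\<close> with the opposite point, on those of \<open>t'\<close> as the identity.\<close>
  have "osgn g t \<noteq> osgn g t'"
  proof -
    have "zpow p c b \<noteq> b"
      using l(2)[of c] \<open>c > 0\<close> zdvd_imp_le[of "int l" c] by (auto simp: c)
    moreover have "t (zpow p c b) = zpow p c b"
      using mc[of b] by (simp add: tb C_def)
    ultimately have "sign_on {x. t x = x} (transpose b (zpow p c b)) = -1"
      using b by (intro sign_on_transpose) auto
    moreover have "sign_on {x. t x = x} g = sign_on {x. t x = x} (transpose b (zpow p c b))"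
    proof (rule sign_on_cong)
      fix x assume "x \<in> {x. t x = x}"
      then have x: "t x = x"
        by simp
      show "g x = transpose b (zpow p c b) x"
      proof (cases "x \<in> C")
        case True
        then obtain k where k: "x = zpow p k b"
          by (auto simp: C)
        then have "zpow p (2 * k) b = b"
          using x zpow_eq_iff[OF bij_p, of k b "- k"] by (simp add: tb)
        then have "c dvd k"
          using l(2) by (simp add: c)
        then obtain m where m: "k = c * m"
          by blast
        have "x = (if even m then b else zpow p c b)"
        proof (cases "even m")
          case True
          then show ?thesis
            using l(2)[of k] by (auto simp: k m c)
        next
          case False
          then obtain q where "m = 2 * q + 1"
            by (auto elim: oddE)
          then have "k - c = 2 * c * q"
            by (simp add: m algebra_simps)
          then show ?thesis
            using l(2)[of "k - c"] zpow_eq_iff[OF bij_p, of k b c] False by (simp add: k c)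
        qed
        moreover have "g (zpow p c b) = b" "g b = zpow p c b"
          using cc[of b] zC by (simp_all add: g_def C_def flip: zpow_add[OF bij_p])
        ultimately show ?thesis
          by (simp add: transpose_def split: if_splits)
      next
        case False
        then have "x \<noteq> b" "x \<noteq> zpow p c b"
          using zC[of b c] by (auto simp: C_def)
        then show ?thesis
          using False by (simp add: g_def)
      qed
    qed simp
    moreover have "sign_on {x. t' x = x} g = sign_on {x. t' x = x} id"
    proof (rule sign_on_cong)
      fix x assume "x \<in> {x. t' x = x}"
      then have x: "t' x = x"
        by simp
      have "x \<notin> C"
      proof
        assume "x \<in> C"
        then obtain k where "x = zpow p k b"
          by (auto simp: C)
        then have "zpow p (2 * k + 1) b = b"
          using x zpow_eq_iff[OF bij_p, of k b "- k - 1"] by (simp add: t'b algebra_simps)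
        then show False
          using even by simp
      qed
      then show "g x = id x"
        by (simp add: g_def)
    qed simp
    ultimately show ?thesis
      using osgn_eq_sign[of t g] osgn_eq_sign[of t' g] g gt by simp
  qed
  moreover have "g ` S \<subseteq> S" if "t ` S \<subseteq> S" "t' ` S \<subseteq> S" for S
    using closed_zpow[OF that] by (auto simp: g_def)
  ultimately show thesis
    using that[of g] g gt by blast
qed

text \<open>If \<open>2 * c + 1\<close> is a period of \<open>p\<close>, the reflection
  \<open>zpow p c (t x)\<close> conjugates \<open>t\<close> to \<open>t'\<close>, since
  \<open>p\<close> to the power \<open>2 * c\<close> is then the inverse of \<open>p\<close>. Cycles
  of \<open>p\<close> of even length occur only in pairs exchanged by \<open>t\<close>: one of the
  two is reflected by \<open>r\<close>, and the equation \<open>h (t x) = t' (h x)\<close> dictates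
  \<open>h\<close> on the other.\<close>

lemma swap_if_no_even_path:
  assumes B: "\<And>b. t b = b \<or> t' b = b \<Longrightarrow> \<exists>m. odd m \<and> zpow p m b = b"
  obtains h where "\<And>x. h (h x) = x" "\<And>x. h (t x) = t' (h x)"
    "\<And>S. t ` S \<subseteq> S \<Longrightarrow> t' ` S \<subseteq> S \<Longrightarrow> h ` S \<subseteq> S"
proof -
  define Od where "Od = {x. \<exists>m. odd m \<and> zpow p m x = x}"
  define half where "half x = (SOME c. zpow p (2 * c + 1) x = x)" for x
  have Od_zpow: "zpow p k x \<in> Od \<longleftrightarrow> x \<in> Od" for k x
    by (simp add: Od_def zpow_fixed_shift[OF bij_p])
  have Od_t: "t x \<in> Od \<longleftrightarrow> x \<in> Od" for x
  proof -
    have "t x \<in> Od" if x: "x \<in> Od" for x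
    proof -
      obtain m where "odd m" "zpow p m x = x"
        using x by (auto simp: Od_def)
      then have "odd (- m) \<and> zpow p (- m) (t x) = t x"
        using t_zpow[of m x] by simp
      then show ?thesis
        unfolding Od_def by blast
    qed
    from this[of x] this[of "t x"] show ?thesis
      by auto
  qed
  have Od_t': "t' x \<in> Od \<longleftrightarrow> x \<in> Od" for x
    by (simp only: t'_eq Od_t Od_zpow)
  have half: "zpow p (2 * half x + 1) x = x" if x: "x \<in> Od" for x
  proof -
    have "\<exists>c. zpow p (2 * c + 1) x = x"
      using x by (auto simp: Od_def elim!: oddE)
    then show ?thesis
      unfolding half_def by (rule someI_ex)
  qed
  define ho where "ho x = zpow p (half x) (t x)" for x
  \<comment> \<open>Independence of the chosen exponent: two candidates differ by a period, as 2
    cancels modulo the odd period.\<close>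
  have ho: "ho x = zpow p c (t x)" if c: "zpow p (2 * c + 1) x = x" for x c
  proof -
    have "x \<in> Od"
      using c by (auto simp: Od_def intro!: exI[of _ "2 * c + 1"])
    then have h: "zpow p (2 * half x + 1) x = x"
      by (rule half)
    have "zpow p (2 * (c - half x)) x = x"
      using zpow_eq_iff[OF bij_p, of "2 * c + 1" x "2 * half x + 1"] c h
      by (simp add: algebra_simps)
    from zpow_half_fixed[OF bij_p _ c this] have "t (zpow p (c - half x) x) = t x"
      by simp
    then have "zpow p (half x - c) (t x) = t x"
      by (simp add: t_zpow)
    then show ?thesis
      by (simp add: ho_def zpow_eq_iff[OF bij_p])
  qed
  have hot: "ho (t x) = t' (ho x)" and hoho: "ho (ho x) = x" if x: "x \<in> Od" for x
  proof -
    define c where "c = half x"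
    have c: "zpow p (2 * c + 1) x = x"
      using half[OF x] by (simp add: c_def)
    then have "zpow p (2 * (- c - 1) + 1) x = x"
      using zpow_mult_fixed[OF bij_p c, of "-1"] by (simp add: algebra_simps)
    then have c': "zpow p (2 * c + 1) (t x) = t x"
      using t_zpow[of "2 * (- c - 1) + 1" x] by (simp add: algebra_simps)
    have hox: "ho x = zpow p c (t x)"
      using ho[OF c] .
    have "ho (t x) = zpow p c x"
      using ho[OF c'] by simp
    also have "\<dots> = zpow p (- c - 1) x"
      using c by (simp add: zpow_eq_iff[OF bij_p] algebra_simps)
    also have "\<dots> = t' (ho x)"
      by (simp add: hox t'_zpow t'_t flip: zpow_add[OF bij_p])
    finally show "ho (t x) = t' (ho x)" .
    have "zpow p (2 * c + 1) (ho x) = ho x"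
      by (simp add: hox zpow_fixed_shift[OF bij_p] c')
    from ho[OF this] show "ho (ho x) = x"
      by (simp add: hox t_zpow flip: zpow_add[OF bij_p])
  qed
  obtain r where r: "\<And>x. r (r x) = x" "\<And>x. r (p x) = inv_into UNIV p (r x)"
    "\<And>x. r x \<in> zorbit p x" "\<And>x. \<exists>b\<in>zorbit p x. r b = b"
    by (rule ex_inverting_involution[OF bij_p], rule that)
  \<comment> \<open>\<open>D x\<close> is the whole component of \<open>x\<close>: one or two cycles
    of \<open>p\<close>.\<close>
  define D where "D x = zorbit p x \<union> zorbit p (t x)" for x
  have t_orb: "t x \<in> zorbit p y" if "x \<in> zorbit p (t y)" for x y
    using that by (auto simp: zorbit_def t_zpow)
  have t_orb': "x \<in> zorbit p (t y)" if "t x \<in> zorbit p y" for x y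
    using t_orb[of "t x" "t y"] that by simp
  define base where "base x = (SOME y. y \<in> D x)" for x
  have D_t: "D (t x) = D x" for x
    by (auto simp: D_def)
  have D_zpow: "D (zpow p k x) = D x" for k x
    using zorbit_eq[OF bij_p, of "zpow p k x" x] zorbit_eq[OF bij_p, of "zpow p (- k) (t x)" "t x"]
    by (simp add: D_def t_zpow) (simp add: zorbit_def)
  have base: "base x \<in> D x" for x
    unfolding base_def by (rule someI[of _ x]) (simp add: D_def)
  have base_t: "base (t x) = base x" and base_zpow: "base (zpow p k x) = base x" for k x
    by (simp_all add: base_def D_t D_zpow)
  \<comment> \<open>\<open>E\<close> selects from every component the cycle of \<open>p\<close>
    through the chosen base point.\<close>
  define E where "E = {x. x \<in> zorbit p (base x)}"
  have E_zpow: "zpow p k x \<in> E \<longleftrightarrow> x \<in> E" for k x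
  proof -
    have "zpow p k x \<in> E" if "x \<in> E" for k x
      using that zorbit_eq[OF bij_p, of x "base x"] by (simp add: E_def base_zpow) (auto simp: zorbit_def)
    from this[of x k] this[of "zpow p k x" "- k"] show ?thesis
      by (auto simp flip: zpow_add[OF bij_p])
  qed
  have E_r: "r x \<in> E \<longleftrightarrow> x \<in> E" and Od_r: "r x \<in> Od \<longleftrightarrow> x \<in> Od" for x
    using r(3)[of x] by (auto simp: zorbit_def E_zpow Od_zpow)
  \<comment> \<open>A relation between \<open>t x\<close> and \<open>x\<close> by a power of
    \<open>p\<close> places a fixed point of \<open>t\<close> (even exponent) or of
    \<open>t'\<close> (odd exponent) halfway between them, and hypothesis \<open>B\<close> then
    gives an odd period.\<close>
  have free: "t x \<notin> zorbit p x" if x: "x \<notin> Od" for x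
  proof
    assume "t x \<in> zorbit p x"
    then obtain k where k: "t x = zpow p k x"
      by (auto simp: zorbit_def)
    have "\<exists>j. t (zpow p j x) = zpow p j x \<or> t' (zpow p j x) = zpow p j x"
    proof (cases "even k")
      case True
      then obtain j where "k = 2 * j"
        by blast
      then show ?thesis
        by (intro exI[of _ j]) (simp add: t_zpow k flip: zpow_add[OF bij_p])
    next
      case False
      then obtain j where "k = 2 * j + 1"
        by (auto elim: oddE)
      then show ?thesis
        by (intro exI[of _ j]) (simp add: t'_eq t_zpow k del: zpow_1 flip: zpow_add[OF bij_p])
    qed
    then obtain j where "zpow p j x \<in> Od"
      using B unfolding Od_def by blast
    with x show False
      by (simp add: Od_zpow)
  qed
  have E_t: "t x \<in> E \<longleftrightarrow> x \<notin> E" if x: "x \<notin> Od" for x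
  proof -
    have "t x \<notin> zorbit p x" "x \<notin> zorbit p (t x)"
      using free[of x] free[of "t x"] x by (simp_all add: Od_t)
    moreover have "base x \<in> zorbit p x \<or> base x \<in> zorbit p (t x)"
      using base[of x] by (simp add: D_def)
    moreover have "zorbit p (base x) = zorbit p y" if "base x \<in> zorbit p y" for y
      using that by (rule zorbit_eq[OF bij_p])
    ultimately show ?thesis
      unfolding E_def mem_Collect_eq base_t by (metis zorbit_self)
  qed
  define h where "h x = (if x \<in> Od then ho x else if x \<in> E then r x else t' (r (t x)))" for x
  have ho_Od: "ho x \<in> Od \<longleftrightarrow> x \<in> Od" for x
    by (simp add: ho_def Od_zpow Od_t)
  have rt: "t' (r (t x)) \<in> E \<longleftrightarrow> x \<in> E" if "x \<notin> Od" for x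
    using that by (simp add: t'_eq E_t E_zpow Od_zpow Od_r Od_t E_r del: zpow_1)
  have rr: "t' (r (t (t' (r (t x))))) = x" for x
  proof -
    have "t (t' (r (t x))) = p (r (t x))"
      by (simp add: p_def)
    then show ?thesis
      by (simp add: r inv_p)
  qed
  show thesis
  proof
    show "h (h x) = x" for x
      by (simp add: h_def ho_Od hoho Od_r E_r r Od_t' Od_t rt rr)
    show "h (t x) = t' (h x)" for x
      by (simp add: h_def Od_t E_t hot)
    show "h ` S \<subseteq> S" if S: "t ` S \<subseteq> S" "t' ` S \<subseteq> S" for S
    proof -
      have "t x \<in> S" "t' x \<in> S" "r x \<in> S" "zpow p k x \<in> S" if "x \<in> S" for x k
        using that S r(3)[of x] closed_zpow[OF S that] by (auto simp: zorbit_def)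
      then show ?thesis
        by (auto simp: h_def ho_def)
    qed
  qed
qed

lemma swap_or_bad:
  obtains (swap) h where "\<And>x. h (h x) = x" "\<And>x. h (t x) = t' (h x)"
      "\<And>S. t ` S \<subseteq> S \<Longrightarrow> t' ` S \<subseteq> S \<Longrightarrow> h ` S \<subseteq> S"
  | (bad) g where "bij g" "\<And>x. g (t x) = t (g x)" "\<And>x. g (t' x) = t' (g x)"
      "\<And>S. t ` S \<subseteq> S \<Longrightarrow> t' ` S \<subseteq> S \<Longrightarrow> g ` S \<subseteq> S" "osgn g t \<noteq> osgn g t'"
proof (cases "\<forall>b. t b = b \<or> t' b = b \<longrightarrow> (\<exists>m. odd m \<and> zpow p m b = b)")
  case True
  then show thesis
    using swap_if_no_even_path swap by blast
next
  case False
  then obtain b where b: "t b = b \<or> t' b = b" "\<And>m. odd m \<Longrightarrow> zpow p m b \<noteq> b"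
    by blast
  show thesis
  proof (cases "t b = b")
    case True
    then show thesis
      using even_path[OF _ b(2)] bad by blast
  next
    case False
    \<comment> \<open>Exchanging the roles of the two involutions inverts \<open>p\<close>, which
      keeps the periods; this covers paths that begin at a fixed point of \<open>t'\<close>.\<close>
    interpret s: two_involutions t' t
      by unfold_locales simp_all
    have "s.p = inv_into UNIV p"
      by (simp add: s.p_def inv_p)
    then have "zpow s.p m b \<noteq> b" if "odd m" for m
      using b(2)[of "- m"] that zpow_inv[OF bij_p, of m b] by simp
    then obtain g where "bij g" "\<And>x. g (t' x) = t' (g x)" "\<And>x. g (t x) = t (g x)"
      "\<And>S. t' ` S \<subseteq> S \<Longrightarrow> t ` S \<subseteq> S \<Longrightarrow> g ` S \<subseteq> S" "osgn g t' \<noteq> osgn g t"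
      using s.even_path[of b] b(1) False by blast
    then show thesis
      using bad[of g] by metis
  qed
qed

end

section \<open>Conjugacy of signed permutations\<close>

text \<open>The offset \<open>c\<close> shifts the enumeration of a cycle: 0 lists its points from
  the start, 1 lists the targets of the successive steps, where signs are collected.\<close>

lemma zpow_fixed_iff_card:
  fixes f :: "'a::finite \<Rightarrow> 'a"
  assumes f: "bij f"
  shows "zpow f k x = x \<longleftrightarrow> int (card (zorbit f x)) dvd k"
    and bij_betw_zorbit: "bij_betw (\<lambda>i. zpow f (int i + c) x) {..<card (zorbit f x)} (zorbit f x)"
proof -
  obtain l where l: "l > 0" "\<And>k. zpow f k x = x \<longleftrightarrow> int l dvd k"
    using zpow_period[OF f] by blast
  have b: "bij_betw (\<lambda>i. zpow f (int i + c) x) {..<l} (zorbit f x)" for c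
    unfolding bij_betw_def
  proof
    show "inj_on (\<lambda>i. zpow f (int i + c) x) {..<l}"
    proof
      fix i j assume ij: "i \<in> {..<l}" "j \<in> {..<l}" "zpow f (int i + c) x = zpow f (int j + c) x"
      then have "int l dvd int i - int j"
        by (simp add: zpow_eq_iff[OF f] l)
      then have "int i mod int l = int j mod int l"
        by (simp add: mod_eq_dvd_iff)
      then show "i = j"
        using ij by simp
    qed
    show "(\<lambda>i. zpow f (int i + c) x) ` {..<l} = zorbit f x"
    proof
      show "zorbit f x \<subseteq> (\<lambda>i. zpow f (int i + c) x) ` {..<l}"
      proof
        fix y assume "y \<in> zorbit f x"
        then obtain k where k: "y = zpow f k x"
          by (auto simp: zorbit_def)
        define i where "i = nat ((k - c) mod int l)"
        have i: "int i = (k - c) mod int l" "i < l"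
          using l(1) by (simp_all add: i_def nat_less_iff)
        have "int l dvd k - (int i + c)"
          unfolding i by (metis diff_diff_eq2 diff_diff_add dvd_minus_mod add.commute diff_add_eq)
        then have "y = zpow f (int i + c) x"
          unfolding k zpow_eq_iff[OF f] l(2) .
        then show "y \<in> (\<lambda>i. zpow f (int i + c) x) ` {..<l}"
          using i(2) by (intro image_eqI[where x = i]) simp_all
      qed
    qed (auto simp: zorbit_def)
  qed
  have "l = card (zorbit f x)"
    using bij_betw_same_card[OF b[of 0]] by simp
  with b l show "zpow f k x = x \<longleftrightarrow> int (card (zorbit f x)) dvd k"
    "bij_betw (\<lambda>i. zpow f (int i + c) x) {..<card (zorbit f x)} (zorbit f x)"
    by simp_all
qed

lemma sign_values:
  assumes "range (\<zeta> :: 'n \<Rightarrow> int) \<subseteq> {1, -1}"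
  shows "\<zeta> i = 1 \<or> \<zeta> i = -1" "\<zeta> i * \<zeta> i = 1"
proof -
  have "\<zeta> i \<in> {1, -1}"
    using assms by blast
  then show "\<zeta> i = 1 \<or> \<zeta> i = -1" "\<zeta> i * \<zeta> i = 1"
    by auto
qed

text \<open>The conjugating element matches the cycles of the two permutations point by point, starting
  from a base point in every orbit; its signs are the ratios of the partial products of the signs.\<close>

lemma signed_perms_conjugate:
  fixes \<pi> \<pi>' :: "'n::finite \<Rightarrow> 'n" and \<zeta> \<zeta>' :: "'n \<Rightarrow> int"
  assumes \<pi>: "bij \<pi>" and \<pi>': "bij \<pi>'"
    and orb: "\<And>x. zorbit \<pi> x = zorbit \<pi>' x"
    and \<zeta>: "range \<zeta> \<subseteq> {1, -1}" and \<zeta>': "range \<zeta>' \<subseteq> {1, -1}"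
    and sgn: "\<And>x. (\<Prod>y\<in>zorbit \<pi> x. \<zeta> y) = (\<Prod>y\<in>zorbit \<pi> x. \<zeta>' y)"
  obtains \<epsilon> f where "range \<epsilon> \<subseteq> {1, -1 :: int}" "bij f" "\<And>x. f (\<pi> x) = \<pi>' (f x)"
    "\<And>x. \<epsilon> (f (\<pi> x)) * \<zeta> (\<pi> x) = \<zeta>' (f (\<pi> x)) * \<epsilon> (f x)"
proof -
  define base where "base x = (SOME y. y \<in> zorbit \<pi> x)" for x
  define len where "len x = card (zorbit \<pi> x)" for x
  define idx where "idx x = (SOME k. k < len x \<and> x = zpow \<pi> (int k) (base x))" for x
  define f where "f x = zpow \<pi>' (int (idx x)) (base x)" for x
  define q where "q b n = (\<Prod>i<n. \<zeta> (zpow \<pi> (int i + 1) b) * \<zeta>' (zpow \<pi>' (int i + 1) b))" for b and n :: nat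
  define e where "e x = q (base x) (idx x)" for x
  have sq: "\<zeta> x * \<zeta> x = 1" "\<zeta>' x * \<zeta>' x = 1" "\<zeta> x \<in> {1, -1}" "\<zeta>' x \<in> {1, -1}" for x
    using sign_values[OF \<zeta>, of x] sign_values[OF \<zeta>', of x] by auto
  have base: "base x \<in> zorbit \<pi> x" for x
    unfolding base_def by (rule someI[of _ x]) simp
  have base_orb: "zorbit \<pi> (base x) = zorbit \<pi> x" for x
    using zorbit_eq[OF \<pi> base] .
  have base_eq: "base y = base x" "len y = len x" if "y \<in> zorbit \<pi> x" for x y
    using zorbit_eq[OF \<pi> that] by (simp_all add: base_def len_def)
  have len_pos: "len x > 0" for x
    unfolding len_def card_gt_0_iff by (metis empty_iff finite zorbit_self)
  have idx: "idx x < len x" "x = zpow \<pi> (int (idx x)) (base x)" for x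
  proof -
    have "x \<in> (\<lambda>i. zpow \<pi> (int i + 0) (base x)) ` {..<len x}"
      using bij_betw_imp_surj_on[OF bij_betw_zorbit[OF \<pi>, of 0 "base x"]]
      by (simp add: base_orb len_def)
    then have "\<exists>k. k < len x \<and> x = zpow \<pi> (int k) (base x)"
      by auto
    then show "idx x < len x" "x = zpow \<pi> (int (idx x)) (base x)"
      unfolding idx_def by (rule someI2_ex, simp)+
  qed
  have fixed: "zpow \<pi> (int (len x)) (base x) = base x" "zpow \<pi>' (int (len x)) (base x) = base x" for x
    by (simp_all add: zpow_fixed_iff_card[OF \<pi>] zpow_fixed_iff_card[OF \<pi>'] len_def base_orb
        flip: orb)
  have idx_unique: "j = k" if "zpow p (int j) (base x) = zpow p (int k) (base x)"
    "j < len x" "k < len x" "p = \<pi> \<or> p = \<pi>'" for j k x p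
  proof -
    have "bij p" "zorbit p (base x) = zorbit \<pi> x"
      using that \<pi> \<pi>' base_orb by (auto simp flip: orb)
    then show ?thesis
      using bij_betw_imp_inj_on[OF bij_betw_zorbit[of p 0 "base x"]] that
      by (auto simp: inj_on_def len_def)
  qed
  \<comment> \<open>Equality of the sign products enters here: the ratio of partial products returns
    to 1 after a full turn, so the signs stay consistent when the index wraps around to 0.\<close>
  have q_len: "q (base x) (len x) = 1" for x
  proof -
    have "(\<Prod>i<len x. \<zeta> (zpow \<pi> (int i + 1) (base x))) = (\<Prod>y\<in>zorbit \<pi> x. \<zeta> y)"
      using prod.reindex_bij_betw[OF bij_betw_zorbit[OF \<pi>, of 1 "base x"], of \<zeta>]
      by (simp only: len_def base_orb)
    moreover have "(\<Prod>i<len x. \<zeta>' (zpow \<pi>' (int i + 1) (base x))) = (\<Prod>y\<in>zorbit \<pi> x. \<zeta>' y)"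
      using prod.reindex_bij_betw[OF bij_betw_zorbit[OF \<pi>', of 1 "base x"], of \<zeta>']
      by (simp only: len_def base_orb flip: orb)
    ultimately have "q (base x) (len x) = (\<Prod>y\<in>zorbit \<pi> x. \<zeta>' y) * (\<Prod>y\<in>zorbit \<pi> x. \<zeta>' y)"
      unfolding q_def prod.distrib by (simp only: sgn)
    also have "\<dots> = 1"
      by (simp add: sq flip: prod.distrib)
    finally show ?thesis .
  qed
  have step: "base (\<pi> x) = base x" "len (\<pi> x) = len x" for x
    using zorbit_step[OF \<pi>, of x] by (simp_all add: base_def len_def)
  have next_idx: "idx (\<pi> x) = (if idx x + 1 < len x then idx x + 1 else 0)" for x
  proof (rule idx_unique)
    have "zpow \<pi> (int (idx (\<pi> x))) (base x) = \<pi> x"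
      using idx(2)[of "\<pi> x"] by (simp add: step)
    also have "\<dots> = zpow \<pi> (int (idx x) + 1) (base x)"
      using idx(2)[of x] by (simp add: zpow_plus_1[OF \<pi>])
    also have "\<dots> = zpow \<pi> (int (if idx x + 1 < len x then idx x + 1 else 0)) (base x)"
      using idx(1)[of x] fixed(1)[of x]
      by (cases "idx x + 1 = len x") (auto simp: add.commute simp flip: of_nat_Suc)
    finally show "zpow \<pi> (int (idx (\<pi> x))) (base x)
      = zpow \<pi> (int (if idx x + 1 < len x then idx x + 1 else 0)) (base x)" .
  qed (use idx(1)[of "\<pi> x"] step len_pos in auto)
  have f\<pi>: "f (\<pi> x) = zpow \<pi>' (int (idx x) + 1) (base x)"
    and e\<pi>: "e (\<pi> x) = q (base x) (idx x + 1)" for x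
    using idx(1)[of x] fixed(2)[of x] q_len[of x]
    by (cases "idx x + 1 = len x"; simp add: f_def e_def next_idx step q_def add.commute flip: of_nat_Suc)+
  have forb: "f x \<in> zorbit \<pi> x" for x
  proof -
    have "f x \<in> zorbit \<pi>' (base x)"
      by (simp add: f_def zorbit_def)
    then show ?thesis
      by (simp add: base_orb flip: orb)
  qed
  have "inj f"
  proof
    fix x y assume xy: "f x = f y"
    then have "zorbit \<pi> x = zorbit \<pi> y"
      using zorbit_eq[OF \<pi> forb[of x]] zorbit_eq[OF \<pi> forb[of y]] by simp
    then have b: "base x = base y" "len x = len y"
      by (simp_all add: base_def len_def)
    have "idx x = idx y"
      by (rule idx_unique[of \<pi>' _ x]) (use xy b idx(1)[of x] idx(1)[of y] in \<open>auto simp: f_def\<close>)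
    with b show "x = y"
      using idx(2)[of x] idx(2)[of y] by simp
  qed
  then have f: "bij f"
    by (simp add: finite_UNIV_inj_surj bij_def)
  have e: "e x \<in> {1, -1}" for x
  proof -
    have "q b n \<in> {1, -1}" for b n
      unfolding q_def
    proof (induction n)
      case (Suc n)
      then show ?case
        using sq(3)[of "zpow \<pi> (int n + 1) b"] sq(4)[of "zpow \<pi>' (int n + 1) b"] by auto
    qed simp
    then show ?thesis
      by (simp add: e_def)
  qed
  define \<epsilon> where "\<epsilon> j = e (inv_into UNIV f j)" for j
  have [simp]: "\<epsilon> (f x) = e x" for x
    using f by (simp add: \<epsilon>_def bij_is_inj)
  show thesis
  proof (rule that[of \<epsilon> f])
    show "range \<epsilon> \<subseteq> {1, -1}"
      using e by (auto simp: \<epsilon>_def)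
    show "f (\<pi> x) = \<pi>' (f x)" for x
      unfolding f\<pi> zpow_plus_1[OF \<pi>'] by (simp add: f_def)
    have \<pi>1: "zpow \<pi> (int (idx x) + 1) (base x) = \<pi> x" for x
      using idx(2)[of x] by (simp add: zpow_plus_1[OF \<pi>])
    have "e (\<pi> x) = e x * (\<zeta> (\<pi> x) * \<zeta>' (f (\<pi> x)))" for x
      unfolding e\<pi> f\<pi> by (simp add: e_def q_def \<pi>1)
    then show "\<epsilon> (f (\<pi> x)) * \<zeta> (\<pi> x) = \<zeta>' (f (\<pi> x)) * \<epsilon> (f x)" for x
      using sq(1)[of "\<pi> x"] by (simp add: algebra_simps)
  qed (rule f)
qed

section \<open>The Weyl groups\<close>

lemma carrier_weyl_B: "(\<zeta>, \<pi>) \<in> carrier weyl_B \<longleftrightarrow> range \<zeta> \<subseteq> {1, -1} \<and> bij \<pi>"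
  by (simp add: weyl_B_def)

lemma mult_weyl_B: "(\<zeta>, \<pi>) \<otimes>\<^bsub>weyl_B\<^esub> (\<zeta>', \<pi>') = (\<lambda>j. \<zeta> j * \<zeta>' (inv_into UNIV \<pi> j), \<pi> \<circ> \<pi>')"
  by (simp add: weyl_B_def)

lemma one_weyl_B: "\<one>\<^bsub>weyl_B\<^esub> = (\<lambda>_. 1, id)"
  by (simp add: weyl_B_def)

lemma group_weyl_B: "group (weyl_B :: 'n::finite signed_perm monoid)"
proof (rule groupI)
  fix x y z :: "'n signed_perm"
  assume x: "x \<in> carrier weyl_B"
  obtain \<zeta> \<pi> where [simp]: "x = (\<zeta>, \<pi>)"
    by (cases x)
  have x': "range \<zeta> \<subseteq> {1, -1}" "bij \<pi>"
    using x by (simp_all add: carrier_weyl_B)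
  show "\<one>\<^bsub>weyl_B\<^esub> \<otimes>\<^bsub>weyl_B\<^esub> x = x"
    by (simp add: one_weyl_B mult_weyl_B)
  show "\<exists>y\<in>carrier weyl_B. y \<otimes>\<^bsub>weyl_B\<^esub> x = \<one>\<^bsub>weyl_B\<^esub>"
  proof
    show "(\<lambda>j. \<zeta> (\<pi> j), inv_into UNIV \<pi>) \<otimes>\<^bsub>weyl_B\<^esub> x = \<one>\<^bsub>weyl_B\<^esub>"
      using x' sign_values(2)[OF x'(1)]
      by (simp add: mult_weyl_B one_weyl_B inv_inv_eq fun_eq_iff bij_is_inj)
    show "(\<lambda>j. \<zeta> (\<pi> j), inv_into UNIV \<pi>) \<in> carrier weyl_B"
      using x' by (auto simp: carrier_weyl_B bij_imp_bij_inv)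
  qed
  assume y: "y \<in> carrier weyl_B"
  obtain \<zeta>' \<pi>' where [simp]: "y = (\<zeta>', \<pi>')"
    by (cases y)
  have y': "range \<zeta>' \<subseteq> {1, -1}" "bij \<pi>'"
    using y by (simp_all add: carrier_weyl_B)
  have "\<zeta> j * \<zeta>' k \<in> {1, -1}" for j k
    using sign_values(1)[OF x'(1), of j] sign_values(1)[OF y'(1), of k] by auto
  then show "x \<otimes>\<^bsub>weyl_B\<^esub> y \<in> carrier weyl_B"
    using x' y' by (auto simp: mult_weyl_B carrier_weyl_B bij_comp)
  assume "z \<in> carrier weyl_B"
  obtain \<zeta>'' \<pi>'' where [simp]: "z = (\<zeta>'', \<pi>'')"
    by (cases z)
  show "x \<otimes>\<^bsub>weyl_B\<^esub> y \<otimes>\<^bsub>weyl_B\<^esub> z = x \<otimes>\<^bsub>weyl_B\<^esub> (y \<otimes>\<^bsub>weyl_B\<^esub> z)"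
    using x' y' by (simp add: mult_weyl_B o_assoc o_inv_distrib mult.assoc)
qed (simp add: one_weyl_B carrier_weyl_B)

lemma finite_weyl_B: "finite (carrier (weyl_B :: 'n::finite signed_perm monoid))"
proof (rule finite_subset)
  show "carrier (weyl_B :: 'n signed_perm monoid) \<subseteq> (UNIV \<rightarrow> {1, -1}) \<times> UNIV"
    by (auto simp: weyl_B_def)
  have "finite (PiE (UNIV :: 'n set) (\<lambda>_. {1, -1 :: int}))"
    by (rule finite_PiE) simp_all
  then show "finite (((UNIV :: 'n set) \<rightarrow> {1, -1 :: int}) \<times> (UNIV :: ('n \<Rightarrow> 'n) set))"
    by (simp add: PiE_UNIV_domain Pi_def)
qed

section \<open>Intertwiners\<close>

definition intertwiner ::
    "('g, 'm) monoid_scheme \<Rightarrow> 'v::complex_vector set \<Rightarrow> ('g \<Rightarrow> 'v \<Rightarrow> 'v) \<Rightarrow>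
     'w::complex_vector set \<Rightarrow> ('g \<Rightarrow> 'w \<Rightarrow> 'w) \<Rightarrow> ('v \<Rightarrow> 'w) \<Rightarrow> bool" where
  "intertwiner G V \<rho> W \<sigma> f \<longleftrightarrow> (\<forall>v\<in>V. f v \<in> W) \<and>
     (\<forall>v\<in>V. \<forall>w\<in>V. f (v + w) = f v + f w) \<and>
     (\<forall>c. \<forall>v\<in>V. f (c *\<^sub>C v) = c *\<^sub>C f v) \<and>
     (\<forall>g\<in>carrier G. \<forall>v\<in>V. f (\<rho> g v) = \<sigma> g (f v))"

lemma intertwinerD:
  assumes "intertwiner G V \<rho> W \<sigma> f" "v \<in> V"
  shows "f v \<in> W" "w \<in> V \<Longrightarrow> f (v + w) = f v + f w" "f (c *\<^sub>C v) = c *\<^sub>C f v"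
    "g \<in> carrier G \<Longrightarrow> f (\<rho> g v) = \<sigma> g (f v)" "f 0 = 0"
proof -
  show "f v \<in> W" "w \<in> V \<Longrightarrow> f (v + w) = f v + f w" "f (c *\<^sub>C v) = c *\<^sub>C f v"
    "g \<in> carrier G \<Longrightarrow> f (\<rho> g v) = \<sigma> g (f v)"
    using assms unfolding intertwiner_def by blast+
  have "f (0 *\<^sub>C v) = 0 *\<^sub>C f v"
    using assms unfolding intertwiner_def by blast
  then show "f 0 = 0"
    by simp
qed

lemma isomorphic_reps_iff:
  "isomorphic_reps G V \<rho> W \<sigma> \<longleftrightarrow> (\<exists>f. intertwiner G V \<rho> W \<sigma> f \<and> bij_betw f V W)"
  unfolding isomorphic_reps_def intertwiner_def by (intro iff_exI) (auto dest: bij_betwE)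

lemma intertwiner_comp:
  assumes "intertwiner G V \<rho> W \<sigma> f" "intertwiner G W \<sigma> X \<tau> h"
  shows "intertwiner G V \<rho> X \<tau> (\<lambda>v. h (f v))"
  using assms unfolding intertwiner_def by simp

lemma intertwiner_subset:
  assumes "intertwiner G V \<rho> W \<sigma> f" "U \<subseteq> V" "\<And>v. v \<in> U \<Longrightarrow> f v \<in> W'"
  shows "intertwiner G U \<rho> W' \<sigma> f"
  using assms unfolding intertwiner_def by blast

lemma intertwiner_sum:
  assumes f: "intertwiner G V \<rho> W \<sigma> f" and V: "cvec.subspace V" "0 \<in> V" and x: "\<And>i. i \<in> I \<Longrightarrow> x i \<in> V"
  shows "f (\<Sum>i\<in>I. x i) = (\<Sum>i\<in>I. f (x i))"
  using x
proof (induction I rule: infinite_finite_induct)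
  case (insert i I)
  then have "(\<Sum>i\<in>I. x i) \<in> V"
    by (intro cvec.subspace_sum[OF V(1)]) auto
  with insert show ?case
    by (simp add: intertwinerD(2)[OF f])
qed (use intertwinerD(5)[OF f V(2)] in auto)

lemma isomorphic_reps_sym:
  assumes iso: "isomorphic_reps G V \<rho> W \<sigma>" and V: "complex_rep G V \<rho>"
  shows "isomorphic_reps G W \<sigma> V \<rho>"
proof -
  interpret complex_rep G V \<rho> by fact
  obtain f where f: "intertwiner G V \<rho> W \<sigma> f" "bij_betw f V W"
    using iso by (auto simp: isomorphic_reps_iff)
  define h where "h = inv_into V f"
  have h: "bij_betw h W V" "\<And>w. w \<in> W \<Longrightarrow> f (h w) = w" "\<And>v. v \<in> V \<Longrightarrow> h (f v) = v"
    using f(2) by (auto simp: h_def bij_betw_inv_into bij_betw_inv_into_right bij_betw_inv_into_left)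
  then have hV: "h w \<in> V" if "w \<in> W" for w
    using that by (auto simp: bij_betw_def)
  have eq: "h w = v" if "w \<in> W" "v \<in> V" "f v = w" for v w
    using h(3) that by blast
  have "intertwiner G W \<sigma> V \<rho> h"
    unfolding intertwiner_def
  proof (intro conjI ballI allI)
    fix w w' c g assume w: "w \<in> W"
    show "h w \<in> V"
      using w by (rule hV)
    have *: "f (c *\<^sub>C h w) = c *\<^sub>C w"
      using intertwinerD(3)[OF f(1) hV[OF w], of c] h(2)[OF w] by simp
    moreover have "c *\<^sub>C h w \<in> V"
      using hV[OF w] subspace by (rule cvec.subspace_scale[rotated])
    ultimately show "h (c *\<^sub>C w) = c *\<^sub>C h w"
      by (metis h(3))
    {
      assume w': "w' \<in> W"
      have "f (h w + h w') = w + w'"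
        using intertwinerD(2)[OF f(1) hV[OF w] hV[OF w']] h(2) w w' by simp
      moreover have "h w + h w' \<in> V"
        using hV[OF w] hV[OF w'] subspace by (simp add: cvec.subspace_add)
      ultimately show "h (w + w') = h w + h w'"
        by (metis h(3))
    }
    {
      assume g: "g \<in> carrier G"
      have "f (\<rho> g (h w)) = \<sigma> g w"
        using intertwinerD(4)[OF f(1) hV[OF w] g] h(2)[OF w] by simp
      then show "h (\<sigma> g w) = \<rho> g (h w)"
        by (metis h(3) closed[OF g hV[OF w]])
    }
  qed
  with h(1) show ?thesis
    by (auto simp: isomorphic_reps_iff)
qed

lemma isomorphic_reps_trans:
  assumes "isomorphic_reps G V \<rho> W \<sigma>" "isomorphic_reps G W \<sigma> X \<tau>"
  shows "isomorphic_reps G V \<rho> X \<tau>"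
  using assms intertwiner_comp bij_betw_trans unfolding isomorphic_reps_iff comp_def by metis

section \<open>Representations of finite groups\<close>

context group
begin

lemma sum_mult_left:
  assumes "h \<in> carrier G"
  shows "(\<Sum>g\<in>carrier G. f (h \<otimes> g)) = (\<Sum>g\<in>carrier G. f g)"
  by (rule sum.reindex_bij_witness[where i = "\<lambda>g. inv h \<otimes> g" and j = "\<lambda>g. h \<otimes> g"])
    (use assms in \<open>simp_all add: inv_solve_left m_assoc[symmetric]\<close>)

lemma sum_conj:
  assumes "h \<in> carrier G"
  shows "(\<Sum>g\<in>carrier G. f (h \<otimes> g \<otimes> inv h)) = (\<Sum>g\<in>carrier G. f g)"
  by (rule sum.reindex_bij_witness[where i = "\<lambda>g. inv h \<otimes> g \<otimes> h" and j = "\<lambda>g. h \<otimes> g \<otimes> inv h"])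
    (use assms in \<open>simp_all add: m_assoc\<close>,
     simp_all add: m_assoc[symmetric])

end

lemma complex_rep_0:
  assumes "complex_rep G V \<rho>" "g \<in> carrier G"
  shows "\<rho> g 0 = 0" "0 \<in> V"
proof -
  interpret complex_rep G V \<rho> by fact
  show "0 \<in> V"
    using subspace by (rule cvec.subspace_0)
  then show "\<rho> g 0 = 0"
    using scaleC[OF assms(2), of 0 0] by simp
qed

lemma complex_rep_sum:
  assumes "complex_rep G V \<rho>" "g \<in> carrier G" "\<And>i. i \<in> I \<Longrightarrow> x i \<in> V"
  shows "\<rho> g (\<Sum>i\<in>I. x i) = (\<Sum>i\<in>I. \<rho> g (x i))"
  using assms(3)
proof (induction I rule: infinite_finite_induct)
  case (insert i I)
  interpret complex_rep G V \<rho> by fact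
  have "(\<Sum>i\<in>I. x i) \<in> V"
    using insert by (intro cvec.subspace_sum[OF subspace]) auto
  with insert show ?case
    by (simp add: add assms(2))
qed (simp_all add: complex_rep_0[OF assms(1,2)])

text \<open>Equivariance comes from replacing \<open>g\<close> by \<open>h \<otimes> g\<close> in
  the sum. Applied to a linear projection it gives complete reducibility; applied to rank one maps
  it gives relations between matrix coefficients and the basic intertwiners of the module.\<close>

lemma intertwiner_average:
  assumes V: "complex_rep G V \<rho>" and W: "complex_rep G W \<sigma>"
    and F: "\<And>v. v \<in> V \<Longrightarrow> F v \<in> W" "\<And>v w. v \<in> V \<Longrightarrow> w \<in> V \<Longrightarrow> F (v + w) = F v + F w"
      "\<And>c v. v \<in> V \<Longrightarrow> F (c *\<^sub>C v) = c *\<^sub>C F v"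
  shows "intertwiner G V \<rho> W \<sigma> (\<lambda>v. \<Sum>g\<in>carrier G. \<sigma> g (F (\<rho> (inv\<^bsub>G\<^esub> g) v)))"
proof -
  interpret V: complex_rep G V \<rho> by fact
  interpret W: complex_rep G W \<sigma> by fact
  let ?T = "\<lambda>v. \<Sum>g\<in>carrier G. \<sigma> g (F (\<rho> (inv\<^bsub>G\<^esub> g) v))"
  have mem: "\<sigma> g (F (\<rho> (inv\<^bsub>G\<^esub> g) v)) \<in> W" if "g \<in> carrier G" "v \<in> V" for g v
    using that by (simp add: W.closed V.closed F)
  show ?thesis
    unfolding intertwiner_def
  proof (intro conjI ballI allI)
    fix v w c h assume v: "v \<in> V"
    show "?T v \<in> W"
      using mem v by (intro cvec.subspace_sum[OF W.subspace])
    show "?T (c *\<^sub>C v) = c *\<^sub>C ?T v"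
      using v by (simp add: V.scaleC V.closed F W.scaleC cvec.scale_sum_right)
    show "?T (v + w) = ?T v + ?T w" if "w \<in> V"
      using v that by (simp add: V.add V.closed F W.add sum.distrib)
    assume h: "h \<in> carrier G"
    have "\<sigma> h (?T v) = (\<Sum>g\<in>carrier G. \<sigma> (h \<otimes>\<^bsub>G\<^esub> g) (F (\<rho> (inv\<^bsub>G\<^esub> g) v)))"
      using v h mem by (subst complex_rep_sum[OF W]) (simp_all add: W.mult V.closed F)
    also have "\<dots> = (\<Sum>g\<in>carrier G. \<sigma> (h \<otimes>\<^bsub>G\<^esub> g) (F (\<rho> (inv\<^bsub>G\<^esub> (h \<otimes>\<^bsub>G\<^esub> g)) (\<rho> h v))))"
      using v h by (intro sum.cong) (simp_all add: V.inv_mult_group V.m_assoc flip: V.mult)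
    also have "\<dots> = ?T (\<rho> h v)"
      by (rule V.sum_mult_left[OF h])
    finally show "?T (\<rho> h v) = \<sigma> h (?T v)" ..
  qed
qed

section \<open>Complete reducibility and Schur's lemma\<close>

locale finite_group_rep = complex_rep G V \<rho>
  for G (structure) and V :: "'v::complex_vector set" and \<rho> :: "'g \<Rightarrow> 'v \<Rightarrow> 'v" +
  assumes finite_carrier: "finite (carrier G)"
begin

definition subrep :: "'v set \<Rightarrow> bool" where
  "subrep U \<longleftrightarrow> cvec.subspace U \<and> U \<subseteq> V \<and> (\<forall>g\<in>carrier G. \<rho> g ` U \<subseteq> U)"

lemma card_carrier: "of_nat (card (carrier G)) \<noteq> (0 :: complex)"
  using finite_carrier one_closed by auto

lemma zero_mem: "0 \<in> V"
  using subspace by (rule cvec.subspace_0)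

lemma complex_rep_subrep:
  assumes "subrep U"
  shows "complex_rep G U \<rho>"
proof
  show "cvec.subspace U"
    using assms by (simp add: subrep_def)
  fix g h v w c
  assume v: "v \<in> U"
  then have "v \<in> V"
    using assms by (auto simp: subrep_def)
  then show "\<rho> \<one> v = v" "g \<in> carrier G \<Longrightarrow> \<rho> g (c *\<^sub>C v) = c *\<^sub>C \<rho> g v"
    "g \<in> carrier G \<Longrightarrow> h \<in> carrier G \<Longrightarrow> \<rho> (g \<otimes> h) v = \<rho> g (\<rho> h v)"
    by (simp_all add: one scaleC mult)
  show "g \<in> carrier G \<Longrightarrow> \<rho> g v \<in> U"
    using assms v by (auto simp: subrep_def)
  show "g \<in> carrier G \<Longrightarrow> w \<in> U \<Longrightarrow> \<rho> g (v + w) = \<rho> g v + \<rho> g w"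
    using assms \<open>v \<in> V\<close> by (auto simp: subrep_def add)
qed

text \<open>The projection is obtained as an intertwiner of \<open>V\<close> into itself, so that it
  falls under the commutation hypothesis imposed later.\<close>

lemma maschke:
  assumes "subrep U"
  obtains P where "intertwiner G V \<rho> V \<rho> P" "\<And>v. v \<in> V \<Longrightarrow> P v \<in> U" "\<And>u. u \<in> U \<Longrightarrow> P u = u"
proof -
  interpret U: complex_rep G U \<rho>
    by (rule complex_rep_subrep[OF assms])
  interpret pair: vector_space_pair "scaleC :: complex \<Rightarrow> 'v \<Rightarrow> 'v" "scaleC :: complex \<Rightarrow> 'v \<Rightarrow> 'v" ..
  have UV: "U \<subseteq> V"
    using assms by (simp add: subrep_def)
  \<comment> \<open>A linear left inverse of the identity on \<open>U\<close> with values in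
    \<open>U\<close> is a linear projection onto \<open>U\<close>, not yet equivariant.\<close>
  obtain p :: "'v \<Rightarrow> 'v" where p: "range p \<subseteq> U" "clinear p" "\<And>u. u \<in> U \<Longrightarrow> p u = u"
    using pair.linear_exists_left_inverse_on[OF cvec.linear_id U.subspace] by auto
  define T where "T v = (\<Sum>g\<in>carrier G. \<rho> g (p (\<rho> (inv g) v)))" for v
  have T: "intertwiner G V \<rho> U \<rho> T"
    unfolding T_def
    by (rule intertwiner_average) (use p in \<open>auto intro!: complex_rep_axioms U.complex_rep_axioms
        simp: clinear_add clinear_scaleC\<close>)
  define P where "P v = (1 / of_nat (card (carrier G))) *\<^sub>C T v" for v
  have "intertwiner G V \<rho> U \<rho> P"
    using T unfolding intertwiner_def P_def
    by (auto simp: scaleC_add_right U.scaleC cvec.subspace_scale[OF U.subspace] mult.commute)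
  then have "intertwiner G V \<rho> V \<rho> P" "\<And>v. v \<in> V \<Longrightarrow> P v \<in> U"
    using UV by (auto simp: intertwiner_def)
  moreover have "P u = u" if u: "u \<in> U" for u
  proof -
    have "T u = (\<Sum>g\<in>carrier G. u)"
      unfolding T_def
    proof (rule sum.cong)
      fix g assume g: "g \<in> carrier G"
      then have "\<rho> g (p (\<rho> (inv g) u)) = \<rho> g (\<rho> (inv g) u)"
        using u by (simp add: p U.closed)
      also have "\<dots> = u"
        using g u by (simp add: U.one flip: U.mult)
      finally show "\<rho> g (p (\<rho> (inv g) u)) = u" .
    qed simp
    also have "\<dots> = (of_nat (card (carrier G))) *\<^sub>C u"
      using cvec.scale_sum_left[of "\<lambda>_. 1" "carrier G" u] by (simp add: scaleC_one)
    finally show ?thesis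
      using card_carrier by (simp add: P_def scaleC_one)
  qed
  ultimately show thesis
    by (rule that)
qed

end

text \<open>The ambient type may have infinite dimension; the finite set \<open>X\<close> is what
  makes the two dimensions comparable.\<close>

lemma dim_less:
  assumes "cvec.subspace U" "U \<subset> W" "W \<subseteq> cvec.span X" "finite X"
  shows "cvec.dim U < cvec.dim W"
proof -
  obtain B where B: "B \<subseteq> U" "cvec.independent B" "U \<subseteq> cvec.span B" "card B = cvec.dim U"
    using cvec.basis_exists by blast
  obtain C where C: "C \<subseteq> W" "cvec.independent C" "W \<subseteq> cvec.span C" "card C = cvec.dim W"
    using cvec.basis_exists by blast
  obtain x where x: "x \<in> W" "x \<notin> U"
    using assms(2) by blast
  have "cvec.span B \<subseteq> U"
    using B(1) assms(1) by (rule cvec.span_minimal)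
  then have "x \<notin> cvec.span B"
    using x by blast
  then have ind: "cvec.independent (insert x B)"
    using B(2) by (rule cvec.independent_insertI)
  have "x \<notin> B"
    using \<open>x \<notin> cvec.span B\<close> cvec.span_base[of x B] by blast
  have "C \<subseteq> cvec.span X" "insert x B \<subseteq> cvec.span C"
    using B(1) C(1,3) x assms(2,3) by blast+
  then have "finite C"
    using cvec.independent_span_bound[OF assms(4) C(2)] by blast
  then have "finite (insert x B)" "card (insert x B) \<le> card C"
    using cvec.independent_span_bound[OF _ ind \<open>insert x B \<subseteq> cvec.span C\<close>] by simp_all
  then show ?thesis
    using B(4) C(4) \<open>x \<notin> B\<close> by simp
qed

lemma schur:
  assumes V: "irreducible_rep G V \<rho>" and W: "irreducible_rep G W \<sigma>"
    and f: "intertwiner G V \<rho> W \<sigma> f" and v: "v \<in> V" "f v \<noteq> 0"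
  shows "bij_betw f V W"
proof -
  interpret V: complex_rep G V \<rho>
    using V by (simp add: irreducible_rep_def)
  interpret W: complex_rep G W \<sigma>
    using W by (simp add: irreducible_rep_def)
  note sub = cvec.subspace_add[OF V.subspace] cvec.subspace_scale[OF V.subspace]
    cvec.subspace_0[OF V.subspace]
  define K where "K = {v \<in> V. f v = 0}"
  have W0: "\<sigma> g 0 = 0" if "g \<in> carrier G" for g
    using complex_rep_0(1)[OF W.complex_rep_axioms that] .
  have "cvec.subspace K"
    using sub intertwinerD[OF f] by (auto simp: cvec.subspace_def K_def)
  moreover have "K \<subseteq> V" "\<forall>g\<in>carrier G. \<rho> g ` K \<subseteq> K"
    using intertwinerD(4)[OF f] by (auto simp: K_def V.closed W0)
  ultimately have "K = {0} \<or> K = V"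
    using V unfolding irreducible_rep_def by blast
  then have K: "K = {0}"
    using v by (auto simp: K_def)
  have "cvec.subspace (f ` V)"
  proof (rule cvec.subspaceI)
    show "0 \<in> f ` V"
      using sub(3) intertwinerD(5)[OF f v(1)] by (intro image_eqI[of _ _ 0]) simp_all
    show "x + y \<in> f ` V" if "x \<in> f ` V" "y \<in> f ` V" for x y
      using that by (auto simp: sub simp flip: intertwinerD(2)[OF f])
    show "c *\<^sub>C x \<in> f ` V" if "x \<in> f ` V" for c x
      using that by (auto simp: sub simp flip: intertwinerD(3)[OF f])
  qed
  moreover have "f ` V \<subseteq> W" "\<forall>g\<in>carrier G. \<sigma> g ` f ` V \<subseteq> f ` V"
    using intertwinerD(1)[OF f] by (auto simp flip: intertwinerD(4)[OF f] simp: V.closed)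
  ultimately have "f ` V = {0} \<or> f ` V = W"
    using W unfolding irreducible_rep_def by blast
  then have "f ` V = W"
    using v by auto
  moreover have "inj_on f V"
  proof
    fix x y assume xy: "x \<in> V" "y \<in> V" "f x = f y"
    have "f (x + (-1) *\<^sub>C y) = f x + (-1) *\<^sub>C f y"
      using xy sub intertwinerD[OF f] by metis
    then have "f (x + (-1) *\<^sub>C y) = 0"
      using xy by simp
    moreover have "x + (-1) *\<^sub>C y \<in> V"
      using xy sub by blast
    ultimately have "x + (-1) *\<^sub>C y \<in> K"
      by (simp only: K_def mem_Collect_eq simp_thms)
    then show "x = y"
      using K by simp
  qed
  ultimately show ?thesis
    by (simp add: bij_betw_def)
qed

section \<open>Representations with commuting intertwiners\<close>

text \<open>Commutativity of the intertwiners expresses multiplicity one. The finite spanning set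
  bounds dimensions and later indexes the copies of \<open>V\<close> in the double commutant
  argument.\<close>

locale commuting_rep = finite_group_rep G V \<rho>
  for G (structure) and V :: "'v::complex_vector set" and \<rho> :: "'g \<Rightarrow> 'v \<Rightarrow> 'v" +
  fixes X :: "'v set"
  assumes finite_X: "finite X" and V_span: "V = cvec.span X"
    and commute: "intertwiner G V \<rho> V \<rho> f \<Longrightarrow> intertwiner G V \<rho> V \<rho> h \<Longrightarrow> v \<in> V \<Longrightarrow> f (h v) = h (f v)"
begin

section \<open>Decomposition into pairwise non-isomorphic irreducible submodules\<close>

text \<open>These are actual submodules instead of isomorphism classes;
  \<open>isomorphic_irreps\<close> shows that here the two notions coincide.\<close>

definition irreps where "irreps = {U. subrep U \<and> irreducible_rep G U \<rho>}"

lemma ex_irreps: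
  assumes "subrep U" "U \<noteq> {0}"
  shows "\<exists>U0\<in>irreps. U0 \<subseteq> U"
  using assms
proof (induction "cvec.dim U" arbitrary: U rule: less_induct)
  case less
  show ?case
  proof (cases "irreducible_rep G U \<rho>")
    case True
    then show ?thesis
      using less by (auto simp: irreps_def)
  next
    case False
    then have "\<exists>U'. cvec.subspace U' \<and> U' \<subseteq> U \<and> (\<forall>g\<in>carrier G. \<rho> g ` U' \<subseteq> U') \<and> U' \<noteq> {0} \<and> U' \<noteq> U"
      using less(3) complex_rep_subrep[OF less(2)] by (auto simp: irreducible_rep_def)
    then obtain U' where U': "cvec.subspace U'" "U' \<subseteq> U" "\<forall>g\<in>carrier G. \<rho> g ` U' \<subseteq> U'" "U' \<noteq> {0}" "U' \<noteq> U"
      by (elim exE conjE)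
    have "subrep U'"
      using U'(1-3) less(2) by (auto simp: subrep_def)
    have "cvec.dim U' < cvec.dim U"
    proof (rule dim_less)
      show "U \<subseteq> cvec.span X"
        using less(2) unfolding V_span[symmetric] subrep_def by blast
    qed (use U' finite_X in auto)
    from less(1)[OF this \<open>subrep U'\<close> U'(4)] show ?thesis
      using U'(2) by blast
  qed
qed

definition proj where
  "proj U = (SOME P. intertwiner G V \<rho> V \<rho> P \<and> (\<forall>v\<in>V. P v \<in> U) \<and> (\<forall>u\<in>U. P u = u))"

lemma proj:
  assumes "subrep U"
  shows "intertwiner G V \<rho> V \<rho> (proj U)" "v \<in> V \<Longrightarrow> proj U v \<in> U" "u \<in> U \<Longrightarrow> proj U u = u"
proof -
  have "\<exists>P. intertwiner G V \<rho> V \<rho> P \<and> (\<forall>v\<in>V. P v \<in> U) \<and> (\<forall>u\<in>U. P u = u)"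
    using maschke[OF assms] by metis
  from someI_ex[OF this] show "intertwiner G V \<rho> V \<rho> (proj U)" "v \<in> V \<Longrightarrow> proj U v \<in> U"
    "u \<in> U \<Longrightarrow> proj U u = u"
    unfolding proj_def by blast+
qed

lemma intertwiner_proj:
  assumes "subrep U"
  shows "intertwiner G V \<rho> U \<rho> (proj U)"
  using proj(1)[OF assms] by (rule intertwiner_subset) (simp_all add: proj(2)[OF assms])

lemma subrep_V: "subrep U \<Longrightarrow> u \<in> U \<Longrightarrow> u \<in> V"
  by (auto simp: subrep_def)

text \<open>Precomposed with the projection onto \<open>U\<close>, \<open>f\<close> becomes an
  endomorphism of \<open>V\<close>. It commutes with that projection, which confines its values to
  \<open>U\<close>.\<close>

lemma intertwiner_stable:
  assumes U: "subrep U" and f: "intertwiner G U \<rho> V \<rho> f" and u: "u \<in> U"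
  shows "f u \<in> U"
proof -
  have "proj U (f (proj U u)) = f (proj U (proj U u))"
    by (rule commute[OF proj(1)[OF U] intertwiner_comp[OF intertwiner_proj[OF U] f] subrep_V[OF U u]])
  then have "proj U (f u) = f u"
    using u by (simp add: proj(3)[OF U])
  then show ?thesis
    using proj(2)[OF U intertwinerD(1)[OF f u]] by simp
qed

text \<open>By Schur's lemma \<open>f\<close> maps onto \<open>W\<close>, and by
  \<open>intertwiner_stable\<close> its values stay in \<open>U\<close>; so \<open>W\<close> lies in
  \<open>U\<close>, and irreducibility gives equality. Hence no type occurs twice.\<close>

lemma irreps_eq:
  assumes U: "U \<in> irreps" and W: "W \<in> irreps" and f: "intertwiner G U \<rho> W \<rho> f"
    and u: "u \<in> U" "f u \<noteq> 0"
  shows "U = W"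
proof -
  have U': "subrep U" "irreducible_rep G U \<rho>" and W': "subrep W" "irreducible_rep G W \<rho>"
    using U W by (auto simp: irreps_def)
  have "bij_betw f U W"
    using schur U' W' f u by blast
  moreover have "f u \<in> U" if "u \<in> U" for u
    using that intertwiner_stable[OF U'(1)] intertwiner_subset[OF f order_refl] intertwinerD(1)[OF f]
      subrep_V[OF W'(1)] by blast
  ultimately have "W \<subseteq> U"
    by (auto simp: bij_betw_def)
  then show ?thesis
    using U' W' unfolding irreducible_rep_def subrep_def by metis
qed

lemma irreps_proj:
  assumes "U \<in> irreps" "W \<in> irreps" "U \<noteq> W" "v \<in> V"
  shows "proj W (proj U v) = 0"
proof (rule ccontr)
  assume "proj W (proj U v) \<noteq> 0"
  moreover have s: "subrep U" "subrep W"
    using assms by (simp_all add: irreps_def)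
  moreover have "intertwiner G U \<rho> W \<rho> (proj W)"
    using intertwiner_proj[OF s(2)]
    by (rule intertwiner_subset) (use s in \<open>auto simp: proj(2) dest: subrep_V\<close>)
  ultimately show False
    using irreps_eq[OF assms(1,2)] proj(2)[OF s(1) assms(4)] assms(3) by blast
qed

lemma proj_irreps:
  assumes "U \<in> irreps"
  shows "intertwiner G V \<rho> V \<rho> (proj U)" "v \<in> V \<Longrightarrow> proj U v \<in> U" "u \<in> U \<Longrightarrow> proj U u = u"
    "v \<in> V \<Longrightarrow> proj U v \<in> V" "v \<in> V \<Longrightarrow> W \<in> irreps \<Longrightarrow> proj W (proj U v) = (if U = W then proj U v else 0)"
proof -
  have s: "subrep U"
    using assms by (simp add: irreps_def)
  show "intertwiner G V \<rho> V \<rho> (proj U)" "v \<in> V \<Longrightarrow> proj U v \<in> U" "u \<in> U \<Longrightarrow> proj U u = u"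
    by (rule proj[OF s], assumption?)+
  then show "v \<in> V \<Longrightarrow> proj U v \<in> V" "v \<in> V \<Longrightarrow> W \<in> irreps \<Longrightarrow> proj W (proj U v) = (if U = W then proj U v else 0)"
    using irreps_proj[OF assms, of W v] proj[OF s] subrep_V[OF s] by auto
qed

text \<open>Nonzero vectors from distinct members are independent, because every projection keeps
  its own vector and kills the others. So there are at most \<open>card X\<close> members.\<close>

lemma finite_irreps: "finite irreps"
proof -
  have "card F \<le> card X" if F: "F \<subseteq> irreps" "finite F" for F
  proof -
    have "\<exists>u\<in>U. u \<noteq> 0" if "U \<in> irreps" for U
      using that complex_rep_0(2)[OF complex_rep_subrep one_closed, of U]
      unfolding irreps_def irreducible_rep_def by auto
    then obtain nz where nz: "\<And>U. U \<in> irreps \<Longrightarrow> nz U \<in> U" "\<And>U. U \<in> irreps \<Longrightarrow> nz U \<noteq> 0"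
      by metis
    have nzV: "nz U \<in> V" if "U \<in> irreps" for U
      using nz(1)[OF that] subrep_V that by (auto simp: irreps_def)
    have pnz: "proj W (nz U) = (if U = W then nz U else 0)" if "U \<in> irreps" "W \<in> irreps" for U W
      using proj_irreps(5)[OF that(1) nzV[OF that(1)] that(2)] proj_irreps(3)[OF that(1) nz(1)[OF that(1)]]
      by (cases "U = W") simp_all
    have inj: "inj_on nz F"
      using F(1) pnz nz(2) by (intro inj_onI) (metis subsetD)
    have "cvec.independent (nz ` F)"
    proof (rule cvec.independent_if_scalars_zero)
      fix c x assume 0: "(\<Sum>x\<in>nz ` F. c x *\<^sub>C x) = 0" and "x \<in> nz ` F"
      then obtain U where U: "U \<in> F" "x = nz U"
        by blast
      then have UI: "U \<in> irreps"
        using F by blast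
      have "0 = proj U (\<Sum>W\<in>F. c (nz W) *\<^sub>C nz W)"
        using 0 intertwinerD(5)[OF proj_irreps(1)[OF UI] zero_mem] by (simp add: sum.reindex[OF inj])
      also have "\<dots> = (\<Sum>W\<in>F. proj U (c (nz W) *\<^sub>C nz W))"
        using F nzV by (intro intertwiner_sum[OF proj_irreps(1)[OF UI] subspace zero_mem])
          (auto intro: cvec.subspace_scale[OF subspace])
      also have "\<dots> = (\<Sum>W\<in>F. if W = U then c (nz W) *\<^sub>C nz W else 0)"
        using F nzV UI
        by (intro sum.cong) (auto simp: intertwinerD(3)[OF proj_irreps(1)[OF UI]] pnz subset_iff)
      also have "\<dots> = c x *\<^sub>C x"
        using U F by simp
      finally show "c x = 0"
        using nz(2)[OF UI] U by simp
    qed (use F in simp)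
    moreover have "nz ` F \<subseteq> cvec.span X"
      using nzV F V_span by blast
    ultimately have "card (nz ` F) \<le> card X"
      using cvec.independent_span_bound[OF finite_X] by blast
    then show ?thesis
      by (simp add: card_image[OF inj])
  qed
  then show ?thesis
    using finite_if_finite_subsets_card_bdd by blast
qed

text \<open>The common kernel \<open>W\<close> of the projections is a submodule. An irreducible
  submodule inside it would be fixed and killed by its own projection, so \<open>W\<close> vanishes,
  and the difference of both sides lies in \<open>W\<close>.\<close>

lemma sum_proj:
  assumes v: "v \<in> V"
  shows "(\<Sum>U\<in>irreps. proj U v) = v"
proof -
  define W where "W = {v \<in> V. \<forall>U\<in>irreps. proj U v = 0}"
  note i = intertwinerD[OF proj_irreps(1)]
  note sub = cvec.subspace_add[OF subspace] cvec.subspace_scale[OF subspace]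
    cvec.subspace_diff[OF subspace] cvec.subspace_sum[OF subspace]
  have "\<rho> g 0 = 0" if "g \<in> carrier G" for g
    using complex_rep_0(1)[OF complex_rep_axioms that] .
  then have "subrep W"
    unfolding subrep_def W_def
    by (auto simp: cvec.subspace_def i sub zero_mem closed i(5)[OF _ zero_mem])
  moreover have False if "U \<in> irreps" "U \<subseteq> W" for U
  proof -
    have "U \<subseteq> {0}"
    proof
      fix u assume "u \<in> U"
      then have "proj U u = u" "u \<in> W"
        using that(2) proj_irreps(3)[OF that(1)] by auto
      then have "u = 0"
        using that(1) unfolding W_def by auto
      then show "u \<in> {0}"
        by simp
    qed
    moreover have "0 \<in> U" "U \<noteq> {0}"
      using that(1) complex_rep_0(2)[OF complex_rep_subrep one_closed, of U]
      unfolding irreps_def irreducible_rep_def by auto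
    ultimately show False
      by blast
  qed
  ultimately have W: "W = {0}"
    using ex_irreps by blast
  have V': "proj U v \<in> V" if "U \<in> irreps" for U
    using proj_irreps(4)[OF that v] .
  have "proj U (v - (\<Sum>U\<in>irreps. proj U v)) = 0" if U: "U \<in> irreps" for U
  proof -
    let ?s = "\<Sum>U\<in>irreps. proj U v"
    have s: "?s \<in> V"
      using V' by (intro sub(4))
    have "proj U (v + (-1) *\<^sub>C ?s) = proj U v + (-1) *\<^sub>C proj U ?s"
      unfolding i(2)[OF U v sub(2)[OF s]] i(3)[OF U s] ..
    also have "proj U ?s = (\<Sum>W\<in>irreps. proj U (proj W v))"
      using V' by (rule intertwiner_sum[OF proj_irreps(1)[OF U] subspace zero_mem])
    also have "\<dots> = (\<Sum>W\<in>irreps. if W = U then proj U v else 0)"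
      by (rule sum.cong) (use proj_irreps(5)[OF _ v U] in auto)
    also have "\<dots> = proj U v"
      using U finite_irreps by simp
    finally show ?thesis
      by simp
  qed
  moreover have "v - (\<Sum>U\<in>irreps. proj U v) \<in> V"
    using v V' by (intro sub(3) sub(4))
  ultimately have "v - (\<Sum>U\<in>irreps. proj U v) \<in> W"
    by (simp add: W_def)
  then show ?thesis
    using W by simp
qed

lemma isomorphic_irreps:
  assumes "U \<in> irreps" "W \<in> irreps" "isomorphic_reps G U \<rho> W \<rho>"
  shows "U = W"
proof -
  obtain f where f: "intertwiner G U \<rho> W \<rho> f" "bij_betw f U W"
    using assms(3) by (auto simp: isomorphic_reps_iff)
  have "W \<noteq> {0}" "0 \<in> W"
    using assms(2) complex_rep_0(2)[OF complex_rep_subrep one_closed, of W]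
    unfolding irreps_def irreducible_rep_def by auto
  then obtain u where "u \<in> U" "f u \<noteq> 0"
    using f(2) by (auto simp: bij_betw_def)
  then show ?thesis
    using irreps_eq assms(1,2) f(1) by blast
qed

text \<open>Multiplicity one is already contained in \<open>irreps\<close>; the hypothesis
  \<open>all\<close> adds completeness. A nonzero map from \<open>U\<close> into \<open>V\<close>
  has a nonzero component, which Schur's lemma turns into an isomorphism with one summand. The
  summands are copied to sequence spaces, where \<open>gelfand_model\<close> expects them.\<close>

lemma gelfand_modelI:
  assumes all: "\<And>(U :: (nat \<Rightarrow>\<^sub>0 complex) set) \<sigma>. irreducible_rep G U \<sigma> \<Longrightarrow>
    \<exists>f. intertwiner G U \<sigma> V \<rho> f \<and> (\<exists>u\<in>U. f u \<noteq> 0)"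
  shows "gelfand_model G V \<rho>"
proof -
  define n where "n = card irreps"
  obtain h where "bij_betw h {..<n} irreps"
    using ex_bij_betw_nat_finite[OF finite_irreps] by (auto simp: n_def atLeast0LessThan)
  then have h: "h ` {..<n} = irreps" "inj_on h {..<n}"
    by (auto simp: bij_betw_def)
  have hi: "h i \<in> irreps" if "i < n" for i
    using h that by auto
  have "\<exists>(Y :: (nat \<Rightarrow>\<^sub>0 complex) set) \<tau>. irreducible_rep G Y \<tau> \<and> isomorphic_reps G U \<rho> Y \<tau>"
    if "U \<in> irreps" for U
    using irreducible_rep_on_sequences[OF _ finite_carrier] that by (auto simp: irreps_def)
  then have "\<exists>p :: (nat \<Rightarrow>\<^sub>0 complex) set \<times> _. irreducible_rep G (fst p) (snd p) \<and>
      isomorphic_reps G (h i) \<rho> (fst p) (snd p)" if "i < n" for i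
    using hi[OF that] by fastforce
  then obtain p :: "nat \<Rightarrow> (nat \<Rightarrow>\<^sub>0 complex) set \<times> _" where
    p: "\<And>i. i < n \<Longrightarrow> irreducible_rep G (fst (p i)) (snd (p i)) \<and>
      isomorphic_reps G (h i) \<rho> (fst (p i)) (snd (p i))"
    by metis
  define Y where "Y i = fst (p i)" for i
  define \<tau> where "\<tau> i = snd (p i)" for i
  have Y: "irreducible_rep G (Y i) (\<tau> i)" and iso: "isomorphic_reps G (h i) \<rho> (Y i) (\<tau> i)"
    if "i < n" for i
    using p[OF that] by (simp_all add: Y_def \<tau>_def)
  obtain \<phi> where \<phi>: "\<And>i. i < n \<Longrightarrow> intertwiner G (h i) \<rho> (Y i) (\<tau> i) (\<phi> i)"
    "\<And>i. i < n \<Longrightarrow> bij_betw (\<phi> i) (h i) (Y i)"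
    using iso unfolding isomorphic_reps_iff by metis
  have ph: "proj (h i) v \<in> h i" if "i < n" "v \<in> V" for i v
    using proj_irreps(2)[OF hi[OF that(1)] that(2)] .
  define F where "F v = (\<Sum>i<n. Poly_Mapping.single i (\<phi> i (proj (h i) v)))" for v
  have F: "Poly_Mapping.lookup (F v) i = (if i < n then \<phi> i (proj (h i) v) else 0)" for v i
    by (simp add: F_def lookup_sum lookup_single when_def)
  have rep: "complex_rep G (Y i) (\<tau> i)" "complex_rep G (h i) \<rho>" if "i < n" for i
    using Y[OF that] hi[OF that] by (auto simp: irreducible_rep_def irreps_def)
  have phV: "intertwiner G V \<rho> (Y i) (\<tau> i) (\<lambda>v. \<phi> i (proj (h i) v))" if "i < n" for i
    by (rule intertwiner_comp[OF intertwiner_proj \<phi>(1)]) (use hi that in \<open>auto simp: irreps_def\<close>)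
  have "intertwiner G V \<rho> (dsum_space {..<n} Y) (dsum_action \<tau>) F"
    unfolding intertwiner_def
  proof (intro conjI ballI allI)
    fix v w c g assume v: "v \<in> V"
    show "F v \<in> dsum_space {..<n} Y"
      using intertwinerD(1)[OF phV v] by (auto simp: dsum_space_def F in_keys_iff split: if_splits)
    show "F (c *\<^sub>C v) = c *\<^sub>C F v"
      by (rule poly_mapping_eqI) (simp add: F intertwinerD(3)[OF phV v])
    show "F (v + w) = F v + F w" if "w \<in> V"
      by (rule poly_mapping_eqI) (simp add: F lookup_add intertwinerD(2)[OF phV v that])
    assume g: "g \<in> carrier G"
    show "F (\<rho> g v) = dsum_action \<tau> g (F v)"
      by (rule poly_mapping_eqI)
        (simp add: F dsum_action_def lookup_mapp when_def in_keys_iff intertwinerD(4)[OF phV v g]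
          complex_rep_0(1)[OF rep(1) g])
  qed
  moreover have "bij_betw F V (dsum_space {..<n} Y)"
    unfolding bij_betw_def
  proof
    show "inj_on F V"
    proof
      fix v w assume vw: "v \<in> V" "w \<in> V" "F v = F w"
      have "proj U v = proj U w" if "U \<in> irreps" for U
      proof -
        obtain i where i: "i < n" "U = h i"
          using \<open>U \<in> irreps\<close> unfolding h(1)[symmetric] by blast
        then have "\<phi> i (proj (h i) v) = \<phi> i (proj (h i) w)"
          using F[of v i] F[of w i] vw(3) by simp
        then show ?thesis
          using \<phi>(2)[OF i(1)] ph[OF i(1)] vw i by (auto simp: bij_betw_def inj_on_def)
      qed
      then have "(\<Sum>U\<in>irreps. proj U v) = (\<Sum>U\<in>irreps. proj U w)"
        by (rule sum.cong[OF refl])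
      then show "v = w"
        unfolding sum_proj[OF vw(1)] sum_proj[OF vw(2)] .
    qed
    show "F ` V = dsum_space {..<n} Y"
    proof
      show "F ` V \<subseteq> dsum_space {..<n} Y"
        using calculation by (auto simp: intertwiner_def)
      show "dsum_space {..<n} Y \<subseteq> F ` V"
      proof
        fix y assume y: "y \<in> dsum_space {..<n} Y"
        define w where "w i = inv_into (h i) (\<phi> i) (Poly_Mapping.lookup y i)" for i
        have w: "w i \<in> h i" "\<phi> i (w i) = Poly_Mapping.lookup y i" if "i < n" for i
          using y that \<phi>(2)[OF that]
          by (auto simp: w_def dsum_space_def bij_betw_def inv_into_into f_inv_into_f)
        have wV: "w i \<in> V" if "i < n" for i
          using subrep_V[OF _ w(1)[OF that]] hi[OF that] by (simp add: irreps_def)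
        have pw: "proj (h i) (\<Sum>j<n. w j) = w i" if i: "i < n" for i
        proof -
          have "proj (h i) (\<Sum>j<n. w j) = (\<Sum>j<n. proj (h i) (w j))"
            using wV by (intro intertwiner_sum[OF proj_irreps(1)[OF hi[OF i]] subspace zero_mem]) simp
          also have "\<dots> = (\<Sum>j<n. if j = i then w i else 0)"
          proof (rule sum.cong)
            fix j assume "j \<in> {..<n}"
            then have j: "j < n"
              by simp
            have "proj (h i) (w j) = (if h j = h i then proj (h j) (w j) else 0)"
              using proj_irreps(5)[OF hi[OF j] wV[OF j] hi[OF i]] proj_irreps(3)[OF hi[OF j] w(1)[OF j]]
              by simp
            moreover have "proj (h i) (w i) = w i"
              by (rule proj_irreps(3)[OF hi[OF i] w(1)[OF i]])
            moreover have "h j \<noteq> h i" if "j \<noteq> i"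
              using inj_onD[OF h(2), of j i] i j that by auto
            ultimately show "proj (h i) (w j) = (if j = i then w i else 0)"
              by presburger
          qed simp
          finally show ?thesis
            using i by simp
        qed
        have "F (\<Sum>j<n. w j) = y"
        proof (rule poly_mapping_eqI)
          fix k
          have "Poly_Mapping.keys y \<subseteq> {..<n}"
            using y by (simp add: dsum_space_def)
          then have "\<not> k < n \<Longrightarrow> Poly_Mapping.lookup y k = 0"
            using in_keys_iff[of k y] by blast
          then show "Poly_Mapping.lookup (F (\<Sum>j<n. w j)) k = Poly_Mapping.lookup y k"
            using pw[of k] w(2)[of k] by (auto simp: F)
        qed
        moreover have "(\<Sum>j<n. w j) \<in> V"
          using wV by (intro cvec.subspace_sum[OF subspace]) simp
        ultimately show "y \<in> F ` V"
          by blast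
      qed
    qed
  qed
  ultimately have "isomorphic_reps G V \<rho> (dsum_space {..<n} Y) (dsum_action \<tau>)"
    unfolding isomorphic_reps_iff by blast
  moreover have "\<exists>!i. i \<in> {..<n} \<and> isomorphic_reps G U \<sigma> (Y i) (\<tau> i)"
    if U: "irreducible_rep G U \<sigma>" for U :: "(nat \<Rightarrow>\<^sub>0 complex) set" and \<sigma>
  proof -
    have Urep: "complex_rep G U \<sigma>"
      using U by (simp add: irreducible_rep_def)
    obtain f u where f: "intertwiner G U \<sigma> V \<rho> f" "u \<in> U" "f u \<noteq> 0"
      using all[OF U] by blast
    then have "(\<Sum>W\<in>irreps. proj W (f u)) \<noteq> 0"
      using sum_proj intertwinerD(1) by metis
    then obtain W where W: "W \<in> irreps" "proj W (f u) \<noteq> 0"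
      by (meson sum.neutral)
    then obtain i where i: "i < n" "W = h i"
      unfolding h(1)[symmetric] by blast
    have "subrep W" "irreducible_rep G W \<rho>"
      using W by (auto simp: irreps_def)
    have "intertwiner G U \<sigma> W \<rho> (\<lambda>x. proj W (f x))"
      by (rule intertwiner_comp[OF f(1) intertwiner_proj[OF \<open>subrep W\<close>]])
    moreover from this have "bij_betw (\<lambda>x. proj W (f x)) U W"
      by (rule schur[OF U \<open>irreducible_rep G W \<rho>\<close>]) (fact f(2) W(2))+
    ultimately have "isomorphic_reps G U \<sigma> W \<rho>"
      unfolding isomorphic_reps_iff by blast
    then have "isomorphic_reps G U \<sigma> (Y i) (\<tau> i)"
      using iso[OF i(1)] isomorphic_reps_trans i(2) by blast
    have uniq: "j = i" if "j < n" "isomorphic_reps G U \<sigma> (Y j) (\<tau> j)" for j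
    proof -
      note s1 = isomorphic_reps_sym[OF \<open>isomorphic_reps G U \<sigma> (Y i) (\<tau> i)\<close> Urep]
      note s2 = isomorphic_reps_sym[OF iso rep(2), OF that(1) that(1)]
      have "isomorphic_reps G (h i) \<rho> (h j) \<rho>"
        by (rule isomorphic_reps_trans[OF isomorphic_reps_trans[OF
              isomorphic_reps_trans[OF iso[OF i(1)] s1] that(2)] s2])
      then have "h i = h j"
        using isomorphic_irreps hi i(1) that(1) by blast
      then show ?thesis
        using h(2) i(1) that(1) by (auto simp: inj_on_def)
    qed
    show ?thesis
    proof (rule ex1I)
      show "i \<in> {..<n} \<and> isomorphic_reps G U \<sigma> (Y i) (\<tau> i)"
        using i(1) \<open>isomorphic_reps G U \<sigma> (Y i) (\<tau> i)\<close> by simp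
      show "j = i" if "j \<in> {..<n} \<and> isomorphic_reps G U \<sigma> (Y j) (\<tau> j)" for j
        using uniq that unfolding lessThan_iff by (elim conjE)
    qed
  qed
  ultimately show ?thesis
    unfolding gelfand_model_def using finite_carrier complex_rep_axioms Y
    by (intro conjI exI[of _ "{..<n}"] exI[of _ Y] exI[of _ \<tau>] allI impI ballI)
      (simp_all only: lessThan_iff)
qed

end

section \<open>The double commutant: intertwiners inside the group algebra\<close>

lemma lookup_dsum_action:
  assumes "\<And>i. i \<in> I \<Longrightarrow> complex_rep G (U i) (\<sigma> i)" "y \<in> dsum_space I U" "g \<in> carrier G"
  shows "Poly_Mapping.lookup (dsum_action \<sigma> g y) i = (if i \<in> I then \<sigma> i g (Poly_Mapping.lookup y i) else 0)"
proof (cases "i \<in> I")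
  case True
  then show ?thesis
    using complex_rep_0(1)[OF assms(1)[OF True] assms(3)]
    by (simp add: dsum_action_def lookup_mapp when_def in_keys_iff)
next
  case False
  then have "i \<notin> Poly_Mapping.keys y"
    using assms(2) by (auto simp: dsum_space_def)
  with False show ?thesis
    by (simp add: dsum_action_def lookup_mapp)
qed

lemma complex_rep_dsum:
  assumes "group G" and U: "\<And>i. i \<in> I \<Longrightarrow> complex_rep G (U i) (\<sigma> i)"
  shows "complex_rep G (dsum_space I U) (dsum_action \<sigma>)"
proof -
  interpret group G by fact
  have mem: "y \<in> dsum_space I U \<longleftrightarrow> (\<forall>i. if i \<in> I then Poly_Mapping.lookup y i \<in> U i else Poly_Mapping.lookup y i = 0)" for y
    by (auto simp: dsum_space_def in_keys_iff subset_iff)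
  have look: "Poly_Mapping.lookup (dsum_action \<sigma> g y) i =
      (if i \<in> I then \<sigma> i g (Poly_Mapping.lookup y i) else 0)"
    if "y \<in> dsum_space I U" "g \<in> carrier G" for g y i
    using U that by (rule lookup_dsum_action)
  note subsp = complex_rep.subspace[OF U]
  have sub: "cvec.subspace (dsum_space I U)"
    by (rule cvec.subspaceI)
      (auto simp: mem lookup_add cvec.subspace_0[OF subsp] cvec.subspace_add[OF subsp]
        cvec.subspace_scale[OF subsp] split: if_splits)
  have cl: "dsum_action \<sigma> g v \<in> dsum_space I U" if "g \<in> carrier G" "v \<in> dsum_space I U" for g v
    using that(2) unfolding mem[of "dsum_action \<sigma> g v"] look[OF that(2,1)]
    by (auto simp: mem complex_rep.closed[OF U that(1)] split: if_splits)
  show ?thesis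
  proof
    fix g h v w c assume v: "v \<in> dsum_space I U"
    have vi: "Poly_Mapping.lookup v i \<in> U i" if "i \<in> I" for i
      using v that by (simp add: dsum_space_def)
    show "dsum_action \<sigma> \<one>\<^bsub>G\<^esub> v = v"
      using v by (intro poly_mapping_eqI)
        (auto simp: look[OF v one_closed] complex_rep.one[OF U vi] mem split: if_splits)
    {
      assume g: "g \<in> carrier G"
      show "dsum_action \<sigma> g v \<in> dsum_space I U"
        using cl g v .
      have "c *\<^sub>C v \<in> dsum_space I U"
        using sub v by (simp add: cvec.subspace_scale)
      then show "dsum_action \<sigma> g (c *\<^sub>C v) = c *\<^sub>C dsum_action \<sigma> g v"
        by (intro poly_mapping_eqI) (simp add: look g v complex_rep.scaleC[OF U g vi])
      {
        assume w: "w \<in> dsum_space I U"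
        then have wi: "Poly_Mapping.lookup w i \<in> U i" if "i \<in> I" for i
          using that by (simp add: dsum_space_def)
        have "v + w \<in> dsum_space I U"
          using sub v w by (simp add: cvec.subspace_add)
        then show "dsum_action \<sigma> g (v + w) = dsum_action \<sigma> g v + dsum_action \<sigma> g w"
          by (intro poly_mapping_eqI) (simp add: look g v w lookup_add complex_rep.add[OF U g vi wi])
      }
      assume h: "h \<in> carrier G"
      show "dsum_action \<sigma> (g \<otimes>\<^bsub>G\<^esub> h) v = dsum_action \<sigma> g (dsum_action \<sigma> h v)"
        by (intro poly_mapping_eqI) (simp add: look g h v cl complex_rep.mult[OF U g h vi])
    }
  qed (rule sub)
qed

context commuting_rep
begin

lemma X_V: "x \<in> X \<Longrightarrow> x \<in> V"
  by (simp add: V_span cvec.span_base)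

text \<open>The double commutant argument: \<open>f\<close> commutes with all intertwiners, hence, acting diagonally on
  the families indexed by \<open>X\<close>, with the projection onto the submodule generated by \<open>X\<close> itself.\<close>

lemma intertwiner_in_group_algebra:
  assumes f: "intertwiner G V \<rho> V \<rho> f"
  obtains a where "\<And>v. v \<in> V \<Longrightarrow> f v = (\<Sum>g\<in>carrier G. a g *\<^sub>C \<rho> g v)"
proof -
  define VX where "VX = dsum_space X (\<lambda>_. V)"
  define D where "D = dsum_action (\<lambda>_ :: 'v. \<rho>)"
  have rep: "complex_rep G VX D"
    unfolding VX_def D_def by (rule complex_rep_dsum[OF group_axioms complex_rep_axioms])
  then interpret VX: finite_group_rep G VX D
    by (intro finite_group_rep.intro finite_group_rep_axioms.intro finite_carrier)
  have look: "Poly_Mapping.lookup (D g y) x = \<rho> g (Poly_Mapping.lookup y x)"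
    if "y \<in> VX" "g \<in> carrier G" "x \<in> X" for y g x
    unfolding D_def using lookup_dsum_action[of X G "\<lambda>_. V" "\<lambda>_. \<rho>" y g x] that complex_rep_axioms
    by (simp add: VX_def)
  have single: "Poly_Mapping.single x v \<in> VX" if "x \<in> X" "v \<in> V" for x v
    using that zero_mem by (auto simp: VX_def dsum_space_def lookup_single when_def)
  have VX_eq: "y = z" if "y \<in> VX" "z \<in> VX" "\<And>x. x \<in> X \<Longrightarrow> Poly_Mapping.lookup y x = Poly_Mapping.lookup z x" for y z
  proof (rule poly_mapping_eqI)
    fix x
    show "Poly_Mapping.lookup y x = Poly_Mapping.lookup z x"
    proof (cases "x \<in> X")
      case False
      then have "x \<notin> Poly_Mapping.keys y" "x \<notin> Poly_Mapping.keys z"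
        using that(1,2) by (auto simp: VX_def dsum_space_def)
      then show ?thesis
        by (simp add: in_keys_iff)
    qed (rule that(3))
  qed
  have VX_V: "Poly_Mapping.lookup y x \<in> V" if "y \<in> VX" "x \<in> X" for x y
    using that by (simp add: VX_def dsum_space_def)
  \<comment> \<open>The tuple of all generators, each placed at the index that it itself is. An
    identity for \<open>x0\<close> in \<open>VX\<close>, read at index \<open>x\<close>, is the same
    identity for the vector \<open>x\<close>.\<close>
  define x0 where "x0 = (\<Sum>x\<in>X. Poly_Mapping.single x x)"
  have x0: "x0 \<in> VX" "\<And>x. x \<in> X \<Longrightarrow> Poly_Mapping.lookup x0 x = x"
  proof -
    show "x0 \<in> VX"
      unfolding x0_def by (intro cvec.subspace_sum[OF VX.subspace] single X_V)
    show "Poly_Mapping.lookup x0 x = x" if "x \<in> X" for x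
      using that finite_X by (simp add: x0_def lookup_sum lookup_single when_def)
  qed
  define S where "S = {\<Sum>g\<in>carrier G. a g *\<^sub>C D g x0 |a. True}"
  have SI: "(\<Sum>g\<in>carrier G. a g *\<^sub>C D g x0) \<in> S" for a
    by (auto simp: S_def)
  have S: "VX.subrep S"
    unfolding VX.subrep_def
  proof (intro conjI ballI)
    show "S \<subseteq> VX"
      unfolding S_def
      by (auto intro!: cvec.subspace_sum[OF VX.subspace] cvec.subspace_scale[OF VX.subspace] VX.closed x0)
    show "cvec.subspace S"
    proof (rule cvec.subspaceI)
      show "0 \<in> S"
        using SI[of "\<lambda>_. 0"] by simp
      show "y + z \<in> S" if yz: "y \<in> S" "z \<in> S" for y z
      proof -
        obtain a b where "y = (\<Sum>g\<in>carrier G. a g *\<^sub>C D g x0)" "z = (\<Sum>g\<in>carrier G. b g *\<^sub>C D g x0)"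
          using yz by (auto simp: S_def)
        then have "y + z = (\<Sum>g\<in>carrier G. (a g + b g) *\<^sub>C D g x0)"
          by (simp add: scaleC_add_left sum.distrib)
        then show ?thesis
          using SI by metis
      qed
      show "c *\<^sub>C y \<in> S" if y: "y \<in> S" for c y
      proof -
        obtain a where "y = (\<Sum>g\<in>carrier G. a g *\<^sub>C D g x0)"
          using y by (auto simp: S_def)
        then have "c *\<^sub>C y = (\<Sum>g\<in>carrier G. (c * a g) *\<^sub>C D g x0)"
          by (simp add: cvec.scale_sum_right scaleC_scaleC)
        then show ?thesis
          using SI by metis
      qed
    qed
    fix h assume h: "h \<in> carrier G"
    show "D h ` S \<subseteq> S"
    proof
      fix z assume "z \<in> D h ` S"
      then obtain a where "z = D h (\<Sum>g\<in>carrier G. a g *\<^sub>C D g x0)"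
        by (auto simp: S_def)
      also have "\<dots> = (\<Sum>g\<in>carrier G. a g *\<^sub>C D (h \<otimes> g) x0)"
        using h x0(1) by (subst complex_rep_sum[OF rep])
          (simp_all add: VX.scaleC VX.closed VX.mult cvec.subspace_scale[OF VX.subspace])
      also have "\<dots> = (\<Sum>g\<in>carrier G. a (inv h \<otimes> (h \<otimes> g)) *\<^sub>C D (h \<otimes> g) x0)"
        using h by (intro sum.cong) (simp_all flip: m_assoc)
      also have "\<dots> = (\<Sum>g\<in>carrier G. a (inv h \<otimes> g) *\<^sub>C D g x0)"
        by (rule sum_mult_left[OF h])
      finally show "z \<in> S"
        using SI by metis
    qed
  qed
  have "x0 \<in> S"
  proof -
    have "(\<Sum>g\<in>carrier G. (if g = \<one> then 1 else 0) *\<^sub>C D g x0) = (\<Sum>g\<in>carrier G. if g = \<one> then D \<one> x0 else 0)"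
      by (rule sum.cong) (auto simp: scaleC_one)
    also have "\<dots> = x0"
      using finite_carrier by (simp add: VX.one x0)
    finally show ?thesis
      using SI[of "\<lambda>g. if g = \<one> then 1 else 0"] by simp
  qed
  obtain P where P: "intertwiner G VX D VX D P" "\<And>y. y \<in> VX \<Longrightarrow> P y \<in> S" "\<And>y. y \<in> S \<Longrightarrow> P y = y"
    using VX.maschke[OF S] by blast
  \<comment> \<open>The blocks of \<open>P\<close>, seen as a matrix indexed by \<open>X\<close>,
    are intertwiners of \<open>V\<close> and hence commute with \<open>f\<close>. So
    \<open>P\<close> commutes with the diagonal action \<open>fX\<close>.\<close>
  have comp: "intertwiner G V \<rho> V \<rho> (\<lambda>v. Poly_Mapping.lookup (P (Poly_Mapping.single x v)) x')"
    if x: "x \<in> X" "x' \<in> X" for x x'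
    unfolding intertwiner_def
  proof (intro conjI ballI allI)
    fix v w c g assume v: "v \<in> V"
    note i = intertwinerD[OF P(1) single[OF x(1) v]]
    show "Poly_Mapping.lookup (P (Poly_Mapping.single x v)) x' \<in> V"
      using VX_V[OF i(1) x(2)] .
    show "Poly_Mapping.lookup (P (Poly_Mapping.single x (c *\<^sub>C v))) x' =
        c *\<^sub>C Poly_Mapping.lookup (P (Poly_Mapping.single x v)) x'"
      using i(3)[of c] by (simp add: scaleC_single)
    show "Poly_Mapping.lookup (P (Poly_Mapping.single x (v + w))) x' =
        Poly_Mapping.lookup (P (Poly_Mapping.single x v)) x' + Poly_Mapping.lookup (P (Poly_Mapping.single x w)) x'"
      if "w \<in> V"
      using i(2)[OF single[OF x(1) that]] by (simp add: single_add lookup_add)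
    assume g: "g \<in> carrier G"
    have "D g (Poly_Mapping.single x v) = Poly_Mapping.single x (\<rho> g v)"
      by (rule VX_eq) (use x v g single complex_rep_0(1)[OF complex_rep_axioms g]
        in \<open>auto simp: look closed VX.closed lookup_single when_def\<close>)
    then show "Poly_Mapping.lookup (P (Poly_Mapping.single x (\<rho> g v))) x' =
        \<rho> g (Poly_Mapping.lookup (P (Poly_Mapping.single x v)) x')"
      using i(4)[OF g] look[OF i(1) g x(2)] by simp
  qed
  define fX where "fX y = (\<Sum>x\<in>X. Poly_Mapping.single x (f (Poly_Mapping.lookup y x)))" for y :: "'v \<Rightarrow>\<^sub>0 'v"
  have fX: "Poly_Mapping.lookup (fX y) x = f (Poly_Mapping.lookup y x)" if "x \<in> X" for x y
    using that finite_X by (simp add: fX_def lookup_sum lookup_single when_def)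
  have fV: "f v \<in> V" if "v \<in> V" for v
    using intertwinerD(1)[OF f that] .
  have fX_VX: "fX y \<in> VX" if "y \<in> VX" for y
    unfolding fX_def using that by (intro cvec.subspace_sum[OF VX.subspace] single fV VX_V)
  have expand: "P y = (\<Sum>x\<in>X. P (Poly_Mapping.single x (Poly_Mapping.lookup y x)))" if y: "y \<in> VX" for y
  proof -
    have "y = (\<Sum>x\<in>X. Poly_Mapping.single x (Poly_Mapping.lookup y x))"
      using y finite_X
      by (intro VX_eq) (auto simp: lookup_sum lookup_single when_def intro!: cvec.subspace_sum[OF VX.subspace] single VX_V)
    then have "P y = P (\<Sum>x\<in>X. Poly_Mapping.single x (Poly_Mapping.lookup y x))"
      by simp
    also have "\<dots> = (\<Sum>x\<in>X. P (Poly_Mapping.single x (Poly_Mapping.lookup y x)))"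
      using y by (intro intertwiner_sum[OF P(1) VX.subspace VX.zero_mem] single VX_V)
    finally show ?thesis .
  qed
  have PfX: "P (fX y) = fX (P y)" if y: "y \<in> VX" for y
  proof (rule VX_eq)
    show "P (fX y) \<in> VX" "fX (P y) \<in> VX"
      using y by (simp_all add: fX_VX intertwinerD(1)[OF P(1)])
    fix x' assume x': "x' \<in> X"
    have "Poly_Mapping.lookup (P (fX y)) x' =
        (\<Sum>x\<in>X. Poly_Mapping.lookup (P (Poly_Mapping.single x (f (Poly_Mapping.lookup y x)))) x')"
      by (simp add: expand[OF fX_VX[OF y]] lookup_sum fX)
    also have "\<dots> = (\<Sum>x\<in>X. f (Poly_Mapping.lookup (P (Poly_Mapping.single x (Poly_Mapping.lookup y x))) x'))"
      using y x' by (intro sum.cong commute[OF comp f] VX_V refl)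
    also have "\<dots> = f (\<Sum>x\<in>X. Poly_Mapping.lookup (P (Poly_Mapping.single x (Poly_Mapping.lookup y x))) x')"
      using y x' by (intro intertwiner_sum[OF f subspace zero_mem, symmetric] VX_V single
          intertwinerD(1)[OF P(1)])
    also have "\<dots> = Poly_Mapping.lookup (fX (P y)) x'"
      using x' by (simp add: fX expand[OF y] lookup_sum)
    finally show "Poly_Mapping.lookup (P (fX y)) x' = Poly_Mapping.lookup (fX (P y)) x'" .
  qed
  \<comment> \<open>\<open>P\<close> fixes \<open>x0\<close>, so \<open>fX x0\<close> is in the
    image of \<open>P\<close>, which is the submodule generated by \<open>x0\<close>. Its elements
    are combinations of group translates of \<open>x0\<close>.\<close>
  have "fX x0 = P (fX x0)"
    using PfX[OF x0(1)] P(3)[OF \<open>x0 \<in> S\<close>] by simp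
  then have "fX x0 \<in> S"
    using P(2)[OF fX_VX[OF x0(1)]] by simp
  then obtain a where a: "fX x0 = (\<Sum>g\<in>carrier G. a g *\<^sub>C D g x0)"
    by (auto simp: S_def)
  define h where "h v = (\<Sum>g\<in>carrier G. a g *\<^sub>C \<rho> g v)" for v
  have hx: "f x = h x" if "x \<in> X" for x
  proof -
    have "f x = Poly_Mapping.lookup (fX x0) x"
      using that by (simp add: fX x0)
    also have "\<dots> = h x"
      unfolding a using that x0 by (simp add: lookup_sum look h_def)
    finally show ?thesis .
  qed
  have "V \<subseteq> {v \<in> V. f v = h v}"
  proof -
    have "cvec.span X \<subseteq> {v \<in> V. f v = h v}"
    proof (rule cvec.span_minimal)
      show "X \<subseteq> {v \<in> V. f v = h v}"
        using hx X_V by auto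
      show "cvec.subspace {v \<in> V. f v = h v}"
      proof (rule cvec.subspaceI)
        show "0 \<in> {v \<in> V. f v = h v}"
          using intertwinerD(5)[OF f zero_mem] zero_mem complex_rep_0(1)[OF complex_rep_axioms]
          by (simp add: h_def)
        show "x + y \<in> {v \<in> V. f v = h v}" if "x \<in> {v \<in> V. f v = h v}" "y \<in> {v \<in> V. f v = h v}" for x y
        proof -
          have "h (x + y) = h x + h y"
            using that by (simp add: h_def add scaleC_add_right sum.distrib)
          then show ?thesis
            using that by (simp add: intertwinerD(2)[OF f] cvec.subspace_add[OF subspace])
        qed
        show "c *\<^sub>C x \<in> {v \<in> V. f v = h v}" if "x \<in> {v \<in> V. f v = h v}" for c x
        proof -
          have "h (c *\<^sub>C x) = c *\<^sub>C h x"
            using that by (simp add: h_def scaleC cvec.scale_sum_right mult.commute)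
          then show ?thesis
            using that by (simp add: intertwinerD(3)[OF f] cvec.subspace_scale[OF subspace])
        qed
      qed
    qed
    then show ?thesis
      by (simp only: V_span)
  qed
  then show thesis
    by (intro that[of a]) (auto simp: h_def)
qed

text \<open>Since \<open>f\<close> commutes with every \<open>\<rho> h\<close>, conjugating the
  coefficients by \<open>h\<close> leaves the represented map unchanged. Averaging over
  \<open>h\<close> makes them constant on conjugacy classes.\<close>

lemma intertwiner_class_function:
  assumes f: "intertwiner G V \<rho> V \<rho> f"
  obtains a where "\<And>v. v \<in> V \<Longrightarrow> f v = (\<Sum>g\<in>carrier G. a g *\<^sub>C \<rho> g v)"
    "\<And>g h. g \<in> carrier G \<Longrightarrow> h \<in> carrier G \<Longrightarrow> a (h \<otimes> g \<otimes> inv h) = a g"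
proof -
  let ?n = "of_nat (card (carrier G)) :: complex"
  obtain a where a: "\<And>v. v \<in> V \<Longrightarrow> f v = (\<Sum>g\<in>carrier G. a g *\<^sub>C \<rho> g v)"
    using intertwiner_in_group_algebra[OF f] by blast
  define b where "b g = (\<Sum>h\<in>carrier G. a (inv h \<otimes> g \<otimes> h)) / ?n" for g
  show thesis
  proof
    fix v assume v: "v \<in> V"
    have "?n *\<^sub>C f v = (\<Sum>h\<in>carrier G. f v)"
      using cvec.scale_sum_left[of "\<lambda>_. 1" "carrier G" "f v"] by (simp add: scaleC_one)
    also have "\<dots> = (\<Sum>h\<in>carrier G. \<Sum>g\<in>carrier G. a (inv h \<otimes> g \<otimes> h) *\<^sub>C \<rho> g v)"
    proof (rule sum.cong)
      fix h assume h: "h \<in> carrier G"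
      have "f v = f (\<rho> h (\<rho> (inv h) v))"
        using v h by (simp add: one flip: mult)
      also have "\<dots> = \<rho> h (f (\<rho> (inv h) v))"
        using v h by (simp add: intertwinerD(4)[OF f] closed)
      also have "\<dots> = \<rho> h (\<Sum>g\<in>carrier G. a g *\<^sub>C \<rho> g (\<rho> (inv h) v))"
        using v h by (simp add: a closed)
      also have "\<dots> = (\<Sum>g\<in>carrier G. a g *\<^sub>C \<rho> (h \<otimes> g \<otimes> inv h) v)"
        using v h by (subst complex_rep_sum[OF complex_rep_axioms])
          (simp_all add: scaleC closed mult m_assoc cvec.subspace_scale[OF subspace])
      also have "\<dots> = (\<Sum>g\<in>carrier G. a (inv h \<otimes> (h \<otimes> g \<otimes> inv h) \<otimes> h) *\<^sub>C \<rho> (h \<otimes> g \<otimes> inv h) v)"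
      proof (rule sum.cong)
        fix g assume g: "g \<in> carrier G"
        have "inv h \<otimes> (h \<otimes> g \<otimes> inv h) \<otimes> h = (inv h \<otimes> h) \<otimes> g \<otimes> (inv h \<otimes> h)"
          using g h by (simp only: m_assoc m_closed inv_closed)
        then show "a g *\<^sub>C \<rho> (h \<otimes> g \<otimes> inv h) v = a (inv h \<otimes> (h \<otimes> g \<otimes> inv h) \<otimes> h) *\<^sub>C \<rho> (h \<otimes> g \<otimes> inv h) v"
          using g h by simp
      qed simp
      also have "\<dots> = (\<Sum>g\<in>carrier G. a (inv h \<otimes> g \<otimes> h) *\<^sub>C \<rho> g v)"
        by (rule sum_conj[OF h])
      finally show "f v = (\<Sum>g\<in>carrier G. a (inv h \<otimes> g \<otimes> h) *\<^sub>C \<rho> g v)" .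
    qed simp
    also have "\<dots> = (\<Sum>g\<in>carrier G. (\<Sum>h\<in>carrier G. a (inv h \<otimes> g \<otimes> h)) *\<^sub>C \<rho> g v)"
      by (subst sum.swap) (simp add: cvec.scale_sum_left)
    finally have "(1 / ?n) *\<^sub>C ?n *\<^sub>C f v =
        (1 / ?n) *\<^sub>C (\<Sum>g\<in>carrier G. (\<Sum>h\<in>carrier G. a (inv h \<otimes> g \<otimes> h)) *\<^sub>C \<rho> g v)"
      by simp
    then show "f v = (\<Sum>g\<in>carrier G. b g *\<^sub>C \<rho> g v)"
      using card_carrier by (simp add: b_def cvec.scale_sum_right scaleC_one)
  next
    fix g k assume gk: "g \<in> carrier G" "k \<in> carrier G"
    have "(\<Sum>h\<in>carrier G. a (inv h \<otimes> (k \<otimes> g \<otimes> inv k) \<otimes> h)) =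
        (\<Sum>h\<in>carrier G. a (inv (inv k \<otimes> h) \<otimes> g \<otimes> (inv k \<otimes> h)))"
      using gk by (intro sum.cong) (simp_all add: inv_mult_group m_assoc)
    also have "\<dots> = (\<Sum>h\<in>carrier G. a (inv h \<otimes> g \<otimes> h))"
      by (rule sum_mult_left[of "inv k" "\<lambda>h. a (inv h \<otimes> g \<otimes> h)"]) (use gk in simp)
    finally show "b (k \<otimes> g \<otimes> inv k) = b g"
      by (simp add: b_def)
  qed
qed

text \<open>The class function is a matrix coefficient of \<open>U\<close>, averaged over conjugates.\<close>

lemma annihilating_class_function:
  fixes U :: "(nat \<Rightarrow>\<^sub>0 complex) set"
  assumes U: "complex_rep G U \<sigma>" and u: "u \<in> U" "u \<noteq> 0"
    and none: "\<nexists>f. intertwiner G U \<sigma> V \<rho> f \<and> (\<exists>u\<in>U. f u \<noteq> 0)"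
  obtains a where "a \<one> \<noteq> 0" "\<And>v. v \<in> V \<Longrightarrow> (\<Sum>g\<in>carrier G. a g *\<^sub>C \<rho> g v) = 0"
    "\<And>g h. g \<in> carrier G \<Longrightarrow> h \<in> carrier G \<Longrightarrow> a (h \<otimes> g \<otimes> inv h) = a g"
proof -
  interpret U: complex_rep G U \<sigma> by fact
  \<comment> \<open>\<open>U\<close> consists of sequences, so a coordinate can serve as the linear
    functional of a matrix coefficient.\<close>
  obtain k where k: "Poly_Mapping.lookup u k \<noteq> 0"
    using u(2) by (metis lookup_zero poly_mapping_eqI)
  define c where "c h g = Poly_Mapping.lookup (\<sigma> (inv h) (\<sigma> (inv g) (\<sigma> h u))) k" for h g
  define a where "a g = (\<Sum>h\<in>carrier G. c h g)" for g
  show thesis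
  proof
    have "c h \<one> = Poly_Mapping.lookup u k" if "h \<in> carrier G" for h
      using that u by (simp add: c_def U.one U.closed flip: U.mult)
    then have "a \<one> = of_nat (card (carrier G)) * Poly_Mapping.lookup u k"
      by (simp add: a_def)
    then show "a \<one> \<noteq> 0"
      using k card_carrier by simp
  next
    fix v assume v: "v \<in> V"
    have "(\<Sum>g\<in>carrier G. c h g *\<^sub>C \<rho> g v) = 0" if h: "h \<in> carrier G" for h
    proof -
      \<comment> \<open>A rank one map from \<open>U\<close> to \<open>V\<close>. Its average over
        the group is an intertwiner, hence zero by \<open>none\<close>; evaluated at
        \<open>\<sigma> h u\<close> it is exactly the sum in question.\<close>
      define F where "F x = Poly_Mapping.lookup (\<sigma> (inv h) x) k *\<^sub>C v" for x
      have "intertwiner G U \<sigma> V \<rho> (\<lambda>w. \<Sum>g\<in>carrier G. \<rho> g (F (\<sigma> (inv g) w)))"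
        by (rule intertwiner_average[OF U complex_rep_axioms])
          (simp_all add: F_def cvec.subspace_scale[OF subspace v] U.add U.scaleC h lookup_add
            scaleC_add_left scaleC_scaleC scaleC_complex_def)
      then have "(\<Sum>g\<in>carrier G. \<rho> g (F (\<sigma> (inv g) (\<sigma> h u)))) = 0"
        using none U.closed[OF h u(1)] by blast
      then show ?thesis
        using v h by (simp add: F_def c_def scaleC)
    qed
    then have "0 = (\<Sum>h\<in>carrier G. \<Sum>g\<in>carrier G. c h g *\<^sub>C \<rho> g v)"
      by simp
    also have "\<dots> = (\<Sum>g\<in>carrier G. a g *\<^sub>C \<rho> g v)"
      by (subst sum.swap) (simp add: a_def cvec.scale_sum_left)
    finally show "(\<Sum>g\<in>carrier G. a g *\<^sub>C \<rho> g v) = 0" ..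
  next
    fix g l assume gl: "g \<in> carrier G" "l \<in> carrier G"
    have c: "c h g = Poly_Mapping.lookup (\<sigma> (inv h \<otimes> inv g \<otimes> h) u) k"
      if "h \<in> carrier G" "g \<in> carrier G" for h g
      using that u(1) by (simp add: c_def U.mult U.closed)
    have "a (l \<otimes> g \<otimes> inv l) = (\<Sum>h\<in>carrier G. c (inv l \<otimes> h) g)"
      unfolding a_def using gl by (intro sum.cong) (simp_all add: c inv_mult_group m_assoc)
    also have "\<dots> = a g"
      unfolding a_def by (rule sum_mult_left) (use gl in simp)
    finally show "a (l \<otimes> g \<otimes> inv l) = a g" .
  qed
qed

section \<open>Counting conjugacy classes\<close>

definition conj_class :: "'g \<Rightarrow> 'g set" where
  "conj_class g = {h \<otimes> g \<otimes> inv h |h. h \<in> carrier G}"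

lemma conj_class_self: "g \<in> carrier G \<Longrightarrow> g \<in> conj_class g"
  unfolding conj_class_def by (rule CollectI, rule exI[of _ \<one>]) simp

text \<open>The intertwiners \<open>A h\<close>, one for every conjugacy class, are linearly independent, and they are
  given by class functions. So no nonzero class function acts as zero.\<close>

lemma irreducible_rep_occurs:
  fixes U :: "(nat \<Rightarrow>\<^sub>0 complex) set"
  assumes A: "\<And>g. g \<in> carrier G \<Longrightarrow> intertwiner G V \<rho> V \<rho> (A g)"
    and w: "\<And>g. g \<in> carrier G \<Longrightarrow> w g \<in> V"
    and l: "\<And>g. g \<in> carrier G \<Longrightarrow> clinear (l g :: 'v \<Rightarrow> complex)"
    and nz: "\<And>g. g \<in> carrier G \<Longrightarrow> l g (A g (w g)) \<noteq> 0"
    and z: "\<And>g h. g \<in> carrier G \<Longrightarrow> h \<in> carrier G \<Longrightarrow> l g (A h (w g)) \<noteq> 0 \<Longrightarrow> h \<in> conj_class g"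
    and U: "irreducible_rep G U \<sigma>"
  shows "\<exists>f. intertwiner G U \<sigma> V \<rho> f \<and> (\<exists>u\<in>U. f u \<noteq> 0)"
proof (rule ccontr)
  assume none: "\<not> ?thesis"
  have Urep: "complex_rep G U \<sigma>"
    using U by (simp add: irreducible_rep_def)
  obtain u where u: "u \<in> U" "u \<noteq> 0"
    using U complex_rep_0(2)[OF Urep one_closed] unfolding irreducible_rep_def by auto
  obtain e where e: "e \<one> \<noteq> 0" "\<And>v. v \<in> V \<Longrightarrow> (\<Sum>g\<in>carrier G. e g *\<^sub>C \<rho> g v) = 0"
    "\<And>g h. g \<in> carrier G \<Longrightarrow> h \<in> carrier G \<Longrightarrow> e (h \<otimes> g \<otimes> inv h) = e g"
    using annihilating_class_function[OF Urep u none] by blast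
  define is_coeff where "is_coeff h a \<longleftrightarrow> (\<forall>v\<in>V. A h v = (\<Sum>g\<in>carrier G. a g *\<^sub>C \<rho> g v)) \<and>
      (\<forall>g\<in>carrier G. \<forall>k\<in>carrier G. a (k \<otimes> g \<otimes> inv k) = a g)" for h a
  define a where "a h = (SOME a. is_coeff h a)" for h
  have a: "is_coeff h (a h)" if "h \<in> carrier G" for h
  proof -
    have "\<exists>a. is_coeff h a"
      using intertwiner_class_function[OF A[OF that]] unfolding is_coeff_def by metis
    then show ?thesis
      unfolding a_def by (rule someI_ex)
  qed
  have a: "h \<in> carrier G \<Longrightarrow> v \<in> V \<Longrightarrow> A h v = (\<Sum>g\<in>carrier G. a h g *\<^sub>C \<rho> g v)"
    "h \<in> carrier G \<Longrightarrow> g \<in> carrier G \<Longrightarrow> k \<in> carrier G \<Longrightarrow> a h (k \<otimes> g \<otimes> inv k) = a h g" for h g k v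
    using a[of h] by (simp_all add: is_coeff_def)
  define K where "K = conj_class ` carrier G"
  have fin: "finite K"
    using finite_carrier by (simp add: K_def)
  define r where "r C = (SOME g. g \<in> carrier G \<and> conj_class g = C)" for C
  have r: "r C \<in> carrier G" "conj_class (r C) = C" if "C \<in> K" for C
  proof -
    have "\<exists>g. g \<in> carrier G \<and> conj_class g = C"
      using that by (auto simp: K_def)
    from someI_ex[OF this] show "r C \<in> carrier G" "conj_class (r C) = C"
      by (simp_all add: r_def)
  qed
  have KI: "conj_class g \<in> K" if "g \<in> carrier G" for g
    using that by (simp add: K_def)
  \<comment> \<open>Class functions are encoded with one coordinate per conjugacy class, which
    bounds the dimension of their span by \<open>card K\<close>.\<close>
  define vec where "vec b = (\<Sum>C\<in>K. Poly_Mapping.single C (b (r C)))" for b :: "'g \<Rightarrow> complex"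
  have vec: "Poly_Mapping.lookup (vec b) (conj_class g) = b g"
    if g: "g \<in> carrier G" and b: "\<And>g k. g \<in> carrier G \<Longrightarrow> k \<in> carrier G \<Longrightarrow> b (k \<otimes> g \<otimes> inv k) = b g" for b g
  proof -
    have "g \<in> conj_class (r (conj_class g))"
      using r(2)[OF KI[OF g]] conj_class_self[OF g] by simp
    then obtain k where "k \<in> carrier G" "g = k \<otimes> r (conj_class g) \<otimes> inv k"
      unfolding conj_class_def by blast
    then have "b g = b (r (conj_class g))"
      using b[OF r(1)[OF KI[OF g]]] by metis
    then show ?thesis
      using fin KI[OF g] by (simp add: vec_def lookup_sum lookup_single when_def)
  qed
  \<comment> \<open>For a class function this is the functional \<open>l (r C)\<close> applied to
    its action on the test vector \<open>w (r C)\<close>. The definition through coordinates makes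
    it linear on arbitrary vectors.\<close>
  define L where "L C x = l (r C) (\<Sum>g\<in>carrier G. Poly_Mapping.lookup x (conj_class g) *\<^sub>C \<rho> g (w (r C)))"
    for C and x :: "'g set \<Rightarrow>\<^sub>0 complex"
  have L_lin: "clinear (L C)" if "C \<in> K" for C
  proof (rule clinearI)
    note lC = l[OF r(1)[OF that]]
    fix x y :: "'g set \<Rightarrow>\<^sub>0 complex" and c
    show "L C (x + y) = L C x + L C y"
      unfolding L_def by (simp only: lookup_add scaleC_add_left sum.distrib clinear_add[OF lC])
    have "(\<Sum>g\<in>carrier G. Poly_Mapping.lookup (c *\<^sub>C x) (conj_class g) *\<^sub>C \<rho> g (w (r C))) =
        c *\<^sub>C (\<Sum>g\<in>carrier G. Poly_Mapping.lookup x (conj_class g) *\<^sub>C \<rho> g (w (r C)))"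
      by (simp add: cvec.scale_sum_right scaleC_complex_def)
    then show "L C (c *\<^sub>C x) = c *\<^sub>C L C x"
      unfolding L_def by (simp only: clinear_scaleC[OF lC])
  qed
  have L_vec: "L C (vec b) = l (r C) (\<Sum>g\<in>carrier G. b g *\<^sub>C \<rho> g (w (r C)))"
    if "\<And>g k. g \<in> carrier G \<Longrightarrow> k \<in> carrier G \<Longrightarrow> b (k \<otimes> g \<otimes> inv k) = b g" for b C
    unfolding L_def by (simp add: vec that)
  define B where "B C = vec (a (r C))" for C
  have LB: "L C (B D) = l (r C) (A (r D) (w (r C)))" if "C \<in> K" "D \<in> K" for C D
    unfolding B_def using that by (subst L_vec) (simp_all add: a r w)
  have LB_diag: "L C (B C) \<noteq> 0" if "C \<in> K" for C
    using nz[OF r(1)[OF that]] that by (simp add: LB)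
  have conj_eq: "conj_class h = conj_class g" if h: "h \<in> conj_class g" and g: "g \<in> carrier G" for g h
  proof -
    obtain k where k: "k \<in> carrier G" "h = k \<otimes> g \<otimes> inv k"
      using h unfolding conj_class_def by blast
    have mem: "x \<otimes> g \<otimes> inv x \<in> conj_class g" "x \<otimes> h \<otimes> inv x \<in> conj_class h"
      if "x \<in> carrier G" for x
      using that unfolding conj_class_def by blast+
    have 1: "conj_class h \<subseteq> conj_class g"
    proof
      fix x assume "x \<in> conj_class h"
      then obtain m where m: "m \<in> carrier G" "x = m \<otimes> h \<otimes> inv m"
        unfolding conj_class_def by blast
      then have "x = (m \<otimes> k) \<otimes> g \<otimes> inv (m \<otimes> k)"
        using k g by (simp add: inv_mult_group m_assoc)
      then show "x \<in> conj_class g"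
        using mem(1)[of "m \<otimes> k"] m k by simp
    qed
    have 2: "conj_class g \<subseteq> conj_class h"
    proof
      fix x assume "x \<in> conj_class g"
      then obtain m where m: "m \<in> carrier G" "x = m \<otimes> g \<otimes> inv m"
        unfolding conj_class_def by blast
      have "(m \<otimes> inv k) \<otimes> h \<otimes> inv (m \<otimes> inv k) = m \<otimes> (inv k \<otimes> k) \<otimes> g \<otimes> (inv k \<otimes> k) \<otimes> inv m"
        using m k g by (simp only: inv_mult_group m_assoc m_closed inv_closed inv_inv)
      then have "x = (m \<otimes> inv k) \<otimes> h \<otimes> inv (m \<otimes> inv k)"
        using m k g by simp
      then show "x \<in> conj_class h"
        using mem(2)[of "m \<otimes> inv k"] m k by simp
    qed
    from 1 2 show ?thesis
      by blast
  qed
  have LB_off: "L C (B D) = 0" if "C \<in> K" "D \<in> K" "C \<noteq> D" for C D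
    using z[OF r(1)[OF that(1)] r(1)[OF that(2)]] conj_eq[OF _ r(1)[OF that(1)], of "r D"] r(2) that
    by (auto simp: LB)
  define E where "E = vec e"
  have LE: "L C E = 0" if "C \<in> K" for C
    unfolding E_def using that e(2)[OF w[OF r(1)[OF that]]] clinear_scaleC[OF l[OF r(1)[OF that]], of 0 0]
    by (subst L_vec) (simp_all add: e)
  have E0: "E \<noteq> 0"
    using vec[OF one_closed e(3)] e(1) by (auto simp: E_def)
  have inj: "inj_on B K"
    by (rule inj_onI) (metis LB_diag LB_off)
  have E_B: "E \<notin> B ` K"
    using LE LB_diag by auto
  have lin_sum: "L C (\<Sum>x\<in>S. c x *\<^sub>C x) = (\<Sum>x\<in>S. c x * L C x)" if "C \<in> K" for S c C
  proof (induction S rule: infinite_finite_induct)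
    case (insert x S)
    then show ?case
      by (simp add: clinear_add[OF L_lin[OF that]] clinear_scaleC[OF L_lin[OF that]] scaleC_complex_def)
  qed (use clinear_scaleC[OF L_lin[OF that], of 0 0] in simp_all)
  \<comment> \<open>The functionals \<open>L C\<close> are diagonal on the vectors
    \<open>B D\<close> and annihilate the nonzero vector \<open>E\<close>. Together these are
    \<open>card K + 1\<close> independent vectors, one more than the dimension admits.\<close>
  have "cvec.independent (insert E (B ` K))"
  proof (rule cvec.independent_if_scalars_zero)
    fix c x assume 0: "(\<Sum>x\<in>insert E (B ` K). c x *\<^sub>C x) = 0" and x: "x \<in> insert E (B ` K)"
    have cB: "c (B C) = 0" if C: "C \<in> K" for C
    proof -
      have "0 = L C (\<Sum>x\<in>insert E (B ` K). c x *\<^sub>C x)"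
        using 0 clinear_scaleC[OF L_lin[OF C], of 0 0] by simp
      also have "\<dots> = (\<Sum>x\<in>insert E (B ` K). c x * L C x)"
        by (rule lin_sum[OF C])
      also have "\<dots> = (\<Sum>D\<in>K. c (B D) * L C (B D))"
        using fin E_B LE[OF C] by (simp add: sum.reindex[OF inj])
      also have "\<dots> = (\<Sum>D\<in>K. if D = C then c (B C) * L C (B C) else 0)"
        by (rule sum.cong) (use LB_off C in auto)
      also have "\<dots> = c (B C) * L C (B C)"
        using C fin by simp
      finally show ?thesis
        using LB_diag[OF C] by simp
    qed
    then have "c E *\<^sub>C E = 0"
      using 0 fin E_B by (simp add: sum.reindex[OF inj])
    then have "c E = 0"
      using E0 by simp
    with cB x show "c x = 0"
      by auto
  qed (use fin in simp)
  moreover have "insert E (B ` K) \<subseteq> cvec.span ((\<lambda>C. Poly_Mapping.single C (1 :: complex)) ` K)"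
  proof -
    have "vec b \<in> cvec.span ((\<lambda>C. Poly_Mapping.single C (1 :: complex)) ` K)" for b
    proof -
      have "vec b = (\<Sum>C\<in>K. b (r C) *\<^sub>C Poly_Mapping.single C (1 :: complex))"
        by (simp add: vec_def scaleC_single scaleC_complex_def)
      then show ?thesis
        by (simp add: cvec.span_sum cvec.span_scale cvec.span_base)
    qed
    then show ?thesis
      by (auto simp: E_def B_def)
  qed
  ultimately have "card (insert E (B ` K)) \<le> card ((\<lambda>C. Poly_Mapping.single C (1 :: complex)) ` K)"
    using cvec.independent_span_bound[of "(\<lambda>C. Poly_Mapping.single C (1 :: complex)) ` K"] fin by blast
  also have "\<dots> \<le> card K"
    by (rule card_image_le[OF fin])
  finally show False
    using fin E_B by (simp add: card_image[OF inj])
qed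

end

section \<open>Linear independence of the vectors \<open>e_vec\<close>\<close>

lemma involutions_weyl_B:
  "(\<zeta>, \<pi>) \<in> involutions weyl_B \<longleftrightarrow>
     range \<zeta> \<subseteq> {1, -1} \<and> (\<forall>x. \<pi> (\<pi> x) = x) \<and> (\<forall>x. \<zeta> (\<pi> x) = \<zeta> x)"
proof
  assume "(\<zeta>, \<pi>) \<in> involutions weyl_B"
  then have *: "range \<zeta> \<subseteq> {1, -1}" "bij \<pi>" "\<pi> \<circ> \<pi> = id" "(\<lambda>j. \<zeta> j * \<zeta> (inv_into UNIV \<pi> j)) = (\<lambda>_. 1)"
    by (auto simp: involutions_def carrier_weyl_B mult_weyl_B one_weyl_B)
  then have \<pi>: "\<pi> (\<pi> x) = x" for x
    by (metis comp_apply id_apply)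
  have "\<zeta> (\<pi> x) = \<zeta> x" for x
  proof -
    have "\<zeta> (\<pi> x) * \<zeta> x = 1"
      using fun_cong[OF *(4), of "\<pi> x"] *(2) by (simp add: bij_is_inj)
    then show ?thesis
      using sign_values(1)[OF *(1), of x] by auto
  qed
  with * \<pi> show "range \<zeta> \<subseteq> {1, -1} \<and> (\<forall>x. \<pi> (\<pi> x) = x) \<and> (\<forall>x. \<zeta> (\<pi> x) = \<zeta> x)"
    by simp
next
  assume *: "range \<zeta> \<subseteq> {1, -1} \<and> (\<forall>x. \<pi> (\<pi> x) = x) \<and> (\<forall>x. \<zeta> (\<pi> x) = \<zeta> x)"
  then have "\<pi> \<circ> \<pi> = id"
    by (simp add: fun_eq_iff)
  then have "bij \<pi>" "inv_into UNIV \<pi> = \<pi>"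
    by (simp_all add: o_bij inv_unique_comp)
  then show "(\<zeta>, \<pi>) \<in> involutions weyl_B"
    using * sign_values(2)[of \<zeta>]
    by (auto simp: involutions_def carrier_weyl_B mult_weyl_B one_weyl_B fun_eq_iff)
qed

text \<open>The linear map to polynomials that sends the factors of the vectors \<open>e_vec \<tau>\<close> to variables:
  the third component of a variable tells whether the squares occur.\<close>

definition mcoeff :: "'n \<Rightarrow> bool \<Rightarrow> 'n cpoly \<Rightarrow> complex" where
  "mcoeff i b p = Poly_Mapping.lookup p (Poly_Mapping.single i (if b then 2 else 1))"

text \<open>The coefficients are two by two minors, so the form is alternating and factors through
  the exterior square. Listing only \<open>i < j\<close> sends an ordered wedge to a single variable
  with coefficient 1.\<close>

definition pair_form :: "'n::{finite,linorder} cpoly \<Rightarrow> 'n cpoly \<Rightarrow> ('n \<times> 'n \<times> bool) cpoly" where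
  "pair_form p q = (\<Sum>(i, j, b) | i < j.
     (mcoeff i b p * mcoeff j b q - mcoeff j b p * mcoeff i b q) *\<^sub>C var (i, j, b))"

definition factor_var :: "'n::{finite,linorder} cpoly \<times> 'n cpoly ext2 \<Rightarrow> ('n \<times> 'n \<times> bool) cpoly" where
  "factor_var v = (\<Sum>i\<in>UNIV. mcoeff i False (fst v) *\<^sub>C var (i, i, False)) + ext2_lift pair_form (snd v)"

lemma mcoeff_add: "mcoeff i b (p + q) = mcoeff i b p + mcoeff i b q"
  and mcoeff_scaleC: "mcoeff i b (c *\<^sub>C p) = c * mcoeff i b p"
  by (simp_all add: mcoeff_def lookup_add scaleC_complex_def)

lemma var_power2: "(var x)\<^sup>2 = Poly_Mapping.single (Poly_Mapping.single x 2) 1"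
  unfolding power2_eq_square var_def mult_single by (simp add: numeral_2_eq_2 flip: single_add)

lemma single_single_eq:
  "Poly_Mapping.single i a = Poly_Mapping.single j b \<longleftrightarrow> i = j \<and> a = b \<or> a = 0 \<and> b = (0 :: nat)"
  by (metis lookup_single_eq lookup_single_not_eq single_zero)

lemma mcoeff_var: "mcoeff i b (var k) = (if i = k \<and> \<not> b then 1 else 0)"
  and mcoeff_var_power2: "mcoeff i b ((var k)\<^sup>2) = (if i = k \<and> b then 1 else 0)"
  by (simp_all add: mcoeff_def var_power2) (auto simp: var_def lookup_single when_def single_single_eq)

lemma pair_form_bilinear:
  "clinear (\<lambda>p. pair_form p q)" "clinear (pair_form p)" "pair_form p p = 0"
  by (auto intro!: clinearI simp: pair_form_def mcoeff_add mcoeff_scaleC cvec.scale_sum_right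
      scaleC_scaleC algebra_simps scaleC_add_left cvec.scale_left_diff_distrib sum.distrib sum_subtractf
      case_prod_unfold)

lemma clinear_factor_var: "clinear factor_var"
proof -
  note [simp] = clinear_add[OF clinear_ext2_lift[OF pair_form_bilinear]]
    clinear_scaleC[OF clinear_ext2_lift[OF pair_form_bilinear]]
  show ?thesis
    by (rule clinearI)
      (simp_all add: factor_var_def mcoeff_add mcoeff_scaleC scaleC_add_left sum.distrib
        scaleC_prod_def scaleC_add_right cvec.scale_sum_right scaleC_scaleC)
qed

lemma clinear_zero: "clinear f \<Longrightarrow> f 0 = 0"
  by (metis clinear_scaleC cvec.scale_zero_left)

lemma factor_var_simps:
  fixes i j k :: "'n::{finite,linorder}"
  shows "factor_var (var k, 0) = var (k, k, False)"
  "i < j \<Longrightarrow> factor_var (0, var i \<and>\<^sub>2 var j) = var (i, j, False)"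
  "i < j \<Longrightarrow> factor_var (0, (var i)\<^sup>2 \<and>\<^sub>2 (var j)\<^sup>2) = var (i, j, True)"
proof -
  have [simp]: "(\<Sum>i\<in>UNIV. mcoeff i False 0 *\<^sub>C var (i, i, False)) = (0 :: ('n \<times> 'n \<times> bool) cpoly)"
    by (simp add: mcoeff_def)
  have "(\<Sum>i\<in>UNIV. mcoeff i False (var k) *\<^sub>C var (i, i, False)) =
      (\<Sum>i\<in>UNIV. if i = k then var (k, k, False) else (0 :: ('n \<times> 'n \<times> bool) cpoly))"
    by (rule sum.cong) (auto simp: mcoeff_var scaleC_one)
  then show "factor_var (var k, 0) = var (k, k, False)"
    by (simp add: factor_var_def clinear_zero[OF clinear_ext2_lift[OF pair_form_bilinear]])
  assume ij: "i < j"
  have *: "(\<Sum>(i', j', b') | i' < j'. (if i' = i \<and> j' = j \<and> b' = b then 1 else 0) *\<^sub>C var (i', j', b')) =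
      (var (i, j, b) :: ('n \<times> 'n \<times> bool) cpoly)" for b
  proof -
    have "(\<Sum>(i', j', b') | i' < j'. (if i' = i \<and> j' = j \<and> b' = b then 1 else 0) *\<^sub>C var (i', j', b')) =
      (\<Sum>v \<in> {(i', j', b'). i' < j'}. if v = (i, j, b) then var (i, j, b) else (0 :: ('n \<times> 'n \<times> bool) cpoly))"
      by (rule sum.cong) (auto simp: scaleC_one split: if_splits)
    then show ?thesis
      using ij by simp
  qed
  have "pair_form (var i) (var j) = var (i, j, False)"
    by (rule trans[OF _ *]) (unfold pair_form_def, intro sum.cong refl,
        use ij in \<open>auto simp: mcoeff_var\<close>)
  moreover have "pair_form ((var i)\<^sup>2) ((var j)\<^sup>2) = var (i, j, True)"
    by (rule trans[OF _ *]) (unfold pair_form_def, intro sum.cong refl,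
        use ij in \<open>auto simp: mcoeff_var_power2\<close>)
  ultimately show "factor_var (0, var i \<and>\<^sub>2 var j) = var (i, j, False)"
    "factor_var (0, (var i)\<^sup>2 \<and>\<^sub>2 (var j)\<^sup>2) = var (i, j, True)"
    unfolding factor_var_def by (simp_all add: ext2_lift_wedge[OF pair_form_bilinear])
qed

section \<open>The monomial attached to an involution\<close>

definition e_vars :: "'n::{finite,linorder} signed_perm \<Rightarrow> ('n \<times> 'n \<times> bool) set" where
  "e_vars \<tau> = (\<lambda>k. (k, k, False)) ` L1 \<tau> \<union>
     (\<lambda>m. (m, snd \<tau> m, False)) ` {m \<in> L2 \<tau>. m < snd \<tau> m} \<union>
     (\<lambda>l. (l, snd \<tau> l, True)) ` {l \<in> Q2 \<tau>. l < snd \<tau> l}"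

definition e_monom :: "'n::{finite,linorder} signed_perm \<Rightarrow> ('n \<times> 'n \<times> bool) \<Rightarrow>\<^sub>0 nat" where
  "e_monom \<tau> = (\<Sum>v\<in>e_vars \<tau>. Poly_Mapping.single v 1)"

lemma prod_var: "finite A \<Longrightarrow> (\<Prod>v\<in>A. var v) = Poly_Mapping.single (\<Sum>v\<in>A. Poly_Mapping.single v 1) 1"
  by (induction A rule: finite_induct) (simp_all add: var_def mult_single)

lemma sym_lift_prod: "clinear f \<Longrightarrow> sym_lift f (\<Prod>i\<in>A. x i) = (\<Prod>i\<in>A. sym_lift f (x i))"
  by (induction A rule: infinite_finite_induct) (simp_all add: sym_lift_one sym_lift_mult)

lemma sym_lift_e_vec:
  "sym_lift factor_var (e_vec \<tau>) = Poly_Mapping.single (e_monom \<tau>) 1"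
proof -
  note [simp] = sym_lift_mult[OF clinear_factor_var] sym_lift_prod[OF clinear_factor_var]
    sym_lift_inj[OF clinear_factor_var] factor_var_simps
  let ?A = "(\<lambda>k. (k, k, False)) ` L1 \<tau>"
  let ?B = "(\<lambda>m. (m, snd \<tau> m, False)) ` {m \<in> L2 \<tau>. m < snd \<tau> m}"
  let ?C = "(\<lambda>l. (l, snd \<tau> l, True)) ` {l \<in> Q2 \<tau>. l < snd \<tau> l}"
  have "sym_lift factor_var (e_vec \<tau>) = (\<Prod>v\<in>?A. var v) * (\<Prod>v\<in>?B. var v) * (\<Prod>v\<in>?C. var v)"
    unfolding e_vec_def Let_def by (simp add: prod.reindex inj_on_def)
  also have "\<dots> = (\<Prod>v\<in>e_vars \<tau>. var v)"
    unfolding e_vars_def by (subst prod.union_disjoint, simp, simp, force)+ simp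
  finally show ?thesis
    by (simp add: prod_var e_monom_def)
qed

lemma keys_e_monom: "Poly_Mapping.keys (e_monom \<tau>) = e_vars \<tau>"
proof -
  have "Poly_Mapping.lookup (e_monom \<tau>) v = (if v \<in> e_vars \<tau> then 1 else 0)" for v
    by (simp add: e_monom_def lookup_sum lookup_single when_def)
  then have "v \<in> Poly_Mapping.keys (e_monom \<tau>) \<longleftrightarrow> v \<in> e_vars \<tau>" for v
    by (simp add: in_keys_iff)
  then show ?thesis
    by blast
qed

lemma mem_e_vars:
  "(i, j, b) \<in> e_vars (\<zeta>, \<pi>) \<longleftrightarrow>
     \<pi> i = j \<and> (if i = j then \<not> b \<and> \<zeta> i = -1 else i < j \<and> \<zeta> j = (if b then 1 else -1))"
  by (auto simp: e_vars_def L1_def L2_def Q2_def)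

text \<open>Transpositions are visible with their sign, negative fixed points as diagonal triples,
  and positive fixed points leave no trace; they are recovered as the remaining indices. The
  one-sided form is applied in both directions to get equality.\<close>

lemma e_vars_eq_imp:
  assumes \<tau>: "(\<zeta>, \<pi>) \<in> involutions weyl_B" and \<tau>': "(\<zeta>', \<pi>') \<in> involutions weyl_B"
    and eq: "e_vars (\<zeta>, \<pi>) = e_vars (\<zeta>', \<pi>')"
  shows "\<pi> x \<noteq> x \<Longrightarrow> \<pi>' x = \<pi> x" "\<zeta> x = -1 \<Longrightarrow> \<pi>' x = \<pi> x \<Longrightarrow> \<zeta>' x = -1"
proof -
  have i: "\<pi> (\<pi> x) = x" "\<pi>' (\<pi>' x) = x" "\<zeta> (\<pi> x) = \<zeta> x" "\<zeta>' (\<pi>' x) = \<zeta>' x" "\<zeta> x = 1 \<or> \<zeta> x = -1" for x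
    using \<tau> \<tau>' sign_values(1)[of \<zeta> x] by (auto simp: involutions_weyl_B)
  have *: "\<pi>' x = \<pi> x" if "x < \<pi> x" for x
  proof -
    have "(x, \<pi> x, \<zeta> x = 1) \<in> e_vars (\<zeta>, \<pi>)"
      using that i(3)[of x] i(5)[of x] by (auto simp: mem_e_vars)
    then show ?thesis
      unfolding eq by (simp add: mem_e_vars)
  qed
  show "\<pi>' x = \<pi> x" if "\<pi> x \<noteq> x"
  proof (cases "x < \<pi> x")
    case False
    then have "\<pi> x < \<pi> (\<pi> x)"
      using that by (simp add: i(1))
    from *[OF this] show ?thesis
      by (metis i(1,2))
  qed (rule *)
  have **: "\<zeta>' x = -1" if "\<zeta> x = -1" "\<pi>' x = \<pi> x" "x \<le> \<pi> x" for x
  proof -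
    have "(x, \<pi> x, False) \<in> e_vars (\<zeta>, \<pi>)"
      using that i(3)[of x] by (auto simp: mem_e_vars)
    then have "(x, \<pi>' x, False) \<in> e_vars (\<zeta>', \<pi>')"
      unfolding eq that(2) .
    then show ?thesis
      using i(4)[of x] by (auto simp: mem_e_vars split: if_splits)
  qed
  show "\<zeta>' x = -1" if "\<zeta> x = -1" "\<pi>' x = \<pi> x"
  proof (cases "x \<le> \<pi> x")
    case False
    then have "\<zeta>' (\<pi> x) = -1"
      using that i(3)[of x] i(2)[of x] by (intro **) (simp_all add: i(1))
    then show ?thesis
      using i(4)[of x] that(2) by simp
  qed (use ** that in blast)
qed

lemma e_vars_inj:
  assumes "\<tau> \<in> involutions weyl_B" "\<tau>' \<in> involutions weyl_B" "e_vars \<tau> = e_vars \<tau>'"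
  shows "\<tau> = \<tau>'"
proof -
  obtain \<zeta> \<pi> \<zeta>' \<pi>' where [simp]: "\<tau> = (\<zeta>, \<pi>)" "\<tau>' = (\<zeta>', \<pi>')"
    by (cases \<tau>; cases \<tau>')
  have a: "(\<zeta>, \<pi>) \<in> involutions weyl_B" "(\<zeta>', \<pi>') \<in> involutions weyl_B"
    "e_vars (\<zeta>, \<pi>) = e_vars (\<zeta>', \<pi>')"
    using assms by simp_all
  have \<pi>: "\<pi> x = \<pi>' x" for x
    using e_vars_eq_imp(1)[OF a(1,2,3), of x] e_vars_eq_imp(1)[OF a(2,1) a(3)[symmetric], of x]
    by metis
  have "\<zeta> x = 1 \<or> \<zeta> x = -1" "\<zeta>' x = 1 \<or> \<zeta>' x = -1" for x
    using a sign_values(1)[of \<zeta> x] sign_values(1)[of \<zeta>' x] by (simp_all add: involutions_weyl_B)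
  then have "\<zeta> x = \<zeta>' x" for x
    using e_vars_eq_imp(2)[OF a(1,2,3), of x] e_vars_eq_imp(2)[OF a(2,1) a(3)[symmetric], of x] \<pi>[of x]
    by metis
  with \<pi> show ?thesis
    by (simp add: fun_eq_iff)
qed

text \<open>A coefficient in the polynomial image, hence linear on the whole symmetric algebra.
  These functionals are dual to the vectors \<open>e_vec\<close> and thereby prove their
  independence.\<close>

definition coord :: "'n::{finite,linorder} signed_perm \<Rightarrow> ('n cpoly \<times> 'n cpoly ext2) symalg \<Rightarrow> complex" where
  "coord \<tau> x = Poly_Mapping.lookup (sym_lift factor_var x) (e_monom \<tau>)"

lemma clinear_coord: "clinear (coord \<tau>)"
  by (rule clinearI)
    (simp_all add: coord_def sym_lift_add[OF clinear_factor_var] sym_lift_scaleC[OF clinear_factor_var] lookup_add)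

lemma coord_e_vec:
  assumes "\<tau> \<in> involutions weyl_B" "\<tau>' \<in> involutions weyl_B"
  shows "coord \<tau> (e_vec \<tau>') = (if \<tau> = \<tau>' then 1 else 0)"
proof -
  have "e_monom \<tau>' = e_monom \<tau> \<longleftrightarrow> \<tau> = \<tau>'"
    using e_vars_inj[OF assms] by (metis keys_e_monom)
  then show ?thesis
    by (simp add: coord_def sym_lift_e_vec lookup_single when_def)
qed

section \<open>The action on the vectors \<open>e_vec\<close>\<close>

lemma wedge_self: "a \<and>\<^sub>2 a = 0"
  by transfer
    (unfold ext2_eq_def, rule cvec.span_base, simp add: ext2_relators_def Let_def, blast)

lemma wedge_commute: "a \<and>\<^sub>2 b = - (b \<and>\<^sub>2 a)"
proof -
  have "0 = (a + b) \<and>\<^sub>2 (a + b)"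
    by (rule wedge_self[symmetric])
  also have "\<dots> = a \<and>\<^sub>2 a + b \<and>\<^sub>2 a + (a \<and>\<^sub>2 b + b \<and>\<^sub>2 b)"
    by (simp only: wedge_add_left wedge_add_right)
  finally show ?thesis
    by (simp add: wedge_self eq_neg_iff_add_eq_0 add.commute)
qed

text \<open>The pairs of \<open>\<pi>\<close> are matched with those of \<open>\<pi>'\<close> by
  sending \<open>m\<close> to the smaller end of the image pair; where \<open>\<eta>\<close>
  reverses the order, antisymmetry of \<open>Y\<close> gives -1. Keeping \<open>Y\<close> abstract
  serves wedges of variables and of squares alike.\<close>

lemma prod_pairs_image:
  fixes \<pi> \<eta> :: "'n::{finite,linorder} \<Rightarrow> 'n" and Y :: "'n \<Rightarrow> 'n \<Rightarrow> 'r::comm_ring_1"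
  assumes \<pi>: "\<And>x. \<pi> (\<pi> x) = x" and \<eta>: "bij \<eta>" and S: "\<And>x. \<pi> x \<in> S \<longleftrightarrow> x \<in> S"
    and Y: "\<And>a b. Y a b = - Y b a" and \<pi>': "\<And>x. \<pi>' (\<eta> x) = \<eta> (\<pi> x)" and S': "\<And>x. \<eta> x \<in> S' \<longleftrightarrow> x \<in> S"
  shows "(\<Prod>m | m \<in> S \<and> m < \<pi> m. Y (\<eta> m) (\<eta> (\<pi> m))) =
    (\<Prod>m | m \<in> S \<and> m < \<pi> m. if \<eta> m < \<eta> (\<pi> m) then 1 else -1) *
    (\<Prod>m | m \<in> S' \<and> m < \<pi>' m. Y m (\<pi>' m))"
proof -
  define h where "h m = (if \<eta> m < \<eta> (\<pi> m) then \<eta> m else \<eta> (\<pi> m))" for m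
  have \<eta>_eq: "\<eta> x = \<eta> y \<longleftrightarrow> x = y" for x y
    using \<eta> by (simp add: bij_is_inj inj_eq)
  have "(\<Prod>m | m \<in> S' \<and> m < \<pi>' m. Y m (\<pi>' m)) = (\<Prod>m | m \<in> S \<and> m < \<pi> m. Y (h m) (\<pi>' (h m)))"
  proof (rule prod.reindex_bij_betw[symmetric])
    have "inj_on h {m. m \<in> S \<and> m < \<pi> m}"
      using \<pi> by (auto simp: inj_on_def h_def \<eta>_eq split: if_splits) (metis order_less_asym)+
    moreover have "h ` {m. m \<in> S \<and> m < \<pi> m} = {m. m \<in> S' \<and> m < \<pi>' m}"
    proof (intro equalityI subsetI)
      fix x assume "x \<in> h ` {m. m \<in> S \<and> m < \<pi> m}"
      then obtain m where m: "x = h m" "m \<in> S" "m < \<pi> m"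
        by blast
      then have "\<eta> m \<noteq> \<eta> (\<pi> m)"
        by (auto simp: \<eta>_eq)
      then show "x \<in> {m. m \<in> S' \<and> m < \<pi>' m}"
        using m by (auto simp: h_def S' \<pi>' S \<pi>)
    next
      fix x assume x: "x \<in> {m. m \<in> S' \<and> m < \<pi>' m}"
      obtain m where m: "x = \<eta> m"
        using \<eta> by (metis bij_pointE)
      have "m \<noteq> \<pi> m"
        using x by (auto simp: m \<pi>')
      show "x \<in> h ` {m. m \<in> S \<and> m < \<pi> m}"
      proof (cases "m < \<pi> m")
        case True
        then show ?thesis
          using x by (intro image_eqI[of _ _ m]) (auto simp: h_def m \<pi>' S')
      next
        case False
        then show ?thesis
          using x \<open>m \<noteq> \<pi> m\<close> by (intro image_eqI[of _ _ "\<pi> m"]) (auto simp: h_def m \<pi>' S' \<pi> S)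
      qed
    qed
    ultimately show "bij_betw h {m. m \<in> S \<and> m < \<pi> m} {m. m \<in> S' \<and> m < \<pi>' m}"
      by (simp add: bij_betw_def)
  qed
  moreover have "Y (\<eta> m) (\<eta> (\<pi> m)) = (if \<eta> m < \<eta> (\<pi> m) then 1 else -1) * Y (h m) (\<pi>' (h m))" for m
    using Y[of "\<eta> m" "\<eta> (\<pi> m)"] by (simp add: h_def \<pi>' \<pi>)
  ultimately show ?thesis
    by (simp add: prod.distrib)
qed

lemma prod_pairs:
  fixes \<pi> :: "'n::{finite,linorder} \<Rightarrow> 'n" and f :: "'n \<Rightarrow> 'r::comm_monoid_mult"
  assumes \<pi>: "\<And>x. \<pi> (\<pi> x) = x" and S: "\<And>x. \<pi> x \<in> S \<longleftrightarrow> x \<in> S" "\<And>x. x \<in> S \<Longrightarrow> \<pi> x \<noteq> x"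
  shows "(\<Prod>m | m \<in> S \<and> m < \<pi> m. f m * f (\<pi> m)) = (\<Prod>m\<in>S. f m)"
proof -
  have "(\<Prod>m | m \<in> S \<and> m < \<pi> m. f (\<pi> m)) = (\<Prod>m | m \<in> S \<and> \<pi> m < m. f m)"
    by (rule prod.reindex_bij_witness[of _ \<pi> \<pi>]) (auto simp: \<pi> S)
  moreover have "{m. m \<in> S \<and> m < \<pi> m} \<union> {m. m \<in> S \<and> \<pi> m < m} = S"
    using S(2) by fastforce
  moreover have "{m. m \<in> S \<and> m < \<pi> m} \<inter> {m. m \<in> S \<and> \<pi> m < m} = {}"
    by auto
  ultimately show ?thesis
    using prod.union_disjoint[of "{m. m \<in> S \<and> m < \<pi> m}" "{m. m \<in> S \<and> \<pi> m < m}" f]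
    by (simp add: prod.distrib)
qed

section \<open>The monomial action on the module\<close>

text \<open>Conjugation by the permutation underlying \<open>w\<close>, not by \<open>w\<close>
  itself: the signs of \<open>w\<close> enter only the scalar \<open>act_sign\<close>.\<close>

definition perm_act :: "'n signed_perm \<Rightarrow> 'n signed_perm \<Rightarrow> 'n signed_perm" where
  "perm_act w \<tau> = (fst \<tau> \<circ> inv_into UNIV (snd w), snd w \<circ> snd \<tau> \<circ> inv_into UNIV (snd w))"

text \<open>For an involution the indices with sign -1 are those in \<open>L1\<close> and both ends
  of the pairs in \<open>L2\<close>, exactly the variables that occur to an odd power. The squares
  in the remaining pairs absorb their signs.\<close>

definition act_sign :: "'n::{finite,linorder} signed_perm \<Rightarrow> 'n signed_perm \<Rightarrow> int" where
  "act_sign w \<tau> = (\<Prod>i | fst \<tau> i = -1. fst w (snd w i)) * osgn (snd w) (snd \<tau>)"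

lemma sym_act_simps:
  shows sym_act_add: "sym_act w (x + y) = sym_act w x + sym_act w y"
    and sym_act_scaleC: "sym_act w (c *\<^sub>C x) = c *\<^sub>C sym_act w x"
    and sym_act_mult: "sym_act w (x * y) = sym_act w x * sym_act w y"
    and sym_act_one: "sym_act w 1 = 1"
    and sym_act_inj: "sym_act w (sym_inj v) = sym_inj (V_act w v)"
proof -
  have 1: "clinear (\<lambda>v. sym_inj (V_act w v))"
    by (rule clinearI) (simp_all add: clinear_add[OF clinear_V_act] clinear_scaleC[OF clinear_V_act]
        clinear_add[OF clinear_sym_inj] clinear_scaleC[OF clinear_sym_inj])
  show "sym_act w (x + y) = sym_act w x + sym_act w y" "sym_act w (c *\<^sub>C x) = c *\<^sub>C sym_act w x"
    "sym_act w (x * y) = sym_act w x * sym_act w y" "sym_act w 1 = 1"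
    unfolding sym_act_def sym_map_def
    by (simp_all add: sym_lift_add[OF 1] sym_lift_scaleC[OF 1] sym_lift_mult[OF 1] sym_lift_one[OF 1])
  show "sym_act w (sym_inj v) = sym_inj (V_act w v)"
    unfolding sym_act_def by (rule sym_map_inj[OF clinear_V_act])
qed

lemma sym_act_prod: "sym_act w (\<Prod>i\<in>A. x i) = (\<Prod>i\<in>A. sym_act w (x i))"
  by (induction A rule: infinite_finite_induct) (simp_all add: sym_act_one sym_act_mult)

lemma clinear_poly_act: "clinear (poly_act w)"
  by (rule clinearI) (simp_all add: poly_act_def poly_eval_add poly_eval_scaleC split: prod.splits)

lemma poly_act_var: "poly_act (\<epsilon>, \<eta>) (var i) = of_int (\<epsilon> (\<eta> i)) *\<^sub>C var (\<eta> i)"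
  by (simp add: poly_act_def)

lemma poly_act_power2: "poly_act w (p\<^sup>2) = (poly_act w p)\<^sup>2"
  by (simp add: poly_act_def power2_eq_square poly_eval_mult split: prod.splits)

lemma V_act_simps:
  "V_act w (p, 0) = (poly_act w p, 0)"
  "V_act w (0, p \<and>\<^sub>2 q) = (0, poly_act w p \<and>\<^sub>2 poly_act w q)"
  by (simp_all add: V_act_def ext2_map_wedge[OF clinear_poly_act] clinear_zero[OF clinear_poly_act]
      clinear_zero[OF clinear_ext2_map[OF clinear_poly_act]])

text \<open>Scalars as elements of the algebra, so that they can be moved through products by
  commutativity and associativity alone.\<close>

definition cst :: "complex \<Rightarrow> 'a::comm_complex_algebra_1" where
  "cst c = c *\<^sub>C 1"

lemma cst_mult: "cst (a * b) = cst a * cst b"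
  by (simp add: cst_def mult_scaleC_left mult_scaleC_right scaleC_scaleC)

lemma cst_one: "cst 1 = 1"
  by (simp add: cst_def scaleC_one)

lemma cst_scaleC: "c *\<^sub>C x = cst c * x"
  by (simp add: cst_def mult_scaleC_left)

lemma cst_minus_one: "cst (-1) = -1"
  by (simp add: cst_def scaleC_one)

lemma cst_prod: "cst (\<Prod>i\<in>A. f i) = (\<Prod>i\<in>A. cst (f i))"
  by (induction A rule: infinite_finite_induct) (simp_all add: cst_mult cst_one)

lemma bij_carrier_weyl_B:
  assumes "w \<in> carrier weyl_B"
  shows "bij (snd w)" "inv_into UNIV (snd w) (snd w x) = x" "snd w (inv_into UNIV (snd w) x) = x"
proof -
  show "bij (snd w)"
    using assms carrier_weyl_B[of "fst w" "snd w"] by simp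
  then show "inv_into UNIV (snd w) (snd w x) = x" "snd w (inv_into UNIV (snd w) x) = x"
    by (simp_all add: bij_is_inj bij_is_surj surj_f_inv_f)
qed

lemma perm_act_simps:
  assumes "w \<in> carrier weyl_B"
  shows "fst (perm_act w \<tau>) (snd w i) = fst \<tau> i" "snd (perm_act w \<tau>) (snd w i) = snd w (snd \<tau> i)"
  using assms by (simp_all add: perm_act_def bij_carrier_weyl_B)

lemma perm_act_eqI:
  assumes "w \<in> carrier weyl_B" "\<And>i. fst \<tau>' (snd w i) = fst \<tau> i" "\<And>i. snd \<tau>' (snd w i) = snd w (snd \<tau> i)"
  shows "perm_act w \<tau> = \<tau>'"
proof -
  have "fst \<tau>' j = fst \<tau> (inv_into UNIV (snd w) j)"
    "snd \<tau>' j = snd w (snd \<tau> (inv_into UNIV (snd w) j))" for j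
    using assms(2,3)[of "inv_into UNIV (snd w) j"] by (simp_all add: bij_carrier_weyl_B[OF assms(1)])
  then show ?thesis
    by (simp add: perm_act_def prod_eq_iff fun_eq_iff)
qed

lemma perm_act_involution:
  assumes "w \<in> carrier weyl_B" "\<tau> \<in> involutions weyl_B"
  shows "perm_act w \<tau> \<in> involutions weyl_B"
proof -
  have "(fst \<tau>, snd \<tau>) \<in> involutions weyl_B"
    using assms(2) by simp
  then show ?thesis
    unfolding perm_act_def involutions_weyl_B by (auto simp: bij_carrier_weyl_B[OF assms(1)])
qed

lemma perm_act_mult:
  assumes "w \<in> carrier weyl_B" "w' \<in> carrier weyl_B"
  shows "perm_act (w \<otimes>\<^bsub>weyl_B\<^esub> w') \<tau> = perm_act w (perm_act w' \<tau>)"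
proof -
  obtain \<epsilon> \<eta> \<epsilon>' \<eta>' where "w = (\<epsilon>, \<eta>)" "w' = (\<epsilon>', \<eta>')"
    by (cases w; cases w')
  then show ?thesis
    using assms by (simp add: perm_act_def mult_weyl_B carrier_weyl_B o_inv_distrib o_assoc)
qed

lemma perm_act_one: "perm_act \<one>\<^bsub>weyl_B\<^esub> \<tau> = \<tau>"
  by (simp add: perm_act_def one_weyl_B)

lemma sym_act_e_vec:
  assumes w: "w \<in> carrier weyl_B" and \<tau>: "\<tau> \<in> involutions weyl_B"
  shows "sym_act w (e_vec \<tau>) = of_int (act_sign w \<tau>) *\<^sub>C e_vec (perm_act w \<tau>)"
proof -
  obtain \<epsilon> \<eta> \<zeta> \<pi> where [simp]: "w = (\<epsilon>, \<eta>)" "\<tau> = (\<zeta>, \<pi>)"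
    by (cases w; cases \<tau>)
  obtain \<zeta>' \<pi>' where \<tau>': "perm_act w \<tau> = (\<zeta>', \<pi>')"
    by (cases "perm_act w \<tau>")
  have \<tau>B: "\<pi> (\<pi> x) = x" "\<zeta> (\<pi> x) = \<zeta> x" "\<zeta> x = 1 \<or> \<zeta> x = -1" for x
    using \<tau> sign_values(1)[of \<zeta> x] by (auto simp: involutions_weyl_B)
  have wB: "bij \<eta>" "\<epsilon> x * \<epsilon> x = 1" for x
    using w sign_values(2)[of \<epsilon> x] by (auto simp: carrier_weyl_B)
  have \<eta>_eq: "\<eta> x = \<eta> y \<longleftrightarrow> x = y" for x y
    using wB(1) by (simp add: bij_is_inj inj_eq)
  have t': "\<zeta>' (\<eta> x) = \<zeta> x" "\<pi>' (\<eta> x) = \<eta> (\<pi> x)" for x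
    using perm_act_simps[OF w, of \<tau> x] \<tau>' by simp_all
  define X :: "'a \<Rightarrow> ('a cpoly \<times> 'a cpoly ext2) symalg" where "X k = sym_inj (var k, 0)" for k
  define Y :: "'a \<Rightarrow> 'a \<Rightarrow> ('a cpoly \<times> 'a cpoly ext2) symalg" where "Y m m' = sym_inj (0, var m \<and>\<^sub>2 var m')" for m m'
  define Z :: "'a \<Rightarrow> 'a \<Rightarrow> ('a cpoly \<times> 'a cpoly ext2) symalg" where "Z m m' = sym_inj (0, (var m)\<^sup>2 \<and>\<^sub>2 (var m')\<^sup>2)" for m m'
  define c where "c i = (of_int (\<epsilon> i) :: complex)" for i
  have anti: "sym_inj (0, a \<and>\<^sub>2 b) = - sym_inj (0, b \<and>\<^sub>2 a)" for a b :: "'a cpoly"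
  proof -
    have "sym_inj (0, a \<and>\<^sub>2 b) = sym_inj ((-1) *\<^sub>C (0, b \<and>\<^sub>2 a))"
      by (subst wedge_commute) (simp add: scaleC_prod_def scaleC_one)
    also have "\<dots> = (-1) *\<^sub>C sym_inj (0, b \<and>\<^sub>2 a)"
      by (rule clinear_scaleC[OF clinear_sym_inj])
    finally show ?thesis
      by simp
  qed
  have YZ: "Y a b = - Y b a" "Z a b = - Z b a" for a b
    unfolding Y_def Z_def by (rule anti)+
  have aX: "sym_act w (X k) = cst (c (\<eta> k)) * X (\<eta> k)" for k
  proof -
    have "sym_act w (X k) = sym_inj (c (\<eta> k) *\<^sub>C (var (\<eta> k), 0))"
      by (simp add: X_def sym_act_inj V_act_simps poly_act_var c_def scaleC_prod_def)
    then show ?thesis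
      by (simp add: clinear_scaleC[OF clinear_sym_inj] X_def cst_scaleC)
  qed
  have aY: "sym_act w (Y k l) = cst (c (\<eta> k)) * cst (c (\<eta> l)) * Y (\<eta> k) (\<eta> l)" for k l
  proof -
    have "sym_act w (Y k l) = sym_inj ((c (\<eta> k) * c (\<eta> l)) *\<^sub>C (0, var (\<eta> k) \<and>\<^sub>2 var (\<eta> l)))"
      by (simp add: Y_def sym_act_inj V_act_simps poly_act_var c_def scaleC_prod_def
          wedge_scaleC_left wedge_scaleC_right scaleC_scaleC mult.commute)
    then show ?thesis
      by (simp only: clinear_scaleC[OF clinear_sym_inj] Y_def cst_scaleC cst_mult)
  qed
  \<comment> \<open>Here the squares take effect: every sign occurs twice and disappears.\<close>
  have aZ: "sym_act w (Z k l) = Z (\<eta> k) (\<eta> l)" for k l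
  proof -
    have "(poly_act (\<epsilon>, \<eta>) (var i))\<^sup>2 = (var (\<eta> i))\<^sup>2" for i
    proof -
      have "(poly_act (\<epsilon>, \<eta>) (var i))\<^sup>2 = (of_int (\<epsilon> (\<eta> i) * \<epsilon> (\<eta> i))) *\<^sub>C (var (\<eta> i))\<^sup>2"
        by (simp add: poly_act_var power2_eq_square mult_scaleC_left mult_scaleC_right scaleC_scaleC)
      then show ?thesis
        by (simp only: wB(2) of_int_1 scaleC_one)
    qed
    then show ?thesis
      by (simp add: Z_def sym_act_inj V_act_simps poly_act_power2)
  qed
  have e: "e_vec (\<zeta>, \<pi>) = (\<Prod>k\<in>L1 (\<zeta>, \<pi>). X k) * (\<Prod>m | m \<in> L2 (\<zeta>, \<pi>) \<and> m < \<pi> m. Y m (\<pi> m)) *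
      (\<Prod>m | m \<in> Q2 (\<zeta>, \<pi>) \<and> m < \<pi> m. Z m (\<pi> m))" for \<zeta> \<pi>
    by (simp add: e_vec_def X_def Y_def Z_def)
  have bX: "(\<Prod>k\<in>L1 (\<zeta>, \<pi>). X (\<eta> k)) = (\<Prod>k\<in>L1 (\<zeta>', \<pi>'). X k)"
  proof (rule prod.reindex_bij_betw)
    show "bij_betw \<eta> (L1 (\<zeta>, \<pi>)) (L1 (\<zeta>', \<pi>'))"
      unfolding bij_betw_def
    proof
      show "inj_on \<eta> (L1 (\<zeta>, \<pi>))"
        by (simp add: inj_on_def \<eta>_eq)
      show "\<eta> ` L1 (\<zeta>, \<pi>) = L1 (\<zeta>', \<pi>')"
      proof (intro equalityI subsetI)
        fix y assume y: "y \<in> L1 (\<zeta>', \<pi>')"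
        obtain x where "y = \<eta> x"
          using wB(1) by (metis bij_pointE)
        then show "y \<in> \<eta> ` L1 (\<zeta>, \<pi>)"
          using y by (auto simp: L1_def t' \<eta>_eq)
      qed (auto simp: L1_def t')
    qed
  qed
  have bY: "(\<Prod>m | m \<in> L2 (\<zeta>, \<pi>) \<and> m < \<pi> m. Y (\<eta> m) (\<eta> (\<pi> m))) =
      (\<Prod>m | m \<in> L2 (\<zeta>, \<pi>) \<and> m < \<pi> m. if \<eta> m < \<eta> (\<pi> m) then 1 else -1) *
      (\<Prod>m | m \<in> L2 (\<zeta>', \<pi>') \<and> m < \<pi>' m. Y m (\<pi>' m))"
    by (rule prod_pairs_image[OF \<tau>B(1) wB(1) _ YZ(1) t'(2)]) (auto simp: L2_def \<tau>B t' \<eta>_eq)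
  have bZ: "(\<Prod>m | m \<in> Q2 (\<zeta>, \<pi>) \<and> m < \<pi> m. Z (\<eta> m) (\<eta> (\<pi> m))) =
      (\<Prod>m | m \<in> Q2 (\<zeta>, \<pi>) \<and> m < \<pi> m. if \<eta> m < \<eta> (\<pi> m) then 1 else -1) *
      (\<Prod>m | m \<in> Q2 (\<zeta>', \<pi>') \<and> m < \<pi>' m. Z m (\<pi>' m))"
    by (rule prod_pairs_image[OF \<tau>B(1) wB(1) _ YZ(2) t'(2)]) (auto simp: Q2_def \<tau>B t' \<eta>_eq)
  have cY: "(\<Prod>m | m \<in> L2 (\<zeta>, \<pi>) \<and> m < \<pi> m. cst (c (\<eta> m)) * cst (c (\<eta> (\<pi> m)))) =
      (\<Prod>m\<in>L2 (\<zeta>, \<pi>). (cst (c (\<eta> m)) :: ('a cpoly \<times> 'a cpoly ext2) symalg))"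
    by (rule prod_pairs) (auto simp: L2_def \<tau>B)
  \<comment> \<open>\<open>L2\<close> is defined by the sign at \<open>\<pi> i\<close>; for an
    involution this equals the sign at \<open>i\<close>, which turns the union into the index set of
    \<open>act_sign\<close>.\<close>
  have neg: "{i. \<zeta> i = -1} = L1 (\<zeta>, \<pi>) \<union> L2 (\<zeta>, \<pi>)" "L1 (\<zeta>, \<pi>) \<inter> L2 (\<zeta>, \<pi>) = {}"
    by (auto simp: L1_def L2_def \<tau>B)
  have pairs: "{i. i < \<pi> i} = {m. m \<in> L2 (\<zeta>, \<pi>) \<and> m < \<pi> m} \<union> {m. m \<in> Q2 (\<zeta>, \<pi>) \<and> m < \<pi> m}"
    "{m. m \<in> L2 (\<zeta>, \<pi>) \<and> m < \<pi> m} \<inter> {m. m \<in> Q2 (\<zeta>, \<pi>) \<and> m < \<pi> m} = {}"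
    using \<tau>B(3) by (auto simp: L2_def Q2_def)
  have sgn: "(cst (of_int (act_sign w \<tau>)) :: ('a cpoly \<times> 'a cpoly ext2) symalg) =
      (\<Prod>k\<in>L1 (\<zeta>, \<pi>). cst (c (\<eta> k))) * (\<Prod>k\<in>L2 (\<zeta>, \<pi>). cst (c (\<eta> k))) *
      ((\<Prod>m | m \<in> L2 (\<zeta>, \<pi>) \<and> m < \<pi> m. if \<eta> m < \<eta> (\<pi> m) then 1 else -1) *
       (\<Prod>m | m \<in> Q2 (\<zeta>, \<pi>) \<and> m < \<pi> m. if \<eta> m < \<eta> (\<pi> m) then 1 else -1))"
  proof -
    have if_cst: "cst (of_int (if b then 1 else -1)) = (if b then 1 else -1 :: ('a cpoly \<times> 'a cpoly ext2) symalg)" for b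
      by (simp add: cst_one cst_minus_one)
    show ?thesis
      unfolding act_sign_def osgn_def
      by (simp add: neg pairs prod.union_disjoint cst_mult cst_prod c_def if_cst
          del: of_int_minus flip: of_int_mult)
        (simp add: cst_prod cst_mult if_cst c_def)
  qed
  have "sym_act w (e_vec \<tau>) = (\<Prod>k\<in>L1 (\<zeta>, \<pi>). cst (c (\<eta> k))) * (\<Prod>k\<in>L1 (\<zeta>, \<pi>). X (\<eta> k)) *
      ((\<Prod>m | m \<in> L2 (\<zeta>, \<pi>) \<and> m < \<pi> m. cst (c (\<eta> m)) * cst (c (\<eta> (\<pi> m)))) *
       (\<Prod>m | m \<in> L2 (\<zeta>, \<pi>) \<and> m < \<pi> m. Y (\<eta> m) (\<eta> (\<pi> m)))) *
      (\<Prod>m | m \<in> Q2 (\<zeta>, \<pi>) \<and> m < \<pi> m. Z (\<eta> m) (\<eta> (\<pi> m)))"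
    unfolding \<open>\<tau> = (\<zeta>, \<pi>)\<close> e sym_act_mult sym_act_prod aX aY aZ by (simp only: prod.distrib)
  also have "\<dots> = cst (of_int (act_sign w \<tau>)) * e_vec (\<zeta>', \<pi>')"
    unfolding bX bY bZ cY sgn e by (simp only: mult_ac)
  finally show ?thesis
    by (simp only: \<tau>' cst_scaleC)
qed

text \<open>The action law is checked on the three kinds of factors, where it reduces to variables.
  It then passes to products and, by linearity, to the module.\<close>

lemma V_act_mult:
  assumes "w \<in> carrier weyl_B" "w' \<in> carrier weyl_B"
  shows "V_act (w \<otimes>\<^bsub>weyl_B\<^esub> w') (var i, 0) = V_act w (V_act w' (var i, 0))"
    "V_act (w \<otimes>\<^bsub>weyl_B\<^esub> w') (0, var i \<and>\<^sub>2 var j) = V_act w (V_act w' (0, var i \<and>\<^sub>2 var j))"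
    "V_act (w \<otimes>\<^bsub>weyl_B\<^esub> w') (0, (var i)\<^sup>2 \<and>\<^sub>2 (var j)\<^sup>2) = V_act w (V_act w' (0, (var i)\<^sup>2 \<and>\<^sub>2 (var j)\<^sup>2))"
  by (simp_all add: V_act_simps poly_act_power2 poly_act_mult[OF assms])

lemma sym_act_mult_e_vec:
  assumes "w \<in> carrier weyl_B" "w' \<in> carrier weyl_B"
  shows "sym_act (w \<otimes>\<^bsub>weyl_B\<^esub> w') (e_vec \<tau>) = sym_act w (sym_act w' (e_vec \<tau>))"
  unfolding e_vec_def Let_def sym_act_mult sym_act_prod sym_act_inj V_act_mult[OF assms] ..

lemma act_sign_square:
  assumes "w \<in> carrier weyl_B"
  shows "act_sign w \<tau> * act_sign w \<tau> = 1"
proof -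
  have "fst w i * fst w i = 1" for i
    using assms carrier_weyl_B[of "fst w" "snd w"] sign_values(2)[of "fst w" i] by simp
  then have "(\<Prod>i\<in>A. fst w (snd w i)) * (\<Prod>i\<in>A. fst w (snd w i)) = 1" for A
    by (simp flip: prod.distrib)
  moreover have "osgn (snd w) (snd \<tau>) * osgn (snd w) (snd \<tau>) = 1"
    unfolding osgn_def by (simp flip: prod.distrib add: if_distrib cong: if_cong)
  ultimately show ?thesis
    by (simp add: act_sign_def mult.assoc mult.left_commute)
qed

text \<open>The cocycle rule is read off from the action: both sides are the coefficient of the same
  basis vector after applying the product. This avoids a combinatorial argument with
  \<open>osgn\<close>.\<close>

lemma act_sign_mult:
  assumes w: "w \<in> carrier weyl_B" "w' \<in> carrier weyl_B" and \<tau>: "\<tau> \<in> involutions weyl_B"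
  shows "act_sign (w \<otimes>\<^bsub>weyl_B\<^esub> w') \<tau> = act_sign w (perm_act w' \<tau>) * act_sign w' \<tau>"
proof -
  interpret B: group weyl_B
    by (rule group_weyl_B)
  have ww: "w \<otimes>\<^bsub>weyl_B\<^esub> w' \<in> carrier weyl_B"
    using w by simp
  have "coord (perm_act (w \<otimes>\<^bsub>weyl_B\<^esub> w') \<tau>) (sym_act (w \<otimes>\<^bsub>weyl_B\<^esub> w') (e_vec \<tau>)) =
      coord (perm_act (w \<otimes>\<^bsub>weyl_B\<^esub> w') \<tau>) (sym_act w (sym_act w' (e_vec \<tau>)))"
    by (simp add: sym_act_mult_e_vec w)
  then have "(of_int (act_sign (w \<otimes>\<^bsub>weyl_B\<^esub> w') \<tau>) :: complex) =
      of_int (act_sign w' \<tau>) * of_int (act_sign w (perm_act w' \<tau>))"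
    using w \<tau> ww
    by (simp add: sym_act_e_vec perm_act_involution sym_act_scaleC clinear_scaleC[OF clinear_coord]
        coord_e_vec perm_act_mult scaleC_complex_def)
  then show ?thesis
    by (metis mult.commute of_int_eq_iff of_int_mult)
qed

lemma act_sign_one: "act_sign \<one>\<^bsub>weyl_B\<^esub> \<tau> = 1"
  by (simp add: act_sign_def one_weyl_B osgn_def)

lemma coord_perm_act:
  assumes w: "w \<in> carrier weyl_B" and "\<rho> \<in> involutions weyl_B" "\<tau> \<in> involutions weyl_B"
  shows "coord (perm_act w \<rho>) (sym_act w (e_vec \<tau>)) = of_int (act_sign w \<rho>) * coord \<rho> (e_vec \<tau>)"
proof -
  interpret B: group weyl_B
    by (rule group_weyl_B)
  have "perm_act w \<rho> = perm_act w \<tau> \<longleftrightarrow> \<rho> = \<tau>"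
    using w perm_act_mult[of "inv\<^bsub>weyl_B\<^esub> w" w] perm_act_one by (metis B.inv_closed B.l_inv)
  then show ?thesis
    using assms by (simp add: sym_act_e_vec clinear_scaleC[OF clinear_coord] coord_e_vec
        perm_act_involution scaleC_complex_def)
qed

lemma sym_act_zero [simp]: "sym_act w 0 = 0"
  using sym_act_scaleC[of w 0 0] by simp

section \<open>The module of a subgroup containing the permutations\<close>

text \<open>\<open>pure\<close> supplies the permutations that exchange two involutions or obstruct
  an entry; \<open>separate\<close> forces equal sign parts at a nonzero entry. Restricting
  \<open>separate\<close> to involutions of \<open>W\<close> is essential for the series D, where
  even sign changes confuse \<open>\<zeta>\<close> with \<open>-\<zeta>\<close>.\<close>

locale weyl_subgroup =
  fixes W :: "'n::{finite,linorder} signed_perm monoid" and C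
  assumes W: "W = weyl_B\<lparr>carrier := C\<rparr>" and sub: "subgroup C weyl_B"
    and pure: "bij \<eta> \<Longrightarrow> ((\<lambda>_. 1), \<eta>) \<in> C"
    and separate: "(\<zeta>, \<pi>) \<in> involutions W \<Longrightarrow> (\<zeta>', \<pi>') \<in> involutions W \<Longrightarrow>
      (\<And>\<epsilon>. (\<epsilon>, id) \<in> C \<Longrightarrow> (\<Prod>i | \<zeta> i = -1. \<epsilon> i) = (\<Prod>i | \<zeta>' i = -1. \<epsilon> i)) \<Longrightarrow> \<zeta> = \<zeta>'"
begin

lemma group_W: "group W"
  unfolding W by (rule subgroup.subgroup_is_group[OF sub group_weyl_B])

sublocale group W
  by (rule group_W)

lemma W_simps: "carrier W = C" "x \<otimes>\<^bsub>W\<^esub> y = x \<otimes>\<^bsub>weyl_B\<^esub> y" "\<one>\<^bsub>W\<^esub> = \<one>\<^bsub>weyl_B\<^esub>"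
  by (simp_all add: W)

lemma carrier_W: "w \<in> C \<Longrightarrow> w \<in> carrier weyl_B"
  using subgroup.subset[OF sub] by blast

lemma involutions_W: "\<tau> \<in> involutions W \<longleftrightarrow> \<tau> \<in> C \<and> \<tau> \<in> involutions weyl_B"
  using carrier_W[of \<tau>] by (auto simp: involutions_def W_simps)

text \<open>The conjugating permutation \<open>p\<close> without signs lies in \<open>C\<close> by
  \<open>pure\<close>, even though \<open>w\<close> may carry signs.\<close>

lemma perm_act_W:
  assumes w: "w \<in> C" and \<tau>: "\<tau> \<in> involutions W"
  shows "perm_act w \<tau> \<in> involutions W"
proof -
  interpret B: group weyl_B
    by (rule group_weyl_B)
  have wB: "w \<in> carrier weyl_B"
    using w by (rule carrier_W)
  define p where "p = ((\<lambda>_ :: 'n. 1 :: int), snd w)"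
  have p: "p \<in> C"
    unfolding p_def by (rule pure[OF bij_carrier_weyl_B(1)[OF wB]])
  have \<tau>C: "\<tau> \<in> C" and \<tau>B: "\<tau> \<in> involutions weyl_B"
    using \<tau> by (simp_all add: involutions_W)
  have pa: "perm_act w \<tau> \<in> carrier weyl_B"
    using perm_act_involution[OF wB \<tau>B] by (simp add: involutions_def)
  have "perm_act w \<tau> \<otimes>\<^bsub>weyl_B\<^esub> p = p \<otimes>\<^bsub>weyl_B\<^esub> \<tau>"
    using bij_carrier_weyl_B[OF wB]
    by (cases \<tau>) (simp add: p_def perm_act_def mult_weyl_B fun_eq_iff)
  then have "perm_act w \<tau> = p \<otimes>\<^bsub>weyl_B\<^esub> \<tau> \<otimes>\<^bsub>weyl_B\<^esub> inv\<^bsub>weyl_B\<^esub> p"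
    using B.inv_solve_right[of "perm_act w \<tau>" "p \<otimes>\<^bsub>weyl_B\<^esub> \<tau>" p] pa p \<tau>C carrier_W by simp
  then have "perm_act w \<tau> \<in> C"
    using p \<tau>C sub by (simp add: subgroup.m_closed subgroup.m_inv_closed)
  then show ?thesis
    using perm_act_involution[OF wB \<tau>B] by (simp add: involutions_W)
qed

lemma finite_C: "finite C"
  using subgroup.subset[OF sub] finite_weyl_B by (rule finite_subset)

lemma finite_involutions: "finite (involutions W)"
  using finite_C by (rule finite_subset[rotated]) (auto simp: involutions_W)

lemma e_vec_mem: "\<tau> \<in> involutions W \<Longrightarrow> e_vec \<tau> \<in> model_space W"
  unfolding model_space_def by (intro cvec.span_base imageI)

lemma model_space_induct [consumes 1, case_names e_vec zero add scale]:
  assumes v: "v \<in> model_space W"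
    and e: "\<And>\<tau>. \<tau> \<in> involutions W \<Longrightarrow> P (e_vec \<tau>)" and z: "P 0"
    and add: "\<And>x y. x \<in> model_space W \<Longrightarrow> y \<in> model_space W \<Longrightarrow> P x \<Longrightarrow> P y \<Longrightarrow> P (x + y)"
    and sc: "\<And>c x. x \<in> model_space W \<Longrightarrow> P x \<Longrightarrow> P (c *\<^sub>C x)"
  shows "P v"
proof -
  have "cvec.span (e_vec ` involutions W) \<subseteq> {x \<in> model_space W. P x}"
  proof (rule cvec.span_minimal)
    show "e_vec ` involutions W \<subseteq> {x \<in> model_space W. P x}"
      using e e_vec_mem by auto
    show "cvec.subspace {x \<in> model_space W. P x}"
      by (rule cvec.subspaceI)
        (auto simp: z add sc model_space_def[of W] cvec.span_zero cvec.span_add cvec.span_scale)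
  qed
  then show ?thesis
    using v by (auto simp: model_space_def)
qed

lemma complex_rep_W: "complex_rep W (model_space W) sym_act"
proof
  show "cvec.subspace (model_space W)"
    by (simp add: model_space_def)
  note span = model_space_def[of W] cvec.span_zero cvec.span_add cvec.span_scale
  fix g h v w c assume v: "v \<in> model_space W"
  show "sym_act \<one>\<^bsub>W\<^esub> v = v"
    using v
  proof (induction rule: model_space_induct)
    case (e_vec \<tau>)
    then show ?case
      by (simp add: W_simps sym_act_e_vec perm_act_one act_sign_one involutions_W scaleC_one
          carrier_W subgroup.one_closed[OF sub])
  next
    case zero
    show ?case
      by simp
  qed (simp_all add: sym_act_add sym_act_scaleC)
  {
    assume g: "g \<in> carrier W"
    show "sym_act g (v + w) = sym_act g v + sym_act g w" "sym_act g (c *\<^sub>C v) = c *\<^sub>C sym_act g v"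
      by (simp_all add: sym_act_add sym_act_scaleC)
    show "sym_act g v \<in> model_space W"
      using v
    proof (induction rule: model_space_induct)
      case (e_vec \<tau>)
      then have "perm_act g \<tau> \<in> involutions W"
        using g by (simp add: perm_act_W W_simps)
      then show ?case
        using e_vec g e_vec_mem
        by (simp add: W_simps sym_act_e_vec involutions_W carrier_W) (simp add: span involutions_W)
    next
      case zero
      show ?case
        by (simp add: span)
    qed (simp_all add: sym_act_add sym_act_scaleC span)
    assume h: "h \<in> carrier W"
    show "sym_act (g \<otimes>\<^bsub>W\<^esub> h) v = sym_act g (sym_act h v)"
      using v
    proof (induction rule: model_space_induct)
      case (e_vec \<tau>)
      then show ?case
        using g h by (simp add: W_simps carrier_W sym_act_mult_e_vec)
    next
      case zero
      show ?case
        by simp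
    qed (simp_all add: sym_act_add sym_act_scaleC)
  }
qed

sublocale M: finite_group_rep W "model_space W" sym_act
  by (intro finite_group_rep.intro finite_group_rep_axioms.intro complex_rep_W)
    (simp add: W_simps finite_C)

lemma coord_act:
  assumes w: "w \<in> C" and \<rho>: "\<rho> \<in> involutions W" and v: "v \<in> model_space W"
  shows "coord (perm_act w \<rho>) (sym_act w v) = of_int (act_sign w \<rho>) * coord \<rho> v"
  using v
proof (induction rule: model_space_induct)
  case (e_vec \<tau>)
  then show ?case
    using w \<rho> by (simp add: coord_perm_act involutions_W carrier_W)
next
  case zero
  show ?case
    by (simp add: clinear_zero[OF clinear_coord])
qed (simp_all add: sym_act_add sym_act_scaleC clinear_add[OF clinear_coord]
    clinear_scaleC[OF clinear_coord] scaleC_complex_def algebra_simps)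

lemma coord_expand:
  assumes "v \<in> model_space W"
  shows "v = (\<Sum>\<tau>\<in>involutions W. coord \<tau> v *\<^sub>C e_vec \<tau>)"
  using assms
proof (induction rule: model_space_induct)
  case (e_vec \<tau>)
  have "(\<Sum>\<rho>\<in>involutions W. coord \<rho> (e_vec \<tau>) *\<^sub>C e_vec \<rho>) =
      (\<Sum>\<rho>\<in>involutions W. if \<rho> = \<tau> then e_vec \<tau> else 0)"
    by (rule sum.cong) (use e_vec in \<open>auto simp: coord_e_vec involutions_W scaleC_one\<close>)
  then show ?case
    using e_vec finite_involutions by simp
next
  case zero
  show ?case
    by (simp add: clinear_zero[OF clinear_coord])
next
  case (add x y)
  have "(\<Sum>\<tau>\<in>involutions W. coord \<tau> (x + y) *\<^sub>C e_vec \<tau>) =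
      (\<Sum>\<tau>\<in>involutions W. coord \<tau> x *\<^sub>C e_vec \<tau>) + (\<Sum>\<tau>\<in>involutions W. coord \<tau> y *\<^sub>C e_vec \<tau>)"
    by (simp add: clinear_add[OF clinear_coord] scaleC_add_left sum.distrib)
  then show ?case
    using add by argo
next
  case (scale c x)
  have "(\<Sum>\<tau>\<in>involutions W. coord \<tau> (c *\<^sub>C x) *\<^sub>C e_vec \<tau>) =
      c *\<^sub>C (\<Sum>\<tau>\<in>involutions W. coord \<tau> x *\<^sub>C e_vec \<tau>)"
    by (simp add: clinear_scaleC[OF clinear_coord] cvec.scale_sum_right scaleC_scaleC scaleC_complex_def)
  then show ?case
    using scale by argo
qed

lemma coord_eqI:
  assumes "v \<in> model_space W" "w \<in> model_space W" "\<And>\<tau>. \<tau> \<in> involutions W \<Longrightarrow> coord \<tau> v = coord \<tau> w"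
  shows "v = w"
proof -
  have "v = (\<Sum>\<tau>\<in>involutions W. coord \<tau> v *\<^sub>C e_vec \<tau>)"
    by (rule coord_expand[OF assms(1)])
  also have "\<dots> = (\<Sum>\<tau>\<in>involutions W. coord \<tau> w *\<^sub>C e_vec \<tau>)"
    by (rule sum.cong) (simp_all add: assms(3))
  also have "\<dots> = w"
    by (rule coord_expand[OF assms(2), symmetric])
  finally show ?thesis .
qed

section \<open>Symmetry of the matrices of intertwiners\<close>

text \<open>Equivariance in matrix form. An element that fixes both involutions but has different
  signs on them annihilates the entry; one that exchanges them relates the entry to its
  transpose.\<close>

lemma intertwiner_coord:
  assumes f: "intertwiner W (model_space W) sym_act (model_space W) sym_act f"
    and w: "w \<in> C" and \<rho>: "\<rho> \<in> involutions W" and \<tau>: "\<tau> \<in> involutions W"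
  shows "of_int (act_sign w \<tau>) * coord (perm_act w \<rho>) (f (e_vec (perm_act w \<tau>))) =
    of_int (act_sign w \<rho>) * coord \<rho> (f (e_vec \<tau>))"
proof -
  have "sym_act w (f (e_vec \<tau>)) = f (sym_act w (e_vec \<tau>))"
    using intertwinerD(4)[OF f e_vec_mem[OF \<tau>]] w by (simp add: W_simps)
  also have "\<dots> = of_int (act_sign w \<tau>) *\<^sub>C f (e_vec (perm_act w \<tau>))"
    using \<tau> w intertwinerD(3)[OF f e_vec_mem[OF perm_act_W[OF w \<tau>]]]
    by (simp add: sym_act_e_vec carrier_W involutions_W)
  finally have "coord (perm_act w \<rho>) (sym_act w (f (e_vec \<tau>))) =
      of_int (act_sign w \<tau>) * coord (perm_act w \<rho>) (f (e_vec (perm_act w \<tau>)))"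
    by (simp add: clinear_scaleC[OF clinear_coord] scaleC_complex_def)
  then show ?thesis
    using coord_act[OF w \<rho> intertwinerD(1)[OF f e_vec_mem[OF \<tau>]]] by simp
qed

lemma act_sign_pure: "act_sign ((\<lambda>_. 1), \<eta>) \<tau> = osgn \<eta> (snd \<tau>)"
  by (simp add: act_sign_def)

text \<open>A matrix entry of an intertwiner vanishes unless the two involutions can be exchanged by an
  involutive permutation \<open>h\<close>; the sign that \<open>h\<close> contributes is that of \<open>h * h\<close>, hence trivial.\<close>

lemma intertwiner_symmetric:
  assumes f: "intertwiner W (model_space W) sym_act (model_space W) sym_act f"
    and \<rho>: "\<rho> \<in> involutions W" and \<tau>: "\<tau> \<in> involutions W"
  shows "coord \<rho> (f (e_vec \<tau>)) = coord \<tau> (f (e_vec \<rho>))"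
proof -
  obtain \<zeta> t \<zeta>' t' where \<rho>\<tau>: "\<rho> = (\<zeta>', t')" "\<tau> = (\<zeta>, t)"
    by (cases \<rho>; cases \<tau>)
  have i: "t (t x) = x" "\<zeta> (t x) = \<zeta> x" "t' (t' x) = x" "\<zeta>' (t' x) = \<zeta>' x" for x
    using \<rho> \<tau> by (simp_all add: \<rho>\<tau> involutions_W involutions_weyl_B)
  interpret two_involutions t t'
    by unfold_locales (simp_all add: i)
  show ?thesis
  proof (cases "\<zeta> = \<zeta>'")
    case False
    \<comment> \<open>Pure sign changes fix every involution, so a nonzero entry forces equal sign
      parts. The local names are generalized because both the entry and its transpose must
      vanish.\<close>
    have *: "coord \<rho> (f (e_vec \<tau>)) = 0"
      if \<rho>: "(\<zeta>', t') \<in> involutions W" "\<rho> = (\<zeta>', t')" and \<tau>: "(\<zeta>, t) \<in> involutions W" "\<tau> = (\<zeta>, t)"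
        and ne: "\<zeta> \<noteq> \<zeta>'" for \<rho> \<tau> \<zeta> t \<zeta>' t'
    proof (rule ccontr)
      assume nz: "coord \<rho> (f (e_vec \<tau>)) \<noteq> 0"
      have "\<zeta> = \<zeta>'"
      proof (rule separate[OF \<tau>(1) \<rho>(1)])
        fix \<epsilon> :: "'n \<Rightarrow> int"
        assume \<epsilon>: "(\<epsilon>, id) \<in> C"
        have "perm_act (\<epsilon>, id) \<sigma> = \<sigma>" for \<sigma> :: "'n signed_perm"
          by (simp add: perm_act_def)
        then have "(of_int (act_sign (\<epsilon>, id) \<tau>) :: complex) = of_int (act_sign (\<epsilon>, id) \<rho>)"
          using intertwiner_coord[OF f \<epsilon>, of \<rho> \<tau>] \<rho> \<tau> nz by simp
        then have "act_sign (\<epsilon>, id) \<tau> = act_sign (\<epsilon>, id) \<rho>"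
          by (simp only: of_int_eq_iff)
        moreover have "osgn id s = 1" for s :: "'n \<Rightarrow> 'n"
          by (simp add: osgn_def)
        ultimately show "(\<Prod>i | \<zeta> i = -1. \<epsilon> i) = (\<Prod>i | \<zeta>' i = -1. \<epsilon> i)"
          by (simp add: act_sign_def \<rho>(2) \<tau>(2))
      qed
      with ne show False
        by contradiction
    qed
    show ?thesis
      using *[of \<zeta>' t' \<rho> \<zeta> t \<tau>] *[of \<zeta> t \<tau> \<zeta>' t' \<rho>] \<rho> \<tau> \<rho>\<tau> False by simp
  next
    case True
    note \<rho>\<tau> = \<rho>\<tau>[folded True]
    \<comment> \<open>The common sign part is constant on the components of the graph, so a
      permutation that preserves every component preserves it.\<close>
    have inv: "\<zeta> (g x) = \<zeta> x"
      if g: "\<And>S. t ` S \<subseteq> S \<Longrightarrow> t' ` S \<subseteq> S \<Longrightarrow> g ` S \<subseteq> S" for g x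
    proof -
      have "g ` {y. \<zeta> y = \<zeta> x} \<subseteq> {y. \<zeta> y = \<zeta> x}"
        by (rule g) (use i True in auto)
      then show ?thesis
        by auto
    qed
    show ?thesis
    proof (cases rule: swap_or_bad)
      case (swap h)
      then have h: "bij h"
        by (intro bij_involution)
      define w where "w = ((\<lambda>_ :: 'n. 1 :: int), h)"
      have w: "w \<in> C" "w \<in> carrier weyl_B"
        using pure[OF h] carrier_W by (auto simp: w_def)
      have ht': "h (t' x) = t (h x)" for x
        by (metis swap(1,2))
      have act: "perm_act w \<tau> = \<rho>" "perm_act w \<rho> = \<tau>"
        by (rule perm_act_eqI[OF w(2)]; simp add: w_def \<rho>\<tau> inv[OF swap(3)] swap(2) ht' flip: True)+
      have "w \<otimes>\<^bsub>weyl_B\<^esub> w = \<one>\<^bsub>weyl_B\<^esub>"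
        using swap(1) by (simp add: w_def mult_weyl_B one_weyl_B fun_eq_iff)
      then have "act_sign w \<rho> * act_sign w \<tau> = 1"
        using act_sign_mult[OF w(2) w(2), of \<tau>] \<tau> by (simp add: act act_sign_one involutions_W)
      then have "act_sign w \<rho> = act_sign w \<tau>" "act_sign w \<rho> \<noteq> 0"
        using act_sign_square[OF w(2)] by (metis mult_cancel_left mult_zero_left zero_neq_one)+
      then show ?thesis
        using intertwiner_coord[OF f w(1) \<rho> \<tau>] by (simp add: act)
    next
      case (bad g)
      define w where "w = ((\<lambda>_ :: 'n. 1 :: int), g)"
      have w: "w \<in> C" "w \<in> carrier weyl_B"
        using pure[OF bad(1)] carrier_W by (auto simp: w_def)
      have act: "perm_act w \<tau> = \<tau>" "perm_act w \<rho> = \<rho>"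
        by (rule perm_act_eqI[OF w(2)]; simp add: w_def \<rho>\<tau> inv[OF bad(4)] bad(2,3) flip: True)+
      have "act_sign w \<tau> \<noteq> act_sign w \<rho>"
        using bad(5) by (simp add: w_def act_sign_pure \<rho>\<tau>)
      then show ?thesis
        using intertwiner_coord[OF f w(1) \<rho> \<tau>] intertwiner_coord[OF f w(1) \<tau> \<rho>] by (simp add: act)
    qed
  qed
qed

lemma coord_intertwiner:
  assumes f: "intertwiner W (model_space W) sym_act (model_space W) sym_act f" and v: "v \<in> model_space W"
  shows "coord \<rho> (f v) = (\<Sum>\<tau>\<in>involutions W. coord \<tau> v * coord \<rho> (f (e_vec \<tau>)))"
proof -
  have "f v = f (\<Sum>\<tau>\<in>involutions W. coord \<tau> v *\<^sub>C e_vec \<tau>)"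
    using coord_expand[OF v] by simp
  also have "\<dots> = (\<Sum>\<tau>\<in>involutions W. f (coord \<tau> v *\<^sub>C e_vec \<tau>))"
    by (intro intertwiner_sum[OF f M.subspace M.zero_mem] cvec.subspace_scale[OF M.subspace] e_vec_mem)
  also have "\<dots> = (\<Sum>\<tau>\<in>involutions W. coord \<tau> v *\<^sub>C f (e_vec \<tau>))"
    by (intro sum.cong refl intertwinerD(3)[OF f] e_vec_mem)
  moreover have "coord \<rho> (\<Sum>\<tau>\<in>S. coord \<tau> v *\<^sub>C f (e_vec \<tau>)) = (\<Sum>\<tau>\<in>S. coord \<tau> v * coord \<rho> (f (e_vec \<tau>)))" for S
    by (induction S rule: infinite_finite_induct)
      (simp_all add: clinear_zero[OF clinear_coord] clinear_add[OF clinear_coord]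
        clinear_scaleC[OF clinear_coord] scaleC_complex_def)
  ultimately show ?thesis
    by simp
qed

text \<open>The matrices of \<open>f\<close>, \<open>h\<close> and \<open>h \<circ> f\<close> are
  symmetric, the last being again that of an intertwiner. Transposing a product reverses its
  factors, so the order of composition is irrelevant.\<close>

sublocale M: commuting_rep W "model_space W" sym_act "e_vec ` involutions W"
proof
  show "finite (e_vec ` involutions W)"
    by (simp add: finite_involutions)
  show "model_space W = cvec.span (e_vec ` involutions W)"
    by (simp add: model_space_def)
  let ?I = "\<lambda>f. intertwiner W (model_space W) sym_act (model_space W) sym_act f"
  fix f h v assume f: "?I f" and h: "?I h" and v: "v \<in> model_space W"
  have fh: "?I (\<lambda>v. f (h v))" and hf: "?I (\<lambda>v. h (f v))"
    by (rule intertwiner_comp[OF h f], rule intertwiner_comp[OF f h])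
  have e: "coord \<rho> (f (h (e_vec \<tau>))) = coord \<rho> (h (f (e_vec \<tau>)))"
    if \<rho>: "\<rho> \<in> involutions W" and \<tau>: "\<tau> \<in> involutions W" for \<rho> \<tau>
  proof -
    have "coord \<rho> (f (h (e_vec \<tau>))) = (\<Sum>\<kappa>\<in>involutions W. coord \<kappa> (h (e_vec \<tau>)) * coord \<rho> (f (e_vec \<kappa>)))"
      by (rule coord_intertwiner[OF f intertwinerD(1)[OF h e_vec_mem[OF \<tau>]]])
    also have "\<dots> = (\<Sum>\<kappa>\<in>involutions W. coord \<kappa> (f (e_vec \<rho>)) * coord \<tau> (h (e_vec \<kappa>)))"
      by (intro sum.cong refl) (simp add: intertwiner_symmetric[OF h _ \<tau>] intertwiner_symmetric[OF f \<rho>])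
    also have "\<dots> = coord \<tau> (h (f (e_vec \<rho>)))"
      by (rule coord_intertwiner[OF h intertwinerD(1)[OF f e_vec_mem[OF \<rho>]], symmetric])
    also have "\<dots> = coord \<rho> (h (f (e_vec \<tau>)))"
      by (rule intertwiner_symmetric[OF hf \<tau> \<rho>])
    finally show ?thesis .
  qed
  show "f (h v) = h (f v)"
  proof (rule coord_eqI)
    show "f (h v) \<in> model_space W" "h (f v) \<in> model_space W"
      using intertwinerD(1)[OF fh v] intertwinerD(1)[OF hf v] .
    show "coord \<rho> (f (h v)) = coord \<rho> (h (f v))" if "\<rho> \<in> involutions W" for \<rho>
      unfolding coord_intertwiner[OF fh v] coord_intertwiner[OF hf v]
      by (intro sum.cong refl) (simp add: e[OF that])
  qed
qed

end

section \<open>All irreducible representations of \<open>weyl_B\<close> occur\<close>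

lemma prod_flip:
  "finite A \<Longrightarrow> (\<Prod>j\<in>A. if j = i then -1 else 1 :: int) = (if i \<in> A then -1 else 1)"
  by simp

interpretation B: weyl_subgroup weyl_B "carrier weyl_B :: 'n::{finite,linorder} signed_perm set"
proof (rule weyl_subgroup.intro)
  show "subgroup (carrier weyl_B) (weyl_B :: 'n signed_perm monoid)"
    by (rule group.subgroup_self[OF group_weyl_B])
  show "((\<lambda>_. 1), \<eta>) \<in> carrier weyl_B" if "bij \<eta>" for \<eta> :: "'n \<Rightarrow> 'n"
    using that by (auto simp: carrier_weyl_B)
  fix \<zeta> \<zeta>' :: "'n \<Rightarrow> int" and \<pi> \<pi>' :: "'n \<Rightarrow> 'n"
  assume inv: "(\<zeta>, \<pi>) \<in> involutions weyl_B" "(\<zeta>', \<pi>') \<in> involutions weyl_B"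
    and eq: "\<And>\<epsilon>. (\<epsilon>, id :: 'n \<Rightarrow> 'n) \<in> carrier weyl_B \<Longrightarrow> (\<Prod>i | \<zeta> i = -1. \<epsilon> i) = (\<Prod>i | \<zeta>' i = -1. \<epsilon> i)"
  have "\<zeta> i = \<zeta>' i" for i
  proof -
    \<comment> \<open>Changing the sign at the single index \<open>i\<close> tests whether
      \<open>\<zeta> i\<close> is -1.\<close>
    have "((\<lambda>j. if j = i then -1 else 1), id) \<in> carrier weyl_B"
      by (auto simp: carrier_weyl_B)
    from eq[OF this] have "\<zeta> i = -1 \<longleftrightarrow> \<zeta>' i = -1"
      by (simp add: prod_flip split: if_splits)
    then show ?thesis
      using inv sign_values(1)[of \<zeta> i] sign_values(1)[of \<zeta>' i] by (auto simp: involutions_weyl_B)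
  qed
  then show "\<zeta> = \<zeta>'"
    by (rule ext)
qed simp

section \<open>From a pair of involutions back to the conjugacy class\<close>

lemma zorbit_subset:
  fixes f :: "'a::finite \<Rightarrow> 'a"
  assumes f: "bij f" and S: "f ` S \<subseteq> S" "x \<in> S"
  shows "zorbit f x \<subseteq> S"
proof -
  have "bij_betw f S S"
    by (rule bij_betw_invariant[OF f]) (use S in auto)
  then have "f ` S = S"
    by (simp add: bij_betw_def)
  then have inv: "inv_into UNIV f y \<in> S" if "y \<in> S" for y
    using that inv_f_f[OF bij_is_inj[OF f]] by (metis imageE)
  have "zpow f k x \<in> S" for k
  proof (induction k rule: int_induct[where k = 0])
    case (step1 i)
    then show ?case
      using S by (auto simp: zpow_plus_1[OF f])
  next
    case (step2 i)
    then show ?case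
      using inv by (simp add: zpow_diff_1[OF f])
  qed (use S in simp)
  then show ?thesis
    by (auto simp: zorbit_def)
qed

text \<open>\<open>\<eta>\<close> is only known to respect the involutions, not the permutations
  \<open>f\<close> and \<open>f'\<close>. Orbits still correspond, since sets closed under
  \<open>s\<close> and \<open>s'\<close> are closed under \<open>f\<close>, and \<open>t\<close>,
  \<open>t'\<close> stay inside orbits of \<open>f'\<close>.\<close>

lemma zorbit_transfer:
  fixes f f' :: "'a::finite \<Rightarrow> 'a"
  assumes f: "bij f" and f': "bij f'"
    and closed: "\<And>S. s ` S \<subseteq> S \<Longrightarrow> s' ` S \<subseteq> S \<Longrightarrow> f ` S \<subseteq> S"
    and t: "\<And>x. t x \<in> zorbit f' x" "\<And>x. t' x \<in> zorbit f' x"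
    and \<eta>: "\<And>x. \<eta> (s x) = t (\<eta> x)" "\<And>x. \<eta> (s' x) = t' (\<eta> x)"
    and y: "y \<in> zorbit f x"
  shows "\<eta> y \<in> zorbit f' (\<eta> x)"
proof -
  define S where "S = {y. \<eta> y \<in> zorbit f' (\<eta> x)}"
  have "t z \<in> zorbit f' (\<eta> x)" "t' z \<in> zorbit f' (\<eta> x)" if "z \<in> zorbit f' (\<eta> x)" for z
    using t[of z] zorbit_eq[OF f' that] by simp_all
  then have "s ` S \<subseteq> S" "s' ` S \<subseteq> S"
    by (auto simp: S_def \<eta>)
  then have "zorbit f x \<subseteq> S"
    by (intro zorbit_subset[OF f] closed) (simp_all add: S_def)
  then show ?thesis
    using y by (auto simp: S_def)
qed

definition good_pair :: "('n::{finite,linorder} \<Rightarrow> 'n) \<Rightarrow> ('n \<Rightarrow> 'n) \<times> ('n \<Rightarrow> 'n) \<Rightarrow> bool" where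
  "good_pair \<pi> p \<longleftrightarrow> (\<forall>x. fst p (fst p x) = x) \<and> (\<forall>x. snd p (snd p x) = x) \<and>
     (\<forall>x. fst p x \<in> zorbit \<pi> x) \<and> (\<forall>x. snd p x \<in> zorbit \<pi> x) \<and>
     (\<forall>S. fst p ` S \<subseteq> S \<longrightarrow> snd p ` S \<subseteq> S \<longrightarrow> \<pi> ` S \<subseteq> S) \<and>
     (\<forall>g. bij g \<longrightarrow> (\<forall>x. g (fst p x) = fst p (g x)) \<longrightarrow> (\<forall>x. g (snd p x) = snd p (g x)) \<longrightarrow>
        osgn g (fst p) = osgn g (snd p))"

definition pair_of where "pair_of \<pi> = (SOME p. good_pair \<pi> p)"

lemma good_pair_of:
  assumes "bij \<pi>"
  shows "good_pair \<pi> (pair_of \<pi>)"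
proof -
  have "\<exists>p. good_pair \<pi> p"
  proof (rule ex_good_pair[OF assms])
    fix t t'
    assume "\<And>x. t (t x) = x" "\<And>x. t' (t' x) = x" "\<And>x. t x \<in> zorbit \<pi> x" "\<And>x. t' x \<in> zorbit \<pi> x"
      "\<And>S. t ` S \<subseteq> S \<Longrightarrow> t' ` S \<subseteq> S \<Longrightarrow> \<pi> ` S \<subseteq> S"
      "\<And>g. bij g \<Longrightarrow> (\<And>x. g (t x) = t (g x)) \<Longrightarrow> (\<And>x. g (t' x) = t' (g x)) \<Longrightarrow> osgn g t = osgn g t'"
    then have "good_pair \<pi> (t, t')"
      by (simp add: good_pair_def)
    then show ?thesis
      by blast
  qed
  then show ?thesis
    unfolding pair_of_def by (rule someI_ex)
qed

text \<open>The sign product of the cycle through \<open>i\<close>. Cycle lengths with these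
  products are the signed cycle type, which classifies conjugacy classes. Being constant on cycles,
  it can serve as the sign part of both involutions of the pair.\<close>

definition orbit_sign :: "'n signed_perm \<Rightarrow> 'n \<Rightarrow> int" where
  "orbit_sign g i = (\<Prod>y\<in>zorbit (snd g) i. fst g y)"

definition first_inv where "first_inv g = (orbit_sign g, fst (pair_of (snd g)))"
definition second_inv where "second_inv g = (orbit_sign g, snd (pair_of (snd g)))"

lemma class_involutions:
  assumes g: "g \<in> carrier weyl_B"
  shows "first_inv g \<in> involutions weyl_B" "second_inv g \<in> involutions weyl_B"
proof -
  have \<pi>: "bij (snd g)"
    using bij_carrier_weyl_B(1)[OF g] .
  have p: "good_pair (snd g) (pair_of (snd g))"
    by (rule good_pair_of[OF \<pi>])
  have "fst g y \<in> {1, -1}" for y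
    using g carrier_weyl_B[of "fst g" "snd g"] by auto
  then have "(\<Prod>y\<in>A. fst g y) \<in> {1, -1}" for A
    by (induction A rule: infinite_finite_induct) force+
  then have "range (orbit_sign g) \<subseteq> {1, -1}"
    unfolding orbit_sign_def by blast
  moreover have "orbit_sign g (fst (pair_of (snd g)) x) = orbit_sign g x"
    "orbit_sign g (snd (pair_of (snd g)) x) = orbit_sign g x" for x
  proof -
    have "fst (pair_of (snd g)) x \<in> zorbit (snd g) x" "snd (pair_of (snd g)) x \<in> zorbit (snd g) x"
      using p by (simp_all add: good_pair_def)
    then show "orbit_sign g (fst (pair_of (snd g)) x) = orbit_sign g x"
      "orbit_sign g (snd (pair_of (snd g)) x) = orbit_sign g x"
      unfolding orbit_sign_def by (simp_all only: zorbit_eq[OF \<pi>])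
  qed
  ultimately show "first_inv g \<in> involutions weyl_B" "second_inv g \<in> involutions weyl_B"
    using p by (simp_all add: first_inv_def second_inv_def involutions_weyl_B good_pair_def)
qed

text \<open>The pair remembers the cycles and their sign products. So \<open>x\<close> carries the
  signed cycles of \<open>h\<close> to those of \<open>g\<close>, and
  \<open>signed_perms_conjugate\<close> supplies the rest.\<close>

lemma conjugate_if_same_pair:
  assumes g: "g \<in> carrier weyl_B" and h: "h \<in> carrier weyl_B" and x: "x \<in> carrier weyl_B"
    and 1: "perm_act x (first_inv h) = first_inv g" and 2: "perm_act x (second_inv h) = second_inv g"
  shows "h \<in> B.M.conj_class g"
proof -
  define \<eta> where "\<eta> = snd x"
  have \<eta>: "bij \<eta>" "inv_into UNIV \<eta> (\<eta> i) = i" "\<eta> (inv_into UNIV \<eta> i) = i" for i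
    using bij_carrier_weyl_B[OF x] by (simp_all add: \<eta>_def)
  have \<pi>: "bij (snd g)" "bij (snd h)"
    using bij_carrier_weyl_B(1)[OF g] bij_carrier_weyl_B(1)[OF h] .
  note pg = good_pair_of[OF \<pi>(1)] and ph = good_pair_of[OF \<pi>(2)]
  have sgn: "orbit_sign g (\<eta> i) = orbit_sign h i" for i
    using perm_act_simps(1)[OF x, of "first_inv h" i] unfolding 1 by (simp add: first_inv_def \<eta>_def)
  have t: "\<eta> (fst (pair_of (snd h)) i) = fst (pair_of (snd g)) (\<eta> i)"
    "\<eta> (snd (pair_of (snd h)) i) = snd (pair_of (snd g)) (\<eta> i)" for i
    using perm_act_simps(2)[OF x, of "first_inv h" i] perm_act_simps(2)[OF x, of "second_inv h" i]
    unfolding 1 2 by (simp_all add: first_inv_def second_inv_def \<eta>_def)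
  have t_inv: "inv_into UNIV \<eta> (fst (pair_of (snd g)) i) = fst (pair_of (snd h)) (inv_into UNIV \<eta> i)"
    "inv_into UNIV \<eta> (snd (pair_of (snd g)) i) = snd (pair_of (snd h)) (inv_into UNIV \<eta> i)" for i
    using t[of "inv_into UNIV \<eta> i"] \<eta> by metis+
  have orb: "zorbit (snd g) (\<eta> i) = \<eta> ` zorbit (snd h) i" for i
  proof (intro equalityI subsetI)
    fix y assume "y \<in> \<eta> ` zorbit (snd h) i"
    then obtain z where z: "y = \<eta> z" "z \<in> zorbit (snd h) i"
      by blast
    show "y \<in> zorbit (snd g) (\<eta> i)"
      unfolding z(1)
      by (rule zorbit_transfer[where s = "fst (pair_of (snd h))" and s' = "snd (pair_of (snd h))" and
            t = "fst (pair_of (snd g))" and t' = "snd (pair_of (snd g))", OF \<pi>(2,1) _ _ _ t z(2)])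
        (use pg ph in \<open>simp_all only: good_pair_def\<close>)
  next
    fix y assume y: "y \<in> zorbit (snd g) (\<eta> i)"
    have "inv_into UNIV \<eta> y \<in> zorbit (snd h) (inv_into UNIV \<eta> (\<eta> i))"
      by (rule zorbit_transfer[where s = "fst (pair_of (snd g))" and s' = "snd (pair_of (snd g))" and
            t = "fst (pair_of (snd h))" and t' = "snd (pair_of (snd h))", OF \<pi> _ _ _ t_inv y])
        (use pg ph in \<open>simp_all only: good_pair_def\<close>)
    then show "y \<in> \<eta> ` zorbit (snd h) i"
      using \<eta> by (intro image_eqI[of y \<eta> "inv_into UNIV \<eta> y"]) simp_all
  qed
  \<comment> \<open>The transport of \<open>h\<close> along \<open>\<eta>\<close>, which has the
    same orbits and sign products as \<open>g\<close>. Thus \<open>p\<close> conjugates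
    \<open>h\<close> to \<open>h1\<close> and \<open>w\<close> conjugates \<open>g\<close> to
    \<open>h1\<close>.\<close>
  define \<zeta>1 where "\<zeta>1 = fst h \<circ> inv_into UNIV \<eta>"
  define \<pi>1 where "\<pi>1 = \<eta> \<circ> snd h \<circ> inv_into UNIV \<eta>"
  have \<pi>1: "bij \<pi>1"
    unfolding \<pi>1_def using \<pi> \<eta> by (intro bij_comp bij_imp_bij_inv)
  have \<pi>1\<eta>: "\<eta> (snd h i) = \<pi>1 (\<eta> i)" for i
    by (simp add: \<pi>1_def \<eta>)
  have orb1: "zorbit \<pi>1 z = zorbit (snd g) z" for z
  proof -
    have "zorbit \<pi>1 (\<eta> i) = \<eta> ` zorbit (snd h) i" for i
      using zpow_semiconj[OF \<pi>(2) \<pi>1, of \<eta>, OF \<pi>1\<eta>] by (simp add: zorbit_def image_image)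
    from this[of "inv_into UNIV \<eta> z"] orb[of "inv_into UNIV \<eta> z"] show ?thesis
      by (simp add: \<eta>)
  qed
  have rng: "range (fst g) \<subseteq> {1, -1}" "range \<zeta>1 \<subseteq> {1, -1}"
    using g h carrier_weyl_B[of "fst g" "snd g"] carrier_weyl_B[of "fst h" "snd h"]
    by (auto simp: \<zeta>1_def)
  have prods: "(\<Prod>y\<in>zorbit (snd g) z. fst g y) = (\<Prod>y\<in>zorbit (snd g) z. \<zeta>1 y)" for z
  proof -
    obtain i where z: "z = \<eta> i"
      using \<eta>(3)[of z] by metis
    have "(\<Prod>y\<in>zorbit (snd g) (\<eta> i). \<zeta>1 y) = (\<Prod>y\<in>zorbit (snd h) i. fst h y)"
      unfolding orb prod.reindex[OF inj_on_subset[OF bij_is_inj[OF \<eta>(1)] subset_UNIV]]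
      by (simp add: \<zeta>1_def \<eta>(2))
    then show ?thesis
      using sgn[of i] by (simp add: z orbit_sign_def)
  qed
  obtain \<epsilon> f where f: "range \<epsilon> \<subseteq> {1, -1 :: int}" "bij f" "\<And>i. f (snd g i) = \<pi>1 (f i)"
    "\<And>i. \<epsilon> (f (snd g i)) * fst g (snd g i) = \<zeta>1 (f (snd g i)) * \<epsilon> (f i)"
    by (rule signed_perms_conjugate[OF \<pi>(1) \<pi>1 orb1[symmetric] rng prods], rule that)
  define p where "p = ((\<lambda>_ :: 'a. 1 :: int), \<eta>)"
  define w where "w = (\<epsilon>, f)"
  define h1 where "h1 = (\<zeta>1, \<pi>1)"
  have carr: "p \<in> carrier weyl_B" "w \<in> carrier weyl_B" "h1 \<in> carrier weyl_B"
    using f \<eta> rng \<pi>1 by (auto simp: p_def w_def h1_def carrier_weyl_B)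
  have ph: "p \<otimes>\<^bsub>weyl_B\<^esub> h = h1 \<otimes>\<^bsub>weyl_B\<^esub> p"
    by (cases h) (simp add: p_def h1_def mult_weyl_B \<zeta>1_def \<pi>1_def fun_eq_iff \<eta>)
  have wg: "w \<otimes>\<^bsub>weyl_B\<^esub> g = h1 \<otimes>\<^bsub>weyl_B\<^esub> w"
  proof -
    have "\<epsilon> j * fst g (inv_into UNIV f j) = \<zeta>1 j * \<epsilon> (inv_into UNIV \<pi>1 j)" for j
    proof -
      define i where "i = inv_into UNIV (snd g) (inv_into UNIV f j)"
      have j: "snd g i = inv_into UNIV f j" "f (snd g i) = j"
        using \<pi>(1) f(2) by (simp_all add: i_def bij_is_surj surj_f_inv_f)
      then have "inv_into UNIV \<pi>1 j = f i"
        using f(3)[of i] \<pi>1 by (metis bij_is_inj inv_f_f)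
      then show ?thesis
        using f(4)[of i] j by simp
    qed
    then show ?thesis
      using f(3) by (cases g) (simp add: w_def h1_def mult_weyl_B fun_eq_iff)
  qed
  define k where "k = inv\<^bsub>weyl_B\<^esub> p \<otimes>\<^bsub>weyl_B\<^esub> w"
  have k: "k \<in> carrier weyl_B"
    using carr by (simp add: k_def)
  have "h = inv\<^bsub>weyl_B\<^esub> p \<otimes>\<^bsub>weyl_B\<^esub> (h1 \<otimes>\<^bsub>weyl_B\<^esub> p)"
    using carr h by (simp add: B.m_assoc[symmetric] flip: ph)
  then have "h \<otimes>\<^bsub>weyl_B\<^esub> inv\<^bsub>weyl_B\<^esub> p = inv\<^bsub>weyl_B\<^esub> p \<otimes>\<^bsub>weyl_B\<^esub> h1"
    using carr by (simp add: B.m_assoc)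
  then have "h \<otimes>\<^bsub>weyl_B\<^esub> k = inv\<^bsub>weyl_B\<^esub> p \<otimes>\<^bsub>weyl_B\<^esub> h1 \<otimes>\<^bsub>weyl_B\<^esub> w"
    using carr h by (simp add: k_def flip: B.m_assoc)
  also have "\<dots> = k \<otimes>\<^bsub>weyl_B\<^esub> g"
    using carr g by (simp add: k_def B.m_assoc wg)
  finally have "h = k \<otimes>\<^bsub>weyl_B\<^esub> g \<otimes>\<^bsub>weyl_B\<^esub> inv\<^bsub>weyl_B\<^esub> k"
    using B.inv_solve_right[of h "k \<otimes>\<^bsub>weyl_B\<^esub> g" k] h k g by simp
  then show ?thesis
    using k unfolding B.M.conj_class_def by blast
qed

text \<open>The sign parts coincide, so only the two values of \<open>osgn\<close> could differ, and
  the choice of a good pair excludes this. The stabilizer of the pair therefore causes no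
  cancellation.\<close>

lemma act_sign_class_involutions:
  assumes g: "g \<in> carrier weyl_B" and x: "x \<in> carrier weyl_B"
    and 1: "perm_act x (first_inv g) = first_inv g" and 2: "perm_act x (second_inv g) = second_inv g"
  shows "act_sign x (first_inv g) = act_sign x (second_inv g)"
proof -
  have "osgn (snd x) (fst (pair_of (snd g))) = osgn (snd x) (snd (pair_of (snd g)))"
    using good_pair_of[OF bij_carrier_weyl_B(1)[OF g]] bij_carrier_weyl_B(1)[OF x]
      perm_act_simps(2)[OF x, of "first_inv g"] perm_act_simps(2)[OF x, of "second_inv g"]
    unfolding good_pair_def 1 2 by (simp add: first_inv_def second_inv_def)
  then show ?thesis
    by (simp add: act_sign_def first_inv_def second_inv_def)
qed

text \<open>\<open>A h\<close> averages the elementary matrix that takes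
  \<open>e_vec (first_inv h)\<close> to \<open>e_vec (second_inv h)\<close>. Its entries vanish
  outside the orbit of that pair, which gives the triangularity, and at the pair itself the entry is
  the order of the stabilizer.\<close>

lemma weyl_B_occurs:
  fixes U :: "(nat \<Rightarrow>\<^sub>0 complex) set"
  assumes U: "irreducible_rep (weyl_B :: 'n::{finite,linorder} signed_perm monoid) U \<sigma>"
  shows "\<exists>f. intertwiner weyl_B U \<sigma> (model_space weyl_B) (sym_act :: 'n signed_perm \<Rightarrow> _) f \<and>
    (\<exists>u\<in>U. f u \<noteq> 0)"
proof -
  let ?B = "weyl_B :: 'n signed_perm monoid"
  define A :: "'n signed_perm \<Rightarrow> _ \<Rightarrow> _" where "A h v = (\<Sum>x\<in>carrier ?B. sym_act x (coord (first_inv h) (sym_act (inv\<^bsub>?B\<^esub> x) v) *\<^sub>C e_vec (second_inv h)))" for h v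
  \<comment> \<open>The inverse is moved to the other side: up to sign, the coefficient at
    \<open>\<rho>\<close> after applying the inverse of \<open>x\<close> is the coefficient at
    \<open>perm_act x \<rho>\<close> before.\<close>
  have coord_inv: "coord \<rho> (sym_act (inv\<^bsub>?B\<^esub> x) (e_vec \<tau>)) = (if perm_act x \<rho> = \<tau> then of_int (act_sign x \<rho>) else 0)"
    if x: "x \<in> carrier ?B" and \<rho>: "\<rho> \<in> involutions ?B" and \<tau>: "\<tau> \<in> involutions ?B" for x \<rho> \<tau>
  proof -
    have "sym_act x (sym_act (inv\<^bsub>?B\<^esub> x) (e_vec \<tau>)) = e_vec \<tau>"
    proof -
      have "sym_act x (sym_act (inv\<^bsub>?B\<^esub> x) (e_vec \<tau>)) = sym_act (x \<otimes>\<^bsub>?B\<^esub> inv\<^bsub>?B\<^esub> x) (e_vec \<tau>)"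
        using x by (simp only: sym_act_mult_e_vec B.inv_closed)
      then show ?thesis
        using x \<tau> by (simp add: sym_act_e_vec[OF B.one_closed] perm_act_one act_sign_one scaleC_one)
    qed
    moreover have "sym_act (inv\<^bsub>?B\<^esub> x) (e_vec \<tau>) \<in> model_space ?B"
      by (rule B.M.closed[OF B.inv_closed[OF x] B.e_vec_mem[OF \<tau>]])
    ultimately have "coord (perm_act x \<rho>) (e_vec \<tau>) = of_int (act_sign x \<rho>) * coord \<rho> (sym_act (inv\<^bsub>?B\<^esub> x) (e_vec \<tau>))"
      using B.coord_act[OF x \<rho>] by metis
    then have "of_int (act_sign x \<rho>) * coord (perm_act x \<rho>) (e_vec \<tau>) =
        of_int (act_sign x \<rho> * act_sign x \<rho>) * coord \<rho> (sym_act (inv\<^bsub>?B\<^esub> x) (e_vec \<tau>))"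
      by simp
    then show ?thesis
      using x \<rho> \<tau> by (simp add: act_sign_square coord_e_vec perm_act_involution split: if_splits)
  qed
  have entry: "coord (second_inv g) (A h (e_vec (first_inv g))) =
      (\<Sum>x\<in>carrier ?B. if perm_act x (first_inv h) = first_inv g \<and> perm_act x (second_inv h) = second_inv g
        then of_int (act_sign x (first_inv h) * act_sign x (second_inv h)) else 0)"
    if g: "g \<in> carrier ?B" and h: "h \<in> carrier ?B" for g h
  proof -
    have sum: "coord \<rho> (\<Sum>x\<in>S. f x) = (\<Sum>x\<in>S. coord \<rho> (f x))" for \<rho> :: "'n signed_perm" and S :: "'n signed_perm set" and f
      by (induction S rule: infinite_finite_induct)
        (simp_all add: clinear_zero[OF clinear_coord] clinear_add[OF clinear_coord])
    show ?thesis
      unfolding A_def sum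
    proof (rule sum.cong)
      fix x assume x: "x \<in> carrier ?B"
      show "coord (second_inv g) (sym_act x (coord (first_inv h) (sym_act (inv\<^bsub>?B\<^esub> x) (e_vec (first_inv g))) *\<^sub>C e_vec (second_inv h))) =
        (if perm_act x (first_inv h) = first_inv g \<and> perm_act x (second_inv h) = second_inv g
          then of_int (act_sign x (first_inv h) * act_sign x (second_inv h)) else 0)"
        unfolding coord_inv[OF x class_involutions(1)[OF h] class_involutions(1)[OF g]]
        using x class_involutions[OF g] class_involutions[OF h]
        by (simp add: sym_act_scaleC clinear_scaleC[OF clinear_coord] sym_act_e_vec
            coord_e_vec perm_act_involution scaleC_complex_def)
    qed simp
  qed
  show ?thesis
  proof (rule B.M.irreducible_rep_occurs[where A = A and w = "\<lambda>g. e_vec (first_inv g)" and l = "\<lambda>g. coord (second_inv g)", OF _ _ _ _ _ U])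
    fix g :: "'n signed_perm" assume g: "g \<in> carrier ?B"
    note i = class_involutions[OF g]
    show "e_vec (first_inv g) \<in> model_space ?B"
      by (rule B.e_vec_mem[OF i(1)])
    show "clinear (coord (second_inv g) :: _ \<Rightarrow> complex)"
      by (rule clinear_coord)
    show "intertwiner ?B (model_space ?B) sym_act (model_space ?B) sym_act (A g)"
      unfolding A_def
      by (rule intertwiner_average[OF B.complex_rep_W B.complex_rep_W])
        (simp_all add: cvec.subspace_scale[OF B.M.subspace B.e_vec_mem[OF i(2)]] scaleC_add_left
          clinear_add[OF clinear_coord] clinear_scaleC[OF clinear_coord] scaleC_scaleC scaleC_complex_def)
    define S where "S = {x \<in> carrier ?B. perm_act x (first_inv g) = first_inv g \<and> perm_act x (second_inv g) = second_inv g}"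
    have "coord (second_inv g) (A g (e_vec (first_inv g))) =
        (\<Sum>x\<in>carrier ?B. if perm_act x (first_inv g) = first_inv g \<and> perm_act x (second_inv g) = second_inv g then 1 else 0)"
      unfolding entry[OF g g] by (rule sum.cong) (auto simp: act_sign_class_involutions[OF g] act_sign_square)
    also have "\<dots> = of_nat (card S)"
      unfolding S_def by (simp add: sum.inter_filter[OF finite_weyl_B, symmetric])
    also have "\<dots> \<noteq> 0"
    proof -
      have "\<one>\<^bsub>?B\<^esub> \<in> S"
        by (simp add: S_def perm_act_one)
      moreover have "finite S"
        unfolding S_def using finite_weyl_B by (rule rev_finite_subset) blast
      ultimately have "card S > 0"
        unfolding card_gt_0_iff by blast
      then show ?thesis
        by simp
    qed
    finally show "coord (second_inv g) (A g (e_vec (first_inv g))) \<noteq> 0" .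
    fix h :: "'n signed_perm" assume h: "h \<in> carrier ?B"
      and nz: "coord (second_inv g) (A h (e_vec (first_inv g))) \<noteq> 0"
    have "\<exists>x\<in>carrier ?B. perm_act x (first_inv h) = first_inv g \<and> perm_act x (second_inv h) = second_inv g"
    proof (rule ccontr)
      assume "\<not> ?thesis"
      then have "coord (second_inv g) (A h (e_vec (first_inv g))) = 0"
        unfolding entry[OF g h] by (intro sum.neutral) auto
      with nz show False
        by contradiction
    qed
    then obtain x where "x \<in> carrier ?B" "perm_act x (first_inv h) = first_inv g" "perm_act x (second_inv h) = second_inv g"
      by blast
    then show "h \<in> B.M.conj_class g"
      by (rule conjugate_if_same_pair[OF g h])
  qed
qed

context weyl_subgroup
begin

text \<open>The irreducible representations of \<open>W\<close> pull back along the retraction \<open>\<phi>\<close>, and the elements of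
  the kernel of \<open>\<phi>\<close> change the sign of the vectors that do not belong to the module of \<open>W\<close>.\<close>

lemma gelfand_model_if_retract:
  assumes \<phi>: "\<And>w. w \<in> carrier weyl_B \<Longrightarrow> \<phi> w \<in> C" "\<And>w. w \<in> C \<Longrightarrow> \<phi> w = w"
      "\<And>w w'. w \<in> carrier weyl_B \<Longrightarrow> w' \<in> carrier weyl_B \<Longrightarrow> \<phi> (w \<otimes>\<^bsub>weyl_B\<^esub> w') = \<phi> w \<otimes>\<^bsub>weyl_B\<^esub> \<phi> w'"
    and ker: "\<And>\<tau>. \<tau> \<in> involutions weyl_B \<Longrightarrow> \<tau> \<notin> C \<Longrightarrow>
      \<exists>w\<in>carrier weyl_B. \<phi> w = \<one>\<^bsub>weyl_B\<^esub> \<and> perm_act w \<tau> = \<tau> \<and> act_sign w \<tau> = -1"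
  shows "gelfand_model W (model_space W) sym_act"
proof (rule M.gelfand_modelI)
  fix U :: "(nat \<Rightarrow>\<^sub>0 complex) set" and \<sigma>
  assume U: "irreducible_rep W U \<sigma>"
  then interpret U: complex_rep W U \<sigma>
    by (simp add: irreducible_rep_def)
  define \<sigma>' where "\<sigma>' w = \<sigma> (\<phi> w)" for w
  have one: "\<phi> \<one>\<^bsub>weyl_B\<^esub> = \<one>\<^bsub>weyl_B\<^esub>"
    using \<phi>(2) subgroup.one_closed[OF sub] by blast
  have "complex_rep weyl_B U \<sigma>'"
  proof
    show "cvec.subspace U"
      by (rule U.subspace)
    fix g h :: "'n signed_perm" and v w c assume v: "v \<in> U"
    show "\<sigma>' \<one>\<^bsub>weyl_B\<^esub> v = v"
      using U.one[OF v] by (simp add: \<sigma>'_def one W_simps)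
    assume g: "g \<in> carrier weyl_B"
    show "\<sigma>' g v \<in> U" "\<sigma>' g (c *\<^sub>C v) = c *\<^sub>C \<sigma>' g v"
      using \<phi>(1)[OF g] v by (simp_all add: \<sigma>'_def U.closed U.scaleC W_simps)
    show "\<sigma>' g (v + w) = \<sigma>' g v + \<sigma>' g w" if "w \<in> U"
      using \<phi>(1)[OF g] v that by (simp add: \<sigma>'_def U.add W_simps)
    show "\<sigma>' (g \<otimes>\<^bsub>weyl_B\<^esub> h) v = \<sigma>' g (\<sigma>' h v)" if h: "h \<in> carrier weyl_B"
      using U.mult[of "\<phi> g" "\<phi> h" v] \<phi>(1)[OF g] \<phi>(1)[OF h] v by (simp add: \<sigma>'_def \<phi>(3)[OF g h] W_simps)
  qed
  \<comment> \<open>\<open>\<phi>\<close> is the identity on \<open>C\<close>, so a subspace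
    invariant under the pullback is invariant under \<open>W\<close>.\<close>
  then have "irreducible_rep weyl_B U \<sigma>'"
    using U \<phi>(2) carrier_W unfolding irreducible_rep_def \<sigma>'_def W_simps by metis
  then obtain f u where f: "intertwiner weyl_B U \<sigma>' (model_space weyl_B) sym_act f" "u \<in> U" "f u \<noteq> 0"
    using weyl_B_occurs by blast
  have fW: "f v \<in> model_space W" if v: "v \<in> U" for v
  proof -
    have fv: "f v \<in> model_space weyl_B"
      by (rule intertwinerD(1)[OF f(1) v])
    have "coord \<tau> (f v) *\<^sub>C e_vec \<tau> \<in> model_space W" if \<tau>: "\<tau> \<in> involutions weyl_B" for \<tau>
    proof (cases "\<tau> \<in> C")
      case True
      then show ?thesis
        using \<tau> by (intro cvec.subspace_scale[OF M.subspace] e_vec_mem) (simp add: involutions_W)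
    next
      case False
      then obtain w where w: "w \<in> carrier weyl_B" "\<phi> w = \<one>\<^bsub>weyl_B\<^esub>" "perm_act w \<tau> = \<tau>" "act_sign w \<tau> = -1"
        using ker[OF \<tau>] by blast
      have "sym_act w (f v) = f (\<sigma>' w v)"
        using intertwinerD(4)[OF f(1) v w(1)] by simp
      also have "\<dots> = f v"
        using U.one[OF v] by (simp add: \<sigma>'_def w W_simps)
      finally have "coord \<tau> (f v) = - coord \<tau> (f v)"
        using B.coord_act[OF w(1) \<tau> fv] by (simp add: w)
      then have "coord \<tau> (f v) = 0"
        by simp
      then show ?thesis
        using M.zero_mem by simp
    qed
    then have "(\<Sum>\<tau>\<in>involutions weyl_B. coord \<tau> (f v) *\<^sub>C e_vec \<tau>) \<in> model_space W"
      by (intro cvec.subspace_sum[OF M.subspace])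
    then show ?thesis
      using B.coord_expand[OF fv] by simp
  qed
  have "intertwiner W U \<sigma> (model_space W) sym_act f"
    using f(1) fW carrier_W \<phi>(2) unfolding intertwiner_def \<sigma>'_def W_simps by metis
  then show "\<exists>f. intertwiner W U \<sigma> (model_space W) sym_act f \<and> (\<exists>u\<in>U. f u \<noteq> 0)"
    using f(2,3) by blast
qed

end

section \<open>The three series\<close>

lemma gelfand_model_weyl_B:
  "gelfand_model weyl_B (model_space weyl_B) (sym_act :: 'n::{finite,linorder} signed_perm \<Rightarrow> _)"
  by (rule B.gelfand_model_if_retract[where \<phi> = id]) (simp_all add: involutions_def)

lemma gelfand_model_weyl_A:
  "gelfand_model weyl_A (model_space weyl_A) (sym_act :: 'n::{finite,linorder} signed_perm \<Rightarrow> _)"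
proof -
  let ?C = "{(\<zeta>, \<pi>) \<in> carrier weyl_B. \<zeta> = (\<lambda>_. 1)} :: 'n signed_perm set"
  interpret B: group "weyl_B :: 'n signed_perm monoid"
    by (rule group_weyl_B)
  have C: "w \<in> ?C \<longleftrightarrow> w \<in> carrier weyl_B \<and> fst w = (\<lambda>_. 1)" for w
    by auto
  have inv: "inv\<^bsub>weyl_B\<^esub> ((\<lambda>_. 1), \<pi>) = ((\<lambda>_. 1), inv_into UNIV \<pi>)" if "bij \<pi>" for \<pi> :: "'n \<Rightarrow> 'n"
    using that by (intro B.inv_equality) (auto simp: mult_weyl_B one_weyl_B carrier_weyl_B bij_imp_bij_inv
        bij_is_inj inv_o_cancel)
  interpret A: weyl_subgroup weyl_A ?C
  proof (rule weyl_subgroup.intro)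
    show "weyl_A = weyl_B\<lparr>carrier := ?C\<rparr>"
      by (simp add: weyl_A_def)
    show "subgroup ?C weyl_B"
      by (rule B.subgroupI)
        (auto simp: mult_weyl_B inv carrier_weyl_B bij_imp_bij_inv bij_comp intro!: exI[of _ id])
    show "((\<lambda>_. 1), \<eta>) \<in> ?C" if "bij \<eta>" for \<eta> :: "'n \<Rightarrow> 'n"
      using that by (auto simp: carrier_weyl_B)
  qed (auto simp: involutions_def weyl_A_def)
  show ?thesis
  proof (rule A.gelfand_model_if_retract[where \<phi> = "\<lambda>w. ((\<lambda>_. 1), snd w)"])
    fix w w' :: "'n signed_perm"
    assume w: "w \<in> carrier weyl_B"
    show "((\<lambda>_. 1), snd w) \<in> ?C"
      using bij_carrier_weyl_B(1)[OF w] by (auto simp: carrier_weyl_B)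
    show "((\<lambda>_. 1), snd (w \<otimes>\<^bsub>weyl_B\<^esub> w')) = ((\<lambda>_. 1), snd w) \<otimes>\<^bsub>weyl_B\<^esub> ((\<lambda>_. 1), snd w')"
      by (cases w; cases w') (simp add: mult_weyl_B)
  next
    fix \<tau> :: "'n signed_perm" assume \<tau>: "\<tau> \<in> involutions weyl_B" "\<tau> \<notin> ?C"
    then have "fst \<tau> \<noteq> (\<lambda>_. 1)"
      by (auto simp: involutions_def)
    then obtain i where "fst \<tau> i \<noteq> 1"
      by (auto simp: fun_eq_iff)
    then have i: "fst \<tau> i = -1"
      using \<tau>(1) involutions_weyl_B[of "fst \<tau>" "snd \<tau>"] sign_values(1)[of "fst \<tau>" i] by auto
    \<comment> \<open>The sign change at one index where \<open>\<tau>\<close> has sign -1: it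
      disappears when signs are forgotten, but negates \<open>e_vec \<tau>\<close>.\<close>
    let ?w = "((\<lambda>j. if j = i then -1 else 1 :: int), id :: 'n \<Rightarrow> 'n)"
    have "?w \<in> carrier weyl_B"
      by (auto simp: carrier_weyl_B)
    moreover have "((\<lambda>_. 1), snd ?w) = \<one>\<^bsub>weyl_B\<^esub>"
      by (simp add: one_weyl_B)
    moreover have "perm_act ?w \<tau> = \<tau>"
      by (simp add: perm_act_def)
    moreover have "act_sign ?w \<tau> = -1"
      using i by (simp add: act_sign_def osgn_def)
    ultimately show "\<exists>w\<in>carrier weyl_B. ((\<lambda>_. 1), snd w) = \<one>\<^bsub>weyl_B\<^esub> \<and> perm_act w \<tau> = \<tau> \<and> act_sign w \<tau> = -1"
      by blast
  qed auto
qed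

lemma prod_signs:
  fixes \<zeta> :: "'n::finite \<Rightarrow> int"
  assumes "range \<zeta> \<subseteq> {1, -1}"
  shows "(\<Prod>i\<in>UNIV. \<zeta> i) = (-1) ^ card {i. \<zeta> i = -1}"
proof -
  have "(\<Prod>i\<in>UNIV. \<zeta> i) = (\<Prod>i\<in>UNIV. if \<zeta> i = -1 then -1 else 1)"
    by (rule prod.cong) (use sign_values(1)[OF assms] in auto)
  then show ?thesis
    by (simp add: prod.If_cases)
qed

text \<open>For odd N the central element -1 has sign product -1 and complements the series D in B.
  The retraction multiplies \<open>w\<close> by the scalar \<open>d w\<close>.\<close>

lemma gelfand_model_weyl_D:
  assumes N: "odd CARD('n::{finite,linorder})"
  shows "gelfand_model weyl_D (model_space weyl_D) (sym_act :: 'n signed_perm \<Rightarrow> _)"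
proof -
  let ?C = "{(\<zeta>, \<pi>) \<in> carrier weyl_B. (\<Prod>i\<in>UNIV. \<zeta> i) = 1} :: 'n signed_perm set"
  define d where "d w = (\<Prod>i\<in>UNIV. fst w i)" for w :: "'n signed_perm"
  interpret B: group "weyl_B :: 'n signed_perm monoid"
    by (rule group_weyl_B)
  have C: "w \<in> ?C \<longleftrightarrow> w \<in> carrier weyl_B \<and> d w = 1" for w
    by (auto simp: d_def)
  have d_mult: "d (w \<otimes>\<^bsub>weyl_B\<^esub> w') = d w * d w'" if "w \<in> carrier weyl_B" for w w' :: "'n signed_perm"
  proof -
    have "(\<Prod>j\<in>UNIV. fst w' (inv_into UNIV (snd w) j)) = d w'"
      unfolding d_def by (rule prod.reindex_bij_betw) (simp add: bij_imp_bij_inv bij_carrier_weyl_B(1)[OF that])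
    then show ?thesis
      by (cases w; cases w') (simp add: d_def mult_weyl_B prod.distrib)
  qed
  have d_one: "d \<one>\<^bsub>weyl_B\<^esub> = 1"
    by (simp add: d_def one_weyl_B)
  have d_sign: "d w = 1 \<or> d w = -1" if "w \<in> carrier weyl_B" for w
    using that carrier_weyl_B[of "fst w" "snd w"] prod_signs[of "fst w"]
    by (simp add: d_def minus_one_power_iff)
  interpret D: weyl_subgroup weyl_D ?C
  proof (rule weyl_subgroup.intro)
    show "weyl_D = weyl_B\<lparr>carrier := ?C\<rparr>"
      by (simp add: weyl_D_def)
    show "subgroup ?C weyl_B"
    proof (rule B.subgroupI)
      show "?C \<subseteq> carrier weyl_B" "?C \<noteq> {}"
        using C[of "\<one>\<^bsub>weyl_B\<^esub>"] d_one by auto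
      show "inv\<^bsub>weyl_B\<^esub> w \<in> ?C" if "w \<in> ?C" for w
      proof -
        have "d (inv\<^bsub>weyl_B\<^esub> w) * d w = d (inv\<^bsub>weyl_B\<^esub> w \<otimes>\<^bsub>weyl_B\<^esub> w)"
          using that unfolding C by (intro d_mult[symmetric]) simp
        then show ?thesis
          using that unfolding C by (simp add: d_one)
      qed
      show "w \<otimes>\<^bsub>weyl_B\<^esub> w' \<in> ?C" if "w \<in> ?C" "w' \<in> ?C" for w w'
        using that unfolding C by (simp add: d_mult)
    qed
    show "((\<lambda>_. 1), \<eta>) \<in> ?C" if "bij \<eta>" for \<eta> :: "'n \<Rightarrow> 'n"
      using that by (auto simp: carrier_weyl_B)
    fix \<zeta> \<zeta>' :: "'n \<Rightarrow> int" and \<pi> \<pi>' :: "'n \<Rightarrow> 'n"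
    assume inv: "(\<zeta>, \<pi>) \<in> involutions weyl_D" "(\<zeta>', \<pi>') \<in> involutions weyl_D"
      and eq: "\<And>\<epsilon>. (\<epsilon>, id :: 'n \<Rightarrow> 'n) \<in> ?C \<Longrightarrow> (\<Prod>i | \<zeta> i = -1. \<epsilon> i) = (\<Prod>i | \<zeta>' i = -1. \<epsilon> i)"
    have \<zeta>: "range \<zeta> \<subseteq> {1, -1}" "(\<Prod>i\<in>UNIV. \<zeta> i) = 1" and \<zeta>': "range \<zeta>' \<subseteq> {1, -1}" "(\<Prod>i\<in>UNIV. \<zeta>' i) = 1"
      using inv by (auto simp: involutions_def weyl_D_def carrier_weyl_B)
    \<comment> \<open>Changing two signs at once stays in the group and shows that the two sign
      parts agree everywhere or differ everywhere. In the second case their sign products would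
      differ by -1 to an odd power.\<close>
    have *: "\<zeta> i * \<zeta>' i = \<zeta> j * \<zeta>' j" if "i \<noteq> j" for i j
    proof -
      have "(\<Prod>k\<in>A. if k = i \<or> k = j then -1 else 1 :: int) = (if i \<in> A then -1 else 1) * (if j \<in> A then -1 else 1)" for A :: "'n set"
      proof -
        have "(\<Prod>k\<in>A. if k = i \<or> k = j then -1 else 1 :: int) =
            (\<Prod>k\<in>A. (if k = i then -1 else 1) * (if k = j then -1 else 1))"
          by (rule prod.cong) (use that in auto)
        then show ?thesis
          by (simp add: prod.distrib prod_flip)
      qed
      note fl = this
      have "((\<lambda>k. if k = i \<or> k = j then -1 else 1), id) \<in> ?C"
        by (auto simp: carrier_weyl_B fl)
      from eq[OF this] show ?thesis
        using sign_values(1)[OF \<zeta>(1), of i] sign_values(1)[OF \<zeta>(1), of j]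
          sign_values(1)[OF \<zeta>'(1), of i] sign_values(1)[OF \<zeta>'(1), of j]
        by (auto simp: fl)
    qed
    define c where "c = \<zeta> undefined * \<zeta>' undefined"
    have c: "\<zeta> i * \<zeta>' i = c" for i
      using *[of i undefined] by (cases "i = undefined") (simp_all add: c_def)
    have "c ^ CARD('n) = (\<Prod>i\<in>(UNIV :: 'n set). \<zeta> i * \<zeta>' i)"
      by (simp add: c)
    also have "\<dots> = 1"
      using \<zeta> \<zeta>' by (simp add: prod.distrib)
    finally have "c \<noteq> -1"
      using N by auto
    then have "\<zeta> i = \<zeta>' i" for i
      using c[of i] sign_values(1)[OF \<zeta>(1), of i] sign_values(1)[OF \<zeta>'(1), of i] by auto
    then show "\<zeta> = \<zeta>'"
      by (rule ext)
  qed
  show ?thesis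
  proof (rule D.gelfand_model_if_retract[where \<phi> = "\<lambda>w. ((\<lambda>i. d w * fst w i), snd w)"])
    fix w :: "'n signed_perm"
    show "((\<lambda>i. d w * fst w i), snd w) = w" if "w \<in> ?C"
      using that unfolding C by simp
    assume w: "w \<in> carrier weyl_B"
    have "fst w i = 1 \<or> fst w i = -1" for i
      using w carrier_weyl_B[of "fst w" "snd w"] sign_values(1)[of "fst w" i] by simp
    then have "range (\<lambda>i. d w * fst w i) \<subseteq> {1, -1}"
      using d_sign[OF w] by fastforce
    moreover have "d ((\<lambda>i. d w * fst w i), snd w) = 1"
      using d_sign[OF w] N by (auto simp: d_def[of "(_, _)"] prod.distrib d_def[symmetric])
    ultimately show "((\<lambda>i. d w * fst w i), snd w) \<in> ?C"
      unfolding C using bij_carrier_weyl_B(1)[OF w] by (simp add: carrier_weyl_B)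
    show "((\<lambda>i. d (w \<otimes>\<^bsub>weyl_B\<^esub> w') * fst (w \<otimes>\<^bsub>weyl_B\<^esub> w') i), snd (w \<otimes>\<^bsub>weyl_B\<^esub> w')) =
      ((\<lambda>i. d w * fst w i), snd w) \<otimes>\<^bsub>weyl_B\<^esub> ((\<lambda>i. d w' * fst w' i), snd w')" for w'
      unfolding d_mult[OF w] by (cases w; cases w') (simp add: mult_weyl_B fun_eq_iff)
  next
    fix \<tau> :: "'n signed_perm" assume \<tau>: "\<tau> \<in> involutions weyl_B" "\<tau> \<notin> ?C"
    then have \<tau>B: "\<tau> \<in> carrier weyl_B" "d \<tau> = -1"
      using d_sign[of \<tau>] C[of \<tau>] by (auto simp: involutions_def)
    \<comment> \<open>The element -1 lies in the kernel of the retraction and acts on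
      \<open>e_vec \<tau>\<close> by -1 to the number of negative signs of \<open>\<tau>\<close>,
      that is by \<open>d \<tau>\<close>.\<close>
    let ?w = "((\<lambda>_. -1 :: int), id :: 'n \<Rightarrow> 'n)"
    have "?w \<in> carrier weyl_B"
      by (auto simp: carrier_weyl_B)
    moreover have "((\<lambda>i. d ?w * fst ?w i), snd ?w) = \<one>\<^bsub>weyl_B\<^esub>"
      using N by (simp add: one_weyl_B d_def)
    moreover have "perm_act ?w \<tau> = \<tau>"
      by (simp add: perm_act_def)
    moreover have "act_sign ?w \<tau> = -1"
      using \<tau>B carrier_weyl_B[of "fst \<tau>" "snd \<tau>"] prod_signs[of "fst \<tau>"] by (simp add: act_sign_def osgn_def d_def)
    ultimately show "\<exists>w\<in>carrier weyl_B. ((\<lambda>i. d w * fst w i), snd w) = \<one>\<^bsub>weyl_B\<^esub> \<and> perm_act w \<tau> = \<tau> \<and> act_sign w \<tau> = -1"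
      by blast
  qed
qed

theorem theorem2p7:
  fixes n :: nat and W :: "'n::{finite, linorder} signed_perm monoid"
  assumes "n \<ge> 1"
    and "(W = weyl_A \<and> CARD('n) = n + 1) \<or>
         (W = weyl_B \<and> CARD('n) = n) \<or>
         (W = weyl_D \<and> CARD('n) = 2 * n + 1)"
  shows "gelfand_model W (model_space W) sym_act"
  using assms(2) gelfand_model_weyl_A gelfand_model_weyl_B gelfand_model_weyl_D[where 'n = 'n] by auto

end
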